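(* Let $1\le r\le d$, $\mu_0^*\in\Sigma_r^*\subset\mathbb{C}^{2r}$, let $(w_0,g_0)$ be a solution of the rank-restricted Prony problem with input $\mu_0^*$, and let $w_0$ be subordinated to a configuration $\mathcal{C}=\{X_j\}_{j=1}^{s(\mathcal{C})}$ of $\{1,\dots,r\}$. For $\mu^*=(m_0,\dots,m_{2r-1})\in\mathbb{C}^{2r}$ in a small neighborhood of $\mu_0^*$ let $w(\mu^* )$ be the (multivalued) node function described in the context, and let $\{\beta_{j,\ell}\}_{1\le j\le s(\mathcal{C}),\,1\le\ell\le|X_j|}$ be the coordinates, with respect to the basis $\mathcal{B}_{\mathcal{C}}(w(\mu^* ))=\{\Delta_{X_{j,\ell}}(w(\mu^* ))\}$ of $V_{w(\mu^* )}$, of the solution of the rank-restricted Prony problem with input $\mu^*$, i.e. the solution of the linear system $$\sum_{j,\ell}\beta_{j,\ell}\,\Delta_{X_{j,\ell}}(w(\mu^* ))(x^k)=m_k,\qquad k=0,1,\dots,2r-1.$$ Then the coordinates $\beta_{j,\ell}$ are (multivalued) algebraic functions of $\mu^*$, continuous in a neighborhood of the point $\mu_0^*$.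
   Context: **The set $\Sigma_r^*$.** For $\mu=(m_0,\dots,m_{2d-1})\in\mathbb{C}^{2d}$ let $\tilde M_d=(m_{i+j})_{0\le i\le d-1,\,0\le j\le d}$ and $M_r=(m_{i+j})_{0\le i,j\le r-1}$. $\Sigma_r$ is the set of $\mu$ with $\operatorname{rank}\tilde M_d=r$ and $\det M_r\ne0$; $\Sigma_r^*\subset\mathbb{C}^{2r}$ is its image under projection to the first $2r$ coordinates. **Rank-restricted Prony problem.** For $w=(x_1,\dots,x_r)\in\mathbb{C}^r$ with distinct values $\tau_1,\dots,\tau_s$ of multiplicities $d_1,\dots,d_s$, $V_w$ is the $r$-dimensional space of linear combinations of $\delta^{(\ell)}(x-\tau_j)$, $0\le\ell<d_j$, viewed as functionals ($\delta^{(\ell)}(x-\tau)$ acts, up to the irrelevant sign $(-1)^\ell$, as $f\mapsto f^{(\ell)}(\tau)$). Given $\mu^*=(m_0,\dots,m_{2r-1})$, find $w\in\mathbb{C}^r$ and $g\in V_w$ with $g(x^k)=\int x^k g(x)\,dx=m_k$ for $k=0,\dots,2r-1$. **Divided differences and $\mathcal{B}_{\mathcal{C}}$.** For points $y_1,\dots,y_n$ (repetitions allowed), $\Delta^{n-1}(y_1,\dots,y_n)f$ is the coefficient of $x^{n-1}$ in the Hermite interpolation polynomial $P$ of degree $\le n-1$ with $P^{(\ell)}(y_j)=f^{(\ell)}(y_j)$ for $0\le\ell<\#\{i:y_i=y_j\}$. For $X=\{n_1<\dots<n_\alpha\}\subseteq\{1,\dots,r\}$ put $\Delta_X(w)=\Delta^{\alpha-1}(x_{n_1},\dots,x_{n_\alpha})$.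 A configuration $\mathcal{C}=\{X_j\}$ is a partition of $\{1,\dots,r\}$ into nonempty subsets; $X_{j,\ell}$ is the set of the $\ell$ smallest elements of $X_j$; $\mathcal{B}_{\mathcal{C}}(w)=\{\Delta_{X_{j,\ell}}(w)\}_{j,\;1\le\ell\le|X_j|}$. The point $w$ is subordinated to $\mathcal{C}$ if $x_k=x_\ell$, $k\ne\ell$, implies that $k,\ell$ lie in the same $X_j$. **The function $w(\mu^* )$.** For $\mu^*$ near $\mu_0^*$ there is a unique rational function $R_{\mu^*}=P_{\mu^*}/Q_{\mu^*}$ (irreducible, $Q_{\mu^*}$ monic of degree $r$, $\deg P_{\mu^*}<r$) whose first $2r$ Taylor coefficients at infinity, i.e. coefficients of $z^{-k-1}$, $0\le k\le 2r-1$, are $\mu^*$; it depends continuously on $\mu^*$. Let $\tau_1,\dots,\tau_s$ be the distinct coordinates of $w_0$ and $\delta=\min_{i\ne j}|\tau_i-\tau_j|$. Choose $\mu_1^*$ close to $\mu_0^*$ such that all roots of $Q_{\mu_1^*}$ are distinct and are grouped into $s$ clusters, the $j$-th within distance $\delta/3$ of $\tau_j$. Enumerate the roots within each cluster arbitrarily, the indices of the $j$-th cluster being the positions at which $\tau_j$ occurs in $w_0$. This defines near $\mu_1^*$ algebraic functions $x_1(\mu^* ),\dots,x_r(\mu^* )$ with $Q_{\mu^*}(z)=\prod_{j=1}^r(z-x_j(\mu^* ))$, which are extended by analytic continuation to the whole neighborhood of $\mu_0^*$. Then $w(\mu^* )=(x_1(\mu^* ),\dots,x_r(\mu^* ))$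 is a continuous multivalued algebraic function near $\mu_0^*$ with $w(\mu_0^* )=w_0$. *)

theory Defs
  imports
    "HOL-Analysis.Analysis"
    "HOL-Library.Disjoint_Sets"
    "Jordan_Normal_Form.Determinant"
    "Jordan_Normal_Form.DL_Rank"
begin

(* Vectors with entries indexed by a finite set I of naturals are functions that are
   extensional on I. The topology of cspace I is the subspace topology of the product
   topology on nat => complex, i.e. the usual topology of C^I. *)

type_synonym cvec = "nat \<Rightarrow> complex"
type_synonym functional = "(complex \<Rightarrow> complex) \<Rightarrow> complex"

definition cspace :: "nat set \<Rightarrow> cvec set" where
  "cspace I = (I \<rightarrow>\<^sub>E UNIV)"

definition polydisc :: "nat set \<Rightarrow> cvec \<Rightarrow> real \<Rightarrow> cvec set" where
  "polydisc I p \<epsilon> = (\<Pi>\<^sub>E i\<in>I. ball (p i) \<epsilon>)"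


subsection \<open>The sets of moment vectors\<close>

definition hankel :: "nat \<Rightarrow> nat \<Rightarrow> cvec \<Rightarrow> complex Matrix.mat" where
  "hankel a b \<mu> = Matrix.mat a b (\<lambda>(i, j). \<mu> (i + j))"

definition Sigma_r :: "nat \<Rightarrow> nat \<Rightarrow> cvec set" where
  "Sigma_r d r = {\<mu> \<in> cspace {..<2 * d}.
     vec_space.rank d (hankel d (d + 1) \<mu>) = r \<and> Determinant.det (hankel r r \<mu>) \<noteq> 0}"

definition Sigma_r_star :: "nat \<Rightarrow> nat \<Rightarrow> cvec set" where
  "Sigma_r_star d r = (\<lambda>\<mu>. restrict \<mu> {..<2 * r}) ` Sigma_r d r"


subsection \<open>The rank-restricted Prony problem\<close>

definition multiplicity_in :: "nat \<Rightarrow> cvec \<Rightarrow> complex \<Rightarrow> nat" where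
  "multiplicity_in r w \<tau> = card {i \<in> {1..r}. w i = \<tau>}"

(* The l-th derivative of the delta distribution at \<tau> is taken to act as
   f |-> f^(l)(\<tau>); the sign (-1)^l does not affect the span. *)

definition V_space :: "nat \<Rightarrow> cvec \<Rightarrow> functional set" where
  "V_space r w = {g. \<exists>c. g = (\<lambda>f. \<Sum>\<tau>\<in>w ` {1..r}. \<Sum>l<multiplicity_in r w \<tau>.
                                  c \<tau> l * (deriv ^^ l) f \<tau>)}"

definition prony_solution :: "nat \<Rightarrow> cvec \<Rightarrow> cvec \<Rightarrow> functional \<Rightarrow> bool" where
  "prony_solution r \<mu> w g \<longleftrightarrow>
     w \<in> cspace {1..r} \<and> g \<in> V_space r w \<and> (\<forall>k<2 * r. g (\<lambda>x. x ^ k) = \<mu> k)"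


subsection \<open>Divided differences and configurations\<close>

definition is_hermite_interpolant :: "complex list \<Rightarrow> (complex \<Rightarrow> complex) \<Rightarrow> complex poly \<Rightarrow> bool" where
  "is_hermite_interpolant ys f P \<longleftrightarrow>
     degree P < length ys \<and>
     (\<forall>y\<in>set ys. \<forall>l<count_list ys y. poly ((pderiv ^^ l) P) y = (deriv ^^ l) f y)"

definition divided_difference :: "complex list \<Rightarrow> functional" where
  "divided_difference ys f = coeff (THE P. is_hermite_interpolant ys f P) (length ys - 1)"

definition Delta :: "cvec \<Rightarrow> nat set \<Rightarrow> functional" where
  "Delta w X = divided_difference (map w (sorted_list_of_set X))"

definition smallest :: "nat \<Rightarrow> nat set \<Rightarrow> nat set" where
  "smallest l X = set (take l (sorted_list_of_set X))"

definition subordinated :: "nat \<Rightarrow> cvec \<Rightarrow> nat set set \<Rightarrow> bool" where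
  "subordinated r w \<C> \<longleftrightarrow>
     (\<forall>k\<in>{1..r}. \<forall>l\<in>{1..r}. k \<noteq> l \<and> w k = w l \<longrightarrow> (\<exists>X\<in>\<C>. k \<in> X \<and> l \<in> X))"

(* The parts of a configuration are indexed by themselves: (X, l) stands for (j, l), X = X_j. *)

definition conf_index :: "nat set set \<Rightarrow> (nat set \<times> nat) set" where
  "conf_index \<C> = (SIGMA X:\<C>. {1..card X})"

definition B_combination :: "nat set set \<Rightarrow> cvec \<Rightarrow> (nat set \<times> nat \<Rightarrow> complex) \<Rightarrow> functional" where
  "B_combination \<C> w b = (\<lambda>f. \<Sum>(X, l)\<in>conf_index \<C>. b (X, l) * Delta w (smallest l X) f)"

definition solves_linear_system ::
  "nat \<Rightarrow> nat set set \<Rightarrow> cvec \<Rightarrow> cvec \<Rightarrow> (nat set \<times> nat \<Rightarrow> complex) \<Rightarrow> bool" where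
  "solves_linear_system r \<C> \<mu> w b \<longleftrightarrow>
     b \<in> (conf_index \<C> \<rightarrow>\<^sub>E UNIV) \<and>
     (\<forall>k<2 * r. (\<Sum>(X, l)\<in>conf_index \<C>. b (X, l) * Delta w (smallest l X) (\<lambda>x. x ^ k)) = \<mu> k)"


subsection \<open>Analytic continuation in several variables\<close>

(* Holomorphy in several variables in Osgood's form: continuous and holomorphic in
   each variable separately. *)

definition holomorphic_map :: "nat set \<Rightarrow> nat set \<Rightarrow> cvec set \<Rightarrow> (cvec \<Rightarrow> cvec) \<Rightarrow> bool" where
  "holomorphic_map I J N f \<longleftrightarrow>
     openin (top_of_set (cspace I)) N \<and> f ` N \<subseteq> cspace J \<and> continuous_on N f \<and>
     (\<forall>p\<in>N. \<forall>i\<in>I. \<forall>j\<in>J. (\<lambda>z. f (p(i := z)) j) field_differentiable at (p i))"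

definition same_germ :: "nat set \<Rightarrow> cvec \<Rightarrow> (cvec \<Rightarrow> cvec) \<Rightarrow> (cvec \<Rightarrow> cvec) \<Rightarrow> bool" where
  "same_germ I p f g \<longleftrightarrow>
     (\<exists>V. openin (top_of_set (cspace I)) V \<and> p \<in> V \<and> (\<forall>q\<in>V. f q = g q))"

(* \<Phi> t is the germ at \<gamma> t, for 0 <= t < 1, of an analytic continuation of the germ of f at
   \<gamma> 0. Nothing is required at t = 1, so that \<gamma> may end at a branch point. *)

definition continues_along ::
  "nat set \<Rightarrow> nat set \<Rightarrow> (cvec \<Rightarrow> cvec) \<Rightarrow> (real \<Rightarrow> cvec) \<Rightarrow> (real \<Rightarrow> cvec \<Rightarrow> cvec) \<Rightarrow> bool" where
  "continues_along I J f \<gamma> \<Phi> \<longleftrightarrow>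
     same_germ I (\<gamma> 0) (\<Phi> 0) f \<and>
     (\<forall>t\<in>{0..<1}. \<exists>N. holomorphic_map I J N (\<Phi> t) \<and> \<gamma> t \<in> N \<and>
        (\<forall>\<^sub>F s in at t within {0..<1}. \<gamma> s \<in> N \<and> same_germ I (\<gamma> s) (\<Phi> s) (\<Phi> t)))"

(* Values at \<mu> of the multivalued function on U generated by the germ of f at \<mu>1; values at
   branch points are the limits along the branches. *)

definition continuation_values ::
  "nat set \<Rightarrow> nat set \<Rightarrow> cvec set \<Rightarrow> cvec \<Rightarrow> (cvec \<Rightarrow> cvec) \<Rightarrow> cvec \<Rightarrow> cvec set" where
  "continuation_values I J U \<mu>1 f \<mu> =
     {w \<in> cspace J. \<exists>\<gamma> \<Phi>. path \<gamma> \<and> path_image \<gamma> \<subseteq> U \<and> pathstart \<gamma> = \<mu>1 \<and> pathfinish \<gamma> = \<mu> \<and>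
        continues_along I J f \<gamma> \<Phi> \<and> ((\<lambda>t. \<Phi> t (\<gamma> t)) \<longlongrightarrow> w) (at_left 1)}"


subsection \<open>The node function\<close>

definition is_pade :: "nat \<Rightarrow> cvec \<Rightarrow> complex poly \<Rightarrow> complex poly \<Rightarrow> bool" where
  "is_pade r \<mu> P Q \<longleftrightarrow>
     lead_coeff Q = 1 \<and> degree Q = r \<and> degree P < r \<and> coprime P Q \<and>
     (\<exists>c. (\<forall>k<2 * r. c k = \<mu> k) \<and>
        (\<forall>\<^sub>F z in at_infinity. (\<lambda>k. c k / z ^ (k + 1)) sums (poly P z / poly Q z)))"

(* x is an enumeration near \<mu>1 of the roots of the denominator, which are distinct at \<mu>1, and
   x i lies in the cluster of w0 i. With \<delta> the minimal distance of distinct coordinates of w0,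
   the last condition says |x i - w0 i| <= \<delta>/3; it is void if w0 has only one distinct
   coordinate. *)

definition node_germ :: "nat \<Rightarrow> cvec \<Rightarrow> cvec \<Rightarrow> (cvec \<Rightarrow> cvec) \<Rightarrow> bool" where
  "node_germ r w0 \<mu>1 x \<longleftrightarrow>
     (\<exists>N. holomorphic_map {..<2 * r} {1..r} N x \<and> \<mu>1 \<in> N \<and>
        (\<forall>\<mu>\<in>N. \<exists>P. is_pade r \<mu> P (\<Prod>j\<in>{1..r}. [:- x \<mu> j, 1:]))) \<and>
     inj_on (x \<mu>1) {1..r} \<and>
     (\<forall>i\<in>{1..r}. \<forall>a\<in>{1..r}. \<forall>b\<in>{1..r}. w0 a \<noteq> w0 b \<longrightarrow>
        cmod (x \<mu>1 i - w0 i) \<le> cmod (w0 a - w0 b) / 3)"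

abbreviation node_values :: "nat \<Rightarrow> cvec set \<Rightarrow> cvec \<Rightarrow> (cvec \<Rightarrow> cvec) \<Rightarrow> cvec \<Rightarrow> cvec set" where
  "node_values r \<equiv> continuation_values {..<2 * r} {1..r}"


subsection \<open>Multivalued functions\<close>

inductive polynomial_fun :: "nat set \<Rightarrow> (cvec \<Rightarrow> complex) \<Rightarrow> bool" for I where
  const: "polynomial_fun I (\<lambda>\<mu>. c)"
| coord: "i \<in> I \<Longrightarrow> polynomial_fun I (\<lambda>\<mu>. \<mu> i)"
| add: "polynomial_fun I p \<Longrightarrow> polynomial_fun I q \<Longrightarrow> polynomial_fun I (\<lambda>\<mu>. p \<mu> + q \<mu>)"
| mult: "polynomial_fun I p \<Longrightarrow> polynomial_fun I q \<Longrightarrow> polynomial_fun I (\<lambda>\<mu>. p \<mu> * q \<mu>)"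

(* All values satisfy one polynomial equation over C[\<mu>] of degree n >= 1 in the value. *)

definition algebraic_multifun :: "nat set \<Rightarrow> cvec set \<Rightarrow> (cvec \<Rightarrow> complex set) \<Rightarrow> bool" where
  "algebraic_multifun I U F \<longleftrightarrow>
     (\<exists>n\<ge>1. \<exists>q :: nat \<Rightarrow> cvec \<Rightarrow> complex.
        (\<forall>k\<le>n. polynomial_fun I (q k)) \<and> (\<exists>\<mu>\<in>cspace I. q n \<mu> \<noteq> 0) \<and>
        (\<forall>\<mu>\<in>U. \<forall>y\<in>F \<mu>. (\<Sum>k\<le>n. q k \<mu> * y ^ k) = 0))"

(* Nonempty finite values, varying continuously in the Hausdorff distance. *)

definition continuous_multifun :: "cvec set \<Rightarrow> (cvec \<Rightarrow> complex set) \<Rightarrow> bool" where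
  "continuous_multifun U F \<longleftrightarrow>
     (\<forall>\<mu>\<in>U. F \<mu> \<noteq> {} \<and> finite (F \<mu>) \<and>
        (\<forall>e>0. \<forall>\<^sub>F \<nu> in at \<mu> within U.
           (\<forall>y\<in>F \<mu>. \<exists>z\<in>F \<nu>. dist y z < e) \<and> (\<forall>z\<in>F \<nu>. \<exists>y\<in>F \<mu>. dist y z < e)))"

end

theory Submission
  imports
    Defs
    "HOL-Complex_Analysis.Complex_Analysis"
    "Subresultants.Subresultant_Gcd"
    "HOL-Computational_Algebra.Field_as_Ring"
    "HOL-Computational_Algebra.Fundamental_Theorem_Algebra"
begin

text \<open>Moments and nodes are tied together by a linear recurrence. A functional in \<open>V_space r w\<close> kills every
multiple of the polynomial \<open>\<Prod>j. z - w j\<close>, so a solution of the Prony problem satisfies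
\<open>nodes r \<mu> w\<close>: the coefficients \<open>q\<^sub>k\<close> of that polynomial fulfil
\<open>\<Sum>k\<le>r. q\<^sub>k * \<mu> (k + i) = 0\<close> for \<open>i < r\<close>. Multiplying the expansion at infinity by the
denominator shows the same for the denominators of Pade approximants. The Hankel determinant is nonzero
at \<open>\<mu>0\<close>, hence nearby, and there Cramer's rule turns the recurrence into a formula for the \<open>q\<^sub>k\<close> as
rational functions of \<open>\<mu>\<close>. The node vectors of \<open>\<mu>\<close> are therefore the enumerations of the roots of one
monic polynomial \<open>den r \<mu>\<close>; there are finitely many, and they stay close to the coordinates of \<open>w0\<close>.

For a fixed node vector the linear system is triangular. Newton polynomials of the parts, multiplied by
the factors of the other parts, form test polynomials on which the functionals of \<open>B_combination\<close> act
triangularly, with diagonal entries that are products of differences \<open>w i - w j\<close> for \<open>i\<close> and \<open>j\<close> in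
different parts (\<open>dd_sum_testpoly\<close>). Subordination says that these do not vanish. So the divided
differences are a basis of \<open>V_space r w\<close>, the first \<open>r\<close> equations have exactly one solution, the
recurrence gives the other \<open>r\<close> equations, and back substitution exhibits each coordinate as a quotient
of continuous functions of \<open>(\<mu>, w)\<close> (\<open>linear_system_solution_continuous\<close>).

Algebraicity is a dimension count. The \<open>2 * r\<close> moments and one coordinate \<open>\<beta>\<close> are \<open>2 * r + 1\<close>
polynomials in \<open>2 * r\<close> variables, the nodes and the coordinates; hence they satisfy a nontrivial
polynomial relation. It has positive degree in \<open>\<beta>\<close>: a nonzero polynomial in the moments alone
cannot vanish on an open polydisc of moment vectors (\<open>coordinate_algebraic_relation\<close>).

It remains to control the values that analytic continuation produces. The recurrence is an analytic
equation, so by the identity theorem it persists along every continuation and passes to the limits at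
branch points; the nodes never leave their clusters, since these are disjoint, and so all values are node vectors
subordinated to \<open>\<C>\<close>. Conversely, there are enough continuations. A point off the zeros of
the discriminant is joined to any other point of the polydisc by a path in a complex line that meets them at most at its end, as a
holomorphic function of one variable that is not identically zero has countably many zeros. Away from
those zeros the roots form a covering space and are locally holomorphic, so paths lift
and the lift is an analytic continuation. Applied to the whole neighbourhood this shows that values exist
everywhere (\<open>continuation_value_exists\<close>); applied to small polydiscs it shows that values at neighbouring
points can be connected by short continuations and are close (\<open>values_transport\<close>). Together with the
joint continuity of the coordinates in \<open>(\<mu>, w)\<close> this is continuity in the Hausdorff distance.\<close>

section \<open>Linear systems and algebraic dependence\<close>

text \<open>Induction on the equations: one equation with a nonzero coefficient eliminates one unknown.\<close>

lemma homogeneous_system_nontrivial: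
  fixes a :: "'j \<Rightarrow> 'i \<Rightarrow> 'a::field"
  assumes "finite J" "finite I" "card J < card I"
  shows "\<exists>c. (\<exists>i\<in>I. c i \<noteq> 0) \<and> (\<forall>j\<in>J. (\<Sum>i\<in>I. a j i * c i) = 0)"
  using assms
proof (induction J arbitrary: I a rule: finite_induct)
  case empty
  then have "I \<noteq> {}" by auto
  then show ?case by (intro exI[of _ "\<lambda>_. 1"]) auto
next
  case (insert j J)
  show ?case
  proof (cases "\<forall>i\<in>I. a j i = 0")
    case True
    have "card J < card I" using insert by simp
    from insert.IH[OF insert.prems(1) this, of a] obtain c
      where "\<exists>i\<in>I. c i \<noteq> 0" "\<forall>j\<in>J. (\<Sum>i\<in>I. a j i * c i) = 0" by auto
    with True show ?thesis by (intro exI[of _ c]) auto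
  next
    case False
    then obtain i0 where i0: "i0 \<in> I" "a j i0 \<noteq> 0" by auto
    define I' where "I' = I - {i0}"
    have I': "finite I'" "i0 \<notin> I'" "I = insert i0 I'" using i0 insert.prems unfolding I'_def by auto
    have "card J < card I'" using insert I' by simp
    from insert.IH[OF I'(1) this, of "\<lambda>j' i. a j' i - a j' i0 * a j i / a j i0"] obtain c
      where c: "\<exists>i\<in>I'. c i \<noteq> 0"
        "\<forall>j'\<in>J. (\<Sum>i\<in>I'. (a j' i - a j' i0 * a j i / a j i0) * c i) = 0" by auto
    define s where "s = (\<Sum>i\<in>I'. a j i * c i)"
    define c' where "c' = c(i0 := - s / a j i0)"
    have *: "(\<Sum>i\<in>I. a j' i * c' i) = (\<Sum>i\<in>I'. a j' i * c i) - a j' i0 * s / a j i0" for j'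
    proof -
      have "(\<Sum>i\<in>I. a j' i * c' i) = a j' i0 * c' i0 + (\<Sum>i\<in>I'. a j' i * c' i)"
        using I' by simp
      also have "(\<Sum>i\<in>I'. a j' i * c' i) = (\<Sum>i\<in>I'. a j' i * c i)"
        using I' by (intro sum.cong) (auto simp: c'_def)
      finally show ?thesis by (simp add: c'_def)
    qed
    have "(\<Sum>i\<in>I. a j' i * c' i) = 0" if "j' \<in> J" for j'
    proof -
      have "(\<Sum>i\<in>I'. (a j' i - a j' i0 * a j i / a j i0) * c i)
        = (\<Sum>i\<in>I'. a j' i * c i) - a j' i0 * s / a j i0"
        unfolding s_def by (simp add: algebra_simps sum_subtractf sum_distrib_left sum_divide_distrib)
      with c(2) that * show ?thesis by simp
    qed
    moreover have "(\<Sum>i\<in>I. a j i * c' i) = 0"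
      unfolding * using i0 by (simp add: s_def)
    moreover have "\<exists>i\<in>I. c' i \<noteq> 0" using c(1) I' by (auto simp: c'_def)
    ultimately show ?thesis by (intro exI[of _ c']) auto
  qed
qed

lemma square_system_solvable:
  fixes a :: "'j \<Rightarrow> 'i \<Rightarrow> 'a::field"
  assumes "finite J" "finite I" "card J = card I"
    and inj: "\<And>c. (\<forall>j\<in>J. (\<Sum>i\<in>I. a j i * c i) = 0) \<Longrightarrow> \<forall>i\<in>I. c i = 0"
  shows "\<exists>c. \<forall>j\<in>J. (\<Sum>i\<in>I. a j i * c i) = m j"
proof -
  \<comment> \<open>The additional unknown \<open>None\<close> multiplies the right-hand side.\<close>
  define I' where "I' = insert None (Some ` I)"
  have sumI': "(\<Sum>i\<in>I'. g i) = g None + (\<Sum>i\<in>I. g (Some i))" for g :: "'i option \<Rightarrow> 'a"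
    unfolding I'_def using assms(2) by (subst sum.insert) (auto simp: sum.reindex)
  have "finite I'" "card J < card I'"
    using assms by (auto simp: I'_def card_image)
  then obtain c where c: "\<exists>i\<in>I'. c i \<noteq> 0"
      "\<forall>j\<in>J. (\<Sum>i\<in>I'. (case i of None \<Rightarrow> - m j | Some i \<Rightarrow> a j i) * c i) = 0"
    using homogeneous_system_nontrivial[OF assms(1), of I' "\<lambda>j i. case i of None \<Rightarrow> - m j | Some i \<Rightarrow> a j i"] by auto
  have eq: "(\<Sum>i\<in>I. a j i * c (Some i)) = m j * c None" if "j \<in> J" for j
    using c(2) that by (simp add: sumI')
  have "c None \<noteq> 0"
  proof
    assume 0: "c None = 0"
    then have "\<forall>i\<in>I. c (Some i) = 0" using inj[of "\<lambda>i. c (Some i)"] eq by simp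
    with 0 c(1) show False by (auto simp: I'_def)
  qed
  then show ?thesis
    by (intro exI[of _ "\<lambda>i. c (Some i) / c None"]) (simp add: eq sum_divide_distrib[symmetric])
qed

text \<open>Functions given by a polynomial of degree at most \<open>K\<close> in each variable of \<open>V\<close>. The bound per variable
makes the monomials a box of exponents, which is easy to count.\<close>

definition poly_span :: "'v set \<Rightarrow> nat \<Rightarrow> (('v \<Rightarrow> complex) \<Rightarrow> complex) \<Rightarrow> bool" where
  "poly_span V K f \<longleftrightarrow> (\<exists>c. \<forall>x. f x = (\<Sum>e\<in>V \<rightarrow>\<^sub>E {..K}. c e * (\<Prod>v\<in>V. x v ^ e v)))"

lemma poly_span_mono:
  assumes "finite V" "poly_span V K f" "K \<le> K'"
  shows "poly_span V K' f"
proof -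
  obtain c where c: "\<And>x. f x = (\<Sum>e\<in>V \<rightarrow>\<^sub>E {..K}. c e * (\<Prod>v\<in>V. x v ^ e v))"
    using assms(2) unfolding poly_span_def by auto
  have sub: "(V \<rightarrow>\<^sub>E {..K}) \<subseteq> (V \<rightarrow>\<^sub>E {..K'})"
    by (rule PiE_mono) (use assms(3) in auto)
  have "f x = (\<Sum>e\<in>V \<rightarrow>\<^sub>E {..K'}. (if e \<in> V \<rightarrow>\<^sub>E {..K} then c e else 0) * (\<Prod>v\<in>V. x v ^ e v))" for x
    unfolding c
    by (rule sum.mono_neutral_cong_left) (use assms sub in \<open>auto intro!: finite_PiE\<close>)
  then show ?thesis unfolding poly_span_def
    by (intro exI[of _ "\<lambda>e. if e \<in> V \<rightarrow>\<^sub>E {..K} then c e else 0"] allI)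
qed

lemma poly_span_add:
  assumes "poly_span V K f" "poly_span V K g"
  shows "poly_span V K (\<lambda>x. f x + g x)"
proof -
  obtain c d where "\<And>x. f x = (\<Sum>e\<in>V \<rightarrow>\<^sub>E {..K}. c e * (\<Prod>v\<in>V. x v ^ e v))"
    "\<And>x. g x = (\<Sum>e\<in>V \<rightarrow>\<^sub>E {..K}. d e * (\<Prod>v\<in>V. x v ^ e v))"
    using assms unfolding poly_span_def by auto
  then show ?thesis unfolding poly_span_def
    by (intro exI[of _ "\<lambda>e. c e + d e"]) (simp add: algebra_simps sum.distrib)
qed

lemma poly_span_cmult:
  assumes "poly_span V K f"
  shows "poly_span V K (\<lambda>x. a * f x)"
proof -
  obtain c where "\<And>x. f x = (\<Sum>e\<in>V \<rightarrow>\<^sub>E {..K}. c e * (\<Prod>v\<in>V. x v ^ e v))"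
    using assms unfolding poly_span_def by auto
  then show ?thesis unfolding poly_span_def
    by (intro exI[of _ "\<lambda>e. a * c e"]) (simp add: algebra_simps sum_distrib_left)
qed

lemma poly_span_zero: "poly_span V K (\<lambda>x. 0)"
  unfolding poly_span_def by (intro exI[of _ "\<lambda>_. 0"]) simp

lemma poly_span_sum:
  assumes "\<And>i. i \<in> A \<Longrightarrow> poly_span V K (f i)"
  shows "poly_span V K (\<lambda>x. \<Sum>i\<in>A. f i x)"
  using assms by (induction A rule: infinite_finite_induct) (auto intro: poly_span_zero poly_span_add)

lemma poly_span_monomial:
  assumes "finite V" "e \<in> V \<rightarrow>\<^sub>E {..K}"
  shows "poly_span V K (\<lambda>x. \<Prod>v\<in>V. x v ^ e v)"
  unfolding poly_span_def
proof (intro exI[of _ "\<lambda>e'. if e' = e then 1 else 0"] allI)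
  fix x :: "'a \<Rightarrow> complex"
  have "(\<Sum>e'\<in>V \<rightarrow>\<^sub>E {..K}. (if e' = e then 1 else 0) * (\<Prod>v\<in>V. x v ^ e' v))
      = (\<Sum>e'\<in>V \<rightarrow>\<^sub>E {..K}. if e' = e then (\<Prod>v\<in>V. x v ^ e' v) else 0)"
    by (intro sum.cong) auto
  also have "\<dots> = (\<Prod>v\<in>V. x v ^ e v)"
    using assms by (simp add: finite_PiE)
  finally show "(\<Prod>v\<in>V. x v ^ e v) = (\<Sum>e'\<in>V \<rightarrow>\<^sub>E {..K}. (if e' = e then 1 else 0) * (\<Prod>v\<in>V. x v ^ e' v))"
    by simp
qed

lemma poly_span_mult:
  assumes V: "finite V" and "poly_span V K f" "poly_span V L g"
  shows "poly_span V (K + L) (\<lambda>x. f x * g x)"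
proof -
  obtain c where c: "\<And>x. f x = (\<Sum>e\<in>V \<rightarrow>\<^sub>E {..K}. c e * (\<Prod>v\<in>V. x v ^ e v))"
    using assms unfolding poly_span_def by auto
  obtain d where d: "\<And>x. g x = (\<Sum>e\<in>V \<rightarrow>\<^sub>E {..L}. d e * (\<Prod>v\<in>V. x v ^ e v))"
    using assms unfolding poly_span_def by auto
  have *: "f x * g x = (\<Sum>e\<in>V \<rightarrow>\<^sub>E {..K}. \<Sum>e'\<in>V \<rightarrow>\<^sub>E {..L}.
      (c e * d e') * (\<Prod>v\<in>V. x v ^ restrict (\<lambda>v. e v + e' v) V v))" for x
    unfolding c d sum_product
    by (intro sum.cong refl) (simp add: power_add prod.distrib algebra_simps)
  show ?thesis unfolding *
    by (intro poly_span_sum poly_span_cmult poly_span_monomial V)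
       (auto simp: PiE_def Pi_def extensional_def intro: add_mono)
qed

lemma poly_span_const: "finite V \<Longrightarrow> poly_span V 0 (\<lambda>x. a)"
  using poly_span_cmult[OF poly_span_monomial[of V "restrict (\<lambda>_. 0) V" 0], of a] by simp

lemma poly_span_var:
  assumes "finite V" "v \<in> V"
  shows "poly_span V 1 (\<lambda>x. x v)"
proof -
  have "(\<Prod>u\<in>V. x u ^ restrict (\<lambda>u. if u = v then 1 else 0) V u) = x v" for x :: "'a \<Rightarrow> complex"
  proof -
    have "(\<Prod>u\<in>V. x u ^ restrict (\<lambda>u. if u = v then 1 else 0) V u) = (\<Prod>u\<in>V. if u = v then x u else 1)"
      by (intro prod.cong) auto
    then show ?thesis using assms by simp
  qed
  then show ?thesis
    using poly_span_monomial[OF assms(1), of "restrict (\<lambda>u. if u = v then 1 else 0) V" 1] by auto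
qed

lemma poly_span_power:
  assumes "finite V" "poly_span V K f"
  shows "poly_span V (K * n) (\<lambda>x. f x ^ n)"
  using poly_span_mult[OF assms(1,2)]
  by (induction n) (auto simp: poly_span_const assms(1))

lemma poly_span_prod:
  assumes "finite V" "finite A" "\<And>i. i \<in> A \<Longrightarrow> poly_span V K (f i)"
  shows "poly_span V (K * card A) (\<lambda>x. \<Prod>i\<in>A. f i x)"
  using assms(2,3)
  by (induction A rule: finite_induct) (auto simp: poly_span_const assms(1) intro!: poly_span_mult)

text \<open>More polynomials than variables are algebraically dependent. The products of powers with exponents at
most \<open>n\<close> number \<open>(n + 1) ^ card I\<close> and lie in a space of dimension of order \<open>n ^ card V\<close>, so for large \<open>n\<close>
they are linearly dependent.\<close>

lemma algebraic_dependence: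
  fixes f :: "'i \<Rightarrow> ('v \<Rightarrow> complex) \<Rightarrow> complex"
  assumes V: "finite V" and I: "finite I" and less: "card V < card I"
    and f: "\<And>i. i \<in> I \<Longrightarrow> poly_span V K (f i)"
  shows "\<exists>n c. (\<exists>e\<in>I \<rightarrow>\<^sub>E {..n}. c e \<noteq> 0) \<and>
    (\<forall>x. (\<Sum>e\<in>I \<rightarrow>\<^sub>E {..n}. c e * (\<Prod>i\<in>I. f i x ^ e i)) = 0)"
proof -
  define L where "L = K * card I"
  \<comment> \<open>This value of \<open>n\<close> gives
    \<open>(L * n + 1) ^ card V \<le> (L + 1) ^ card V * (n + 1) ^ card V = n * (n + 1) ^ card V < (n + 1) ^ (card V + 1)\<close>.\<close>
  define n where "n = (L + 1) ^ card V"
  define J where "J = V \<rightarrow>\<^sub>E {..L * n}"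
  define E where "E = I \<rightarrow>\<^sub>E {..n}"
  have "poly_span V (L * n) (\<lambda>x. \<Prod>i\<in>I. f i x ^ e i)" if "e \<in> E" for e
  proof -
    have "poly_span V (K * n) (\<lambda>x. f i x ^ e i)" if i: "i \<in> I" for i
      by (rule poly_span_mono[OF V poly_span_power[OF V f[OF i]]])
         (use i \<open>e \<in> E\<close> in \<open>auto simp: E_def\<close>)
    from poly_span_prod[OF V I this, of "\<lambda>i. i"] show ?thesis
      by (simp add: L_def mult.assoc mult.commute mult.left_commute)
  qed
  then have "\<forall>e\<in>E. \<exists>c. \<forall>x. (\<Prod>i\<in>I. f i x ^ e i) = (\<Sum>j\<in>J. c j * (\<Prod>v\<in>V. x v ^ j v))"
    by (auto simp: poly_span_def J_def)
  then obtain a where a: "\<And>e x. e \<in> E \<Longrightarrow> (\<Prod>i\<in>I. f i x ^ e i) = (\<Sum>j\<in>J. a e j * (\<Prod>v\<in>V. x v ^ j v))"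
    by metis
  have fin: "finite J" "finite E" using V I by (auto simp: J_def E_def intro!: finite_PiE)
  have "card J = (L * n + 1) ^ card V" using V by (simp add: J_def card_PiE)
  also have "\<dots> \<le> ((L + 1) * (n + 1)) ^ card V"
    by (intro power_mono) (auto simp: algebra_simps)
  also have "\<dots> = n * (n + 1) ^ card V" by (simp only: power_mult_distrib n_def)
  also have "\<dots> < (n + 1) ^ (card V + 1)" by simp
  also have "\<dots> \<le> (n + 1) ^ card I" using less by (intro power_increasing) auto
  also have "\<dots> = card E" using I by (simp add: E_def card_PiE)
  finally have "card J < card E" .
  from homogeneous_system_nontrivial[OF fin this, of "\<lambda>j e. a e j"] obtain c where
    c: "\<exists>e\<in>E. c e \<noteq> 0" "\<forall>j\<in>J. (\<Sum>e\<in>E. a e j * c e) = 0" by auto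
  have "(\<Sum>e\<in>E. c e * (\<Prod>i\<in>I. f i x ^ e i)) = 0" for x
  proof -
    have "(\<Sum>e\<in>E. c e * (\<Prod>i\<in>I. f i x ^ e i)) = (\<Sum>e\<in>E. \<Sum>j\<in>J. (\<Prod>v\<in>V. x v ^ j v) * (a e j * c e))"
      by (intro sum.cong refl) (simp only: a sum_distrib_left mult_ac)
    also have "\<dots> = (\<Sum>j\<in>J. \<Sum>e\<in>E. (\<Prod>v\<in>V. x v ^ j v) * (a e j * c e))"
      by (rule sum.swap)
    also have "\<dots> = 0" using c(2) by (simp add: sum_distrib_left[symmetric])
    finally show ?thesis .
  qed
  with c(1) show ?thesis unfolding E_def by blast
qed

lemma sum_PiE_insert:
  fixes g :: "('v \<Rightarrow> 'b) \<Rightarrow> 'c::comm_monoid_add"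
  assumes "finite V" "v \<notin> V" "finite B"
  shows "(\<Sum>e\<in>insert v V \<rightarrow>\<^sub>E B. g e) = (\<Sum>k\<in>B. \<Sum>e\<in>V \<rightarrow>\<^sub>E B. g (e(v := k)))"
proof -
  have "(\<Sum>e\<in>insert v V \<rightarrow>\<^sub>E B. g e) = (\<Sum>e\<in>(\<lambda>(y, h). h(v := y)) ` (B \<times> (V \<rightarrow>\<^sub>E B)). g e)"
    by (simp add: PiE_insert_eq)
  also have "\<dots> = (\<Sum>(k, e)\<in>B \<times> (V \<rightarrow>\<^sub>E B). g (e(v := k)))"
    using inj_combinator[OF assms(2), of "\<lambda>_. B"]
    by (subst sum.reindex) (auto simp: case_prod_beta)
  finally show ?thesis by (simp add: sum.cartesian_product)
qed

text \<open>Induction on the variables: fix all but one of them so that some coefficient with respect to the last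
one survives, and avoid its finitely many roots.\<close>

lemma polynomial_nonvanishing:
  fixes c :: "('v \<Rightarrow> nat) \<Rightarrow> complex"
  assumes "finite V" "\<And>v. v \<in> V \<Longrightarrow> infinite (A v)"
    and "\<exists>e\<in>V \<rightarrow>\<^sub>E {..n}. c e \<noteq> 0"
  shows "\<exists>x\<in>PiE V A. (\<Sum>e\<in>V \<rightarrow>\<^sub>E {..n}. c e * (\<Prod>v\<in>V. x v ^ e v)) \<noteq> 0"
  using assms
proof (induction V arbitrary: c rule: finite_induct)
  case empty
  then show ?case by auto
next
  case (insert v V)
  obtain e0 where e0: "e0 \<in> insert v V \<rightarrow>\<^sub>E {..n}" "c e0 \<noteq> 0" using insert.prems(2) by blast
  define k0 where "k0 = e0 v"
  have "e0(v := undefined) \<in> V \<rightarrow>\<^sub>E {..n}" "c ((e0(v := undefined))(v := k0)) \<noteq> 0"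
    using e0 insert.hyps by (auto simp: k0_def PiE_def Pi_def extensional_def)
  then have ex: "\<exists>e\<in>V \<rightarrow>\<^sub>E {..n}. c (e(v := k0)) \<noteq> 0"
    by (intro bexI[of _ "e0(v := undefined)"])
  have "\<And>v. v \<in> V \<Longrightarrow> infinite (A v)" using insert.prems(1) by simp
  from insert.IH[OF this ex] obtain x where x: "x \<in> PiE V A"
    "(\<Sum>e\<in>V \<rightarrow>\<^sub>E {..n}. c (e(v := k0)) * (\<Prod>v\<in>V. x v ^ e v)) \<noteq> 0" by blast
  define q where "q k = (\<Sum>e\<in>V \<rightarrow>\<^sub>E {..n}. c (e(v := k)) * (\<Prod>v\<in>V. x v ^ e v))" for k
  have k0: "k0 \<le> n" "q k0 \<noteq> 0" using e0 x by (auto simp: k0_def q_def)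
  then have "finite {z. (\<Sum>i\<le>n. q i * z ^ i) = 0}"
    using polyfun_finite_roots[of q n] by auto
  moreover have "infinite (A v)" using insert.prems by auto
  ultimately have "\<not> A v \<subseteq> {z. (\<Sum>i\<le>n. q i * z ^ i) = 0}"
    using finite_subset by blast
  then obtain z where z: "z \<in> A v" "(\<Sum>i\<le>n. q i * z ^ i) \<noteq> 0"
    by blast
  have 1: "(\<Prod>u\<in>insert v V. (x(v := z)) u ^ (e(v := k)) u) = z ^ k * (\<Prod>u\<in>V. x u ^ e u)" for e :: "'v \<Rightarrow> nat" and k
  proof -
    have "(\<Prod>u\<in>V. (x(v := z)) u ^ (e(v := k)) u) = (\<Prod>u\<in>V. x u ^ e u)"
      by (intro prod.cong) (use insert.hyps in auto)
    then show ?thesis using insert.hyps by simp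
  qed
  have "(\<Sum>e\<in>insert v V \<rightarrow>\<^sub>E {..n}. c e * (\<Prod>u\<in>insert v V. (x(v := z)) u ^ e u)) = (\<Sum>i\<le>n. q i * z ^ i)"
    unfolding sum_PiE_insert[OF insert.hyps(1,2) finite_atMost] 1 q_def sum_distrib_right
    by (intro sum.cong refl) (simp add: mult_ac)
  moreover have "x(v := z) \<in> PiE (insert v V) A"
    using x z by (auto simp: PiE_def Pi_def extensional_def)
  ultimately show ?case using z(2) by (intro bexI[of _ "x(v := z)"]) (simp only: not_False_eq_True)
qed

section \<open>Hermite interpolation and divided differences\<close>

definition linprod :: "complex list \<Rightarrow> complex poly" where
  "linprod ys = (\<Prod>y\<leftarrow>ys. [:- y, 1:])"

lemma linprod_simps [simp]: "linprod [] = 1" "linprod (y # ys) = [:- y, 1:] * linprod ys"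
  "linprod (xs @ ys) = linprod xs * linprod ys"
  by (simp_all add: linprod_def)

lemma linprod_nonzero [simp]: "linprod ys \<noteq> 0"
  by (induction ys) (auto simp del: mult_pCons_left)

lemma degree_linprod [simp]: "degree (linprod ys) = length ys"
proof (induction ys)
  case (Cons y ys)
  have "degree ([:- y, 1:] * linprod ys) = degree [:- y, 1:] + degree (linprod ys)"
    by (rule degree_mult_eq) auto
  with Cons show ?case by (simp del: mult_pCons_left)
qed simp

lemma lead_coeff_linprod: "coeff (linprod ys) (length ys) = 1"
proof (induction ys)
  case (Cons y ys)
  then show ?case by (simp add: coeff_eq_0)
qed simp

lemma linprod_map_distinct: "distinct xs \<Longrightarrow> linprod (map w xs) = (\<Prod>i\<in>set xs. [:- w i, 1:])"
  unfolding linprod_def by (simp add: prod.distinct_set_conv_list o_def)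

lemma power_dvd_pderiv:
  fixes R :: "complex poly"
  assumes "[:- y, 1:] ^ Suc n dvd R"
  shows "[:- y, 1:] ^ n dvd pderiv R"
proof -
  obtain S where R: "R = [:- y, 1:] ^ Suc n * S" using assms by (auto elim: dvdE)
  have "[:- y, 1:] ^ n dvd [:- y, 1:] ^ Suc n * pderiv S"
    by (intro dvd_mult2 le_imp_power_dvd) simp
  moreover have "[:- y, 1:] ^ n dvd S * pderiv ([:- y, 1:] ^ Suc n)"
    unfolding pderiv_power_Suc by (intro dvd_mult dvd_mult2 dvd_smult dvd_refl)
  ultimately show ?thesis unfolding R pderiv_mult by (rule dvd_add)
qed

lemma pderivs_vanish_iff_dvd:
  fixes R :: "complex poly"
  shows "(\<forall>l<n. poly ((pderiv ^^ l) R) y = 0) \<longleftrightarrow> [:- y, 1:] ^ n dvd R"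
proof (induction n arbitrary: R)
  case (Suc n)
  have split: "(\<forall>l<Suc n. poly ((pderiv ^^ l) R) y = 0) \<longleftrightarrow>
      poly R y = 0 \<and> (\<forall>l<n. poly ((pderiv ^^ l) (pderiv R)) y = 0)"
    unfolding All_less_Suc2 by (simp add: funpow_swap1)
  show ?case
  proof (cases "R = 0")
    case True
    moreover have "(pderiv ^^ l) (0 :: complex poly) = 0" for l
      by (induction l) auto
    ultimately show ?thesis by simp
  next
    case False
    show ?thesis unfolding split Suc.IH
    proof safe
      assume *: "poly R y = 0" "[:- y, 1:] ^ n dvd pderiv R"
      have "pderiv R \<noteq> 0"
      proof
        assume "pderiv R = 0"
        then obtain c where "R = [:c:]" by (metis degree_eq_zeroE pderiv_eq_0_iff)
        with * False show False by simp
      qed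
      moreover have "Polynomial.order y R = Suc (Polynomial.order y (pderiv R))"
        using False * by (intro order_pderiv)
      moreover have "n \<le> Polynomial.order y (pderiv R)"
        using * \<open>pderiv R \<noteq> 0\<close> Polynomial.order_divides by blast
      ultimately show "[:- y, 1:] ^ Suc n dvd R" unfolding Polynomial.order_divides by linarith
    next
      assume *: "[:- y, 1:] ^ Suc n dvd R"
      then show "poly R y = 0"
        by (metis dvd_trans dvd_triv_left poly_eq_0_iff_dvd power_Suc)
      show "[:- y, 1:] ^ n dvd pderiv R" using * by (rule power_dvd_pderiv)
    qed
  qed
qed simp

lemma order_linear_factor: "Polynomial.order y [:- a, 1 :: complex:] = (if y = a then 1 else 0)"
proof (cases "y = a")
  case True
  then show ?thesis using order_power_n_n[of a 1] by simp
qed (auto intro: order_0I)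

text \<open>Unique factorisation into linear factors, in terms of root multiplicities.\<close>

lemma linprod_dvd_iff_order:
  "linprod ys dvd R \<longleftrightarrow> R = 0 \<or> (\<forall>y. count_list ys y \<le> Polynomial.order y R)"
proof (induction ys arbitrary: R)
  case (Cons a ys)
  show ?case
  proof (cases "R = 0")
    case False
    show ?thesis
    proof (cases "poly R a = 0")
      case True
      then obtain S where R: "R = [:- a, 1:] * S" by (metis dvdE poly_eq_0_iff_dvd)
      then have S: "S \<noteq> 0" using False by auto
      have ord: "Polynomial.order y R = (if y = a then 1 else 0) + Polynomial.order y S" for y
      proof -
        have "[:- a, 1:] * S \<noteq> 0" using False R by simp
        from order_mult[OF this, of y] show ?thesis
          unfolding R[symmetric] order_linear_factor .
      qed
      have cnt: "count_list (a # ys) y = (if y = a then 1 else 0) + count_list ys y" for y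
        by simp
      have "linprod (a # ys) dvd R \<longleftrightarrow> linprod ys dvd S"
        unfolding R linprod_simps by (subst dvd_mult_cancel_left) (simp del: mult_pCons_left)
      then show ?thesis unfolding Cons.IH[of S] ord cnt add_le_cancel_left
        using S False by blast
    next
      case nz: False
      have "\<not> linprod (a # ys) dvd R"
      proof
        assume "linprod (a # ys) dvd R"
        then have "[:- a, 1:] dvd R" unfolding linprod_simps by (rule dvd_mult_left)
        with nz show False by (simp add: poly_eq_0_iff_dvd)
      qed
      moreover have "Polynomial.order a R = 0" using nz by (rule order_0I)
      moreover have "count_list (a # ys) a \<noteq> 0" by simp
      ultimately show ?thesis using False by (metis le_zero_eq)
    qed
  qed simp
qed simp

lemma hermite_data_vanish_iff_dvd:
  "(\<forall>y\<in>set ys. \<forall>l<count_list ys y. poly ((pderiv ^^ l) R) y = 0) \<longleftrightarrow> linprod ys dvd R"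
proof -
  have "(\<forall>y\<in>set ys. \<forall>l<count_list ys y. poly ((pderiv ^^ l) R) y = 0) \<longleftrightarrow>
    (\<forall>y. \<forall>l<count_list ys y. poly ((pderiv ^^ l) R) y = 0)"
    by (metis count_list_0_iff less_nat_zero_code)
  also have "\<dots> \<longleftrightarrow> linprod ys dvd R"
    unfolding pderivs_vanish_iff_dvd linprod_dvd_iff_order Polynomial.order_divides by auto
  finally show ?thesis .
qed

lemma coeff_sum_monom:
  "coeff (\<Sum>k<n. Polynomial.smult (c k) (monom 1 k)) i = (if i < n then c i else (0 :: complex))"
  unfolding coeff_sum coeff_smult coeff_monom
  by (simp add: if_distrib[of "\<lambda>x. _ * x"] cong: if_cong)

lemma higher_pderiv_diff: "(pderiv ^^ l) (P - Q :: complex poly) = (pderiv ^^ l) P - (pderiv ^^ l) Q"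
  by (induction l) (auto simp: pderiv_diff)

lemma higher_pderiv_sum: "(pderiv ^^ l) (\<Sum>i\<in>A. P i :: complex poly) = (\<Sum>i\<in>A. (pderiv ^^ l) (P i))"
  by (induction l) (auto simp: pderiv_sum)

lemma higher_pderiv_smult: "(pderiv ^^ l) (Polynomial.smult c P :: complex poly) = Polynomial.smult c ((pderiv ^^ l) P)"
  by (induction l) (auto simp: pderiv_smult)

lemma higher_deriv_poly: "(deriv ^^ l) (poly P) = poly ((pderiv ^^ l) (P :: complex poly))"
proof (induction l)
  case (Suc l)
  have "deriv (poly Q) = poly (pderiv Q)" for Q :: "complex poly"
    by (intro ext DERIV_imp_deriv poly_DERIV)
  with Suc show ?case by simp
qed simp

definition hermite_data :: "complex list \<Rightarrow> (complex \<times> nat) set" where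
  "hermite_data ys = (SIGMA y:set ys. {..<count_list ys y})"

lemma finite_hermite_data [simp]: "finite (hermite_data ys)"
  by (simp add: hermite_data_def)

lemma card_hermite_data: "card (hermite_data ys) = length ys"
  by (simp add: hermite_data_def sum_count_set)

lemma hermite_unique:
  assumes "degree P < length ys" "degree Q < length ys"
    and "\<And>y l. (y, l) \<in> hermite_data ys \<Longrightarrow> poly ((pderiv ^^ l) P) y = poly ((pderiv ^^ l) Q) y"
  shows "P = Q"
proof (rule ccontr)
  assume "P \<noteq> Q"
  then have "P - Q \<noteq> 0" by simp
  have "linprod ys dvd P - Q"
    unfolding hermite_data_vanish_iff_dvd[symmetric]
  proof (intro ballI allI impI)
    fix y l assume "y \<in> set ys" "l < count_list ys y"
    then have "(y, l) \<in> hermite_data ys" by (simp add: hermite_data_def)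
    from assms(3)[OF this] show "poly ((pderiv ^^ l) (P - Q)) y = 0"
      by (simp only: higher_pderiv_diff poly_diff diff_self)
  qed
  from dvd_imp_degree_le[OF this \<open>P - Q \<noteq> 0\<close>] have "length ys \<le> degree (P - Q)"
    by (simp only: degree_linprod)
  moreover have "degree (P - Q) < length ys"
    using assms(1,2) by (rule degree_diff_less)
  ultimately show False by simp
qed

text \<open>Uniqueness says that the square system for the coefficients has trivial kernel, so it is solvable.\<close>

lemma hermite_exists:
  assumes "ys \<noteq> []"
  shows "\<exists>P. degree P < length ys \<and> (\<forall>(y, l)\<in>hermite_data ys. poly ((pderiv ^^ l) P) y = D y l)"
proof -
  define mk where "mk c = (\<Sum>k<length ys. Polynomial.smult (c k) (monom 1 k))" for c :: "nat \<Rightarrow> complex"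
  have coeff_mk: "coeff (mk c) k = (if k < length ys then c k else 0)" for c k
    unfolding mk_def by (rule coeff_sum_monom)
  have deg: "degree (mk c) < length ys" for c
    using assms by (intro degree_lessI) (auto simp: coeff_mk)
  have ev: "poly ((pderiv ^^ l) (mk c)) y = (\<Sum>k<length ys. poly ((pderiv ^^ l) (monom 1 k)) y * c k)" for l c y
    unfolding mk_def higher_pderiv_sum higher_pderiv_smult poly_sum by (simp add: mult.commute)
  have "\<exists>c. \<forall>j\<in>hermite_data ys. (\<Sum>k<length ys. poly ((pderiv ^^ snd j) (monom 1 k)) (fst j) * c k) = D (fst j) (snd j)"
  proof (rule square_system_solvable)
    fix c :: "nat \<Rightarrow> complex"
    assume 0: "\<forall>j\<in>hermite_data ys. (\<Sum>k<length ys. poly ((pderiv ^^ snd j) (monom 1 k)) (fst j) * c k) = 0"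
    have "mk c = 0"
    proof (rule hermite_unique[OF deg])
      show "degree (0 :: complex poly) < length ys" using assms by simp
      fix y l assume "(y, l) \<in> hermite_data ys"
      from bspec[OF 0 this] have "poly ((pderiv ^^ l) (mk c)) y = 0"
        by (simp only: ev fst_conv snd_conv)
      moreover have "(pderiv ^^ l) (0 :: complex poly) = 0" by (induction l) simp_all
      ultimately show "poly ((pderiv ^^ l) (mk c)) y = poly ((pderiv ^^ l) 0) y" by (simp only: poly_0)
    qed
    show "\<forall>k\<in>{..<length ys}. c k = 0"
    proof
      fix k assume "k \<in> {..<length ys}"
      then show "c k = 0" using coeff_mk[of c k] \<open>mk c = 0\<close> by simp
    qed
  qed (simp_all add: card_hermite_data)
  then obtain c where c: "\<forall>j\<in>hermite_data ys.
    (\<Sum>k<length ys. poly ((pderiv ^^ snd j) (monom 1 k)) (fst j) * c k) = D (fst j) (snd j)" by (rule exE)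
  show ?thesis
  proof (intro exI[of _ "mk c"] conjI deg ballI)
    fix j assume "j \<in> hermite_data ys"
    from bspec[OF c this] show "case j of (y, l) \<Rightarrow> poly ((pderiv ^^ l) (mk c)) y = D y l"
      by (simp only: ev case_prod_beta)
  qed
qed

lemma is_hermite_interpolant_iff:
  "is_hermite_interpolant ys f P \<longleftrightarrow> degree P < length ys \<and>
     (\<forall>(y, l)\<in>hermite_data ys. poly ((pderiv ^^ l) P) y = (deriv ^^ l) f y)"
  by (simp add: is_hermite_interpolant_def hermite_data_def Ball_def) blast

lemma divided_difference_eqI:
  assumes "is_hermite_interpolant ys f P"
  shows "divided_difference ys f = coeff P (length ys - 1)"
proof -
  have "(THE P. is_hermite_interpolant ys f P) = P"
  proof (rule the_equality[of "is_hermite_interpolant ys f", OF assms])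
    fix Q assume Q: "is_hermite_interpolant ys f Q"
    show "Q = P"
    proof (rule hermite_unique[of Q ys P])
      show "degree Q < length ys" "degree P < length ys"
        using Q assms by (simp_all only: is_hermite_interpolant_iff)
      fix y l assume "(y, l) \<in> hermite_data ys"
      then show "poly ((pderiv ^^ l) Q) y = poly ((pderiv ^^ l) P) y"
        using Q assms unfolding is_hermite_interpolant_iff by fastforce
    qed
  qed
  then show ?thesis by (simp add: divided_difference_def)
qed

text \<open>A divided difference is a combination of the prescribed derivatives: the coefficients are the leading
coefficients of the polynomials that interpolate the unit vectors.\<close>

lemma divided_difference_data:
  assumes "ys \<noteq> []"
  shows "\<exists>a. \<forall>f. divided_difference ys f = (\<Sum>(y, l)\<in>hermite_data ys. a y l * (deriv ^^ l) f y)"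
proof -
  have "\<forall>p. \<exists>P. degree P < length ys \<and>
    (\<forall>(y, l)\<in>hermite_data ys. poly ((pderiv ^^ l) P) y = (if p = (y, l) then 1 else 0))"
    by (intro allI hermite_exists assms)
  from choice[OF this] obtain B where B': "\<forall>p. degree (B p) < length ys \<and>
    (\<forall>(y, l)\<in>hermite_data ys. poly ((pderiv ^^ l) (B p)) y = (if p = (y, l) then 1 else 0))"
    by (rule exE)
  have B: "\<And>p. degree (B p) < length ys"
    "\<And>p y l. (y, l) \<in> hermite_data ys \<Longrightarrow> poly ((pderiv ^^ l) (B p)) y = (if p = (y, l) then 1 else 0)"
    using B' by blast+
  show ?thesis
  proof (intro exI[of _ "\<lambda>y l. coeff (B (y, l)) (length ys - 1)"] allI)
    fix f
    define P where "P = (\<Sum>p\<in>hermite_data ys. Polynomial.smult ((deriv ^^ snd p) f (fst p)) (B p))"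
    have "is_hermite_interpolant ys f P"
      unfolding is_hermite_interpolant_iff
    proof safe
      show "degree P < length ys"
        unfolding P_def using assms B(1)
        by (intro degree_sum_less) (auto intro: le_less_trans[OF degree_smult_le])
      fix y l assume yl: "(y, l) \<in> hermite_data ys"
      have "poly ((pderiv ^^ l) P) y = (\<Sum>p\<in>hermite_data ys. (deriv ^^ snd p) f (fst p) * (if p = (y, l) then 1 else 0))"
        unfolding P_def higher_pderiv_sum higher_pderiv_smult poly_sum
        by (intro sum.cong) (auto simp: B(2)[OF yl])
      also have "\<dots> = (\<Sum>p\<in>hermite_data ys. if p = (y, l) then (deriv ^^ snd p) f (fst p) else 0)"
        by (intro sum.cong) auto
      also have "\<dots> = (deriv ^^ l) f y" using yl by simp
      finally show "poly ((pderiv ^^ l) P) y = (deriv ^^ l) f y" .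
    qed
    from divided_difference_eqI[OF this]
    show "divided_difference ys f = (\<Sum>(y, l)\<in>hermite_data ys. coeff (B (y, l)) (length ys - 1) * (deriv ^^ l) f y)"
      by (simp add: P_def coeff_sum split_beta mult.commute)
  qed
qed

text \<open>For a polynomial the Hermite interpolant is the remainder modulo \<open>linprod ys\<close>.\<close>

lemma divided_difference_poly:
  assumes "ys \<noteq> []"
  shows "divided_difference ys (poly p) = coeff (p mod linprod ys) (length ys - 1)"
proof (rule divided_difference_eqI, unfold is_hermite_interpolant_def, safe)
  show "degree (p mod linprod ys) < length ys"
    using degree_mod_less[of "linprod ys" p] assms by auto
  have "linprod ys dvd p mod linprod ys - p"
    by (metis dvd_minus_mod dvd_minus_iff minus_diff_eq)
  then show "poly ((pderiv ^^ l) (p mod linprod ys)) y = (deriv ^^ l) (poly p) y"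
    if "y \<in> set ys" "l < count_list ys y" for y l
    using that unfolding hermite_data_vanish_iff_dvd[symmetric]
    by (auto simp: higher_pderiv_diff higher_deriv_poly)
qed

lemma divided_difference_poly_dvd:
  "ys \<noteq> [] \<Longrightarrow> linprod ys dvd p \<Longrightarrow> divided_difference ys (poly p) = 0"
  by (simp add: divided_difference_poly)

text \<open>This evaluates a divided difference on a Newton polynomial; it yields the diagonal entries of the triangular
system below.\<close>

lemma divided_difference_poly_last:
  "divided_difference (ys @ [y]) (poly (linprod ys * q)) = poly q y"
proof -
  have "(linprod ys * q) mod linprod (ys @ [y]) = linprod ys * (q mod [:- y, 1:])"
    by (simp only: linprod_simps mult_1_right mod_mult_mult1)
  moreover have "q mod [:- y, 1:] = [:poly q y:]"
  proof -
    have "q mod [:- y, 1:] = ([:- y, 1:] * synthetic_div q y) mod [:- y, 1:] + [:poly q y:] mod [:- y, 1:]"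
      unfolding poly_mod_add_left[symmetric] synthetic_div_correct' by (rule refl)
    also have "[:poly q y:] mod [:- y, 1:] = [:poly q y:]"
      by (rule mod_poly_less) simp
    finally show ?thesis by (simp only: mod_mult_self1_is_0 add_0_left)
  qed
  ultimately have "(linprod ys * q) mod linprod (ys @ [y]) = Polynomial.smult (poly q y) (linprod ys)"
    by simp
  moreover have "coeff (linprod ys) (length ys) = 1" by (rule lead_coeff_linprod)
  ultimately show ?thesis using divided_difference_poly[of "ys @ [y]" "linprod ys * q"] by simp
qed

lemma divided_difference_poly_sum:
  fixes p :: "'a \<Rightarrow> complex poly"
  assumes "ys \<noteq> []" "finite A"
  shows "divided_difference ys (poly (\<Sum>k\<in>A. Polynomial.smult (c k) (p k)))
    = (\<Sum>k\<in>A. c k * divided_difference ys (poly (p k)))"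
  using assms(2)
proof (induction A rule: finite_induct)
  case empty
  show ?case using divided_difference_poly[OF assms(1), of 0] by (simp only: sum.empty mod_0 coeff_0)
next
  case (insert x A)
  then show ?case
    unfolding sum.insert[OF insert.hyps] divided_difference_poly[OF assms(1)]
      poly_mod_add_left mod_smult_left coeff_add coeff_smult by (simp only:)
qed

lemma divided_difference_poly_Cons:
  assumes "ys \<noteq> []"
  shows "divided_difference (y # ys) (poly p) = divided_difference ys (poly (synthetic_div p y))"
proof -
  define s where "s = synthetic_div p y"
  have p: "p = [:poly p y:] + [:- y, 1:] * s"
    using synthetic_div_correct'[of y p] by (simp add: s_def add.commute)
  have T: "degree (s mod linprod ys) < length ys"
    using degree_mod_less[of "linprod ys" s] assms by auto
  define M where "M = linprod ys"
  have M: "linprod (y # ys) = [:- y, 1:] * M" "degree (linprod (y # ys)) = Suc (length ys)"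
    by (simp add: M_def del: mult_pCons_left) (simp only: degree_linprod length_Cons)
  have "[:poly p y:] mod linprod (y # ys) = [:poly p y:]"
    by (intro mod_poly_less) (simp only: M(2) degree_pCons_0 zero_less_Suc)
  moreover have "([:- y, 1:] * s) mod linprod (y # ys) = [:- y, 1:] * (s mod M)"
    by (simp only: M(1) mod_mult_mult1)
  ultimately have "p mod linprod (y # ys) = [:poly p y:] + [:- y, 1:] * (s mod M)"
    using arg_cong[OF p, of "\<lambda>q. q mod linprod (y # ys)"] by (simp only: poly_mod_add_left)
  then have "divided_difference (y # ys) (poly p) = coeff ([:poly p y:] + [:- y, 1:] * (s mod M)) (length ys)"
    using divided_difference_poly[of "y # ys" p] by simp
  also have "\<dots> = coeff (s mod M) (length ys - 1)"
  proof -
    obtain n where n: "length ys = Suc n" using assms by (cases ys) auto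
    have "coeff (s mod M) (Suc n) = 0"
      using T by (simp add: coeff_eq_0 n M_def)
    then show ?thesis by (simp add: n)
  qed
  finally show ?thesis using assms by (simp add: divided_difference_poly s_def M_def)
qed

text \<open>For a nonempty list, the complete homogeneous symmetric polynomial of degree \<open>k + 1 - length ys\<close> in the
entries, zero if that number is negative, in the recursive form that synthetic division gives.\<close>

primrec hsym :: "complex list \<Rightarrow> nat \<Rightarrow> complex" where
  "hsym [] = (\<lambda>k. 0)"
| "hsym (y # ys) = (\<lambda>k. if ys = [] then y ^ k else \<Sum>j<k. y ^ (k - 1 - j) * hsym ys j)"

lemma synthetic_div_monom:
  "synthetic_div (monom 1 k) y = (\<Sum>j<k. Polynomial.smult (y ^ (k - 1 - j)) (monom 1 j))" for y :: complex
proof (induction k)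
  case (Suc k)
  have "synthetic_div (monom 1 (Suc k)) y = pCons (y ^ k) (synthetic_div (monom 1 k) y)"
    by (simp add: monom_Suc poly_monom)
  also have "\<dots> = (\<Sum>j<Suc k. Polynomial.smult (y ^ (k - j)) (monom 1 j))"
  proof (rule poly_eqI)
    fix n show "coeff (pCons (y ^ k) (synthetic_div (monom 1 k) y)) n = coeff (\<Sum>j<Suc k. Polynomial.smult (y ^ (k - j)) (monom 1 j)) n"
      unfolding Suc.IH coeff_sum_monom coeff_pCons by (cases n) (simp_all add: coeff_sum_monom)
  qed
  finally show ?case by simp
qed (simp only: monom_0 synthetic_div_pCons, simp)

lemma poly_monom_fun: "(\<lambda>x. x ^ k) = poly (monom (1::complex) k)"
  by (intro ext) (simp add: poly_monom)

lemma divided_difference_power: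
  "ys \<noteq> [] \<Longrightarrow> divided_difference ys (\<lambda>x. x ^ k) = hsym ys k"
proof (induction ys arbitrary: k)
  case (Cons y ys)
  show ?case
  proof (cases "ys = []")
    case True
    have "divided_difference ([] @ [y]) (poly (linprod [] * monom 1 k)) = poly (monom 1 k) y"
      by (rule divided_difference_poly_last)
    then show ?thesis using True by (simp add: poly_monom_fun poly_monom)
  next
    case False
    have "divided_difference (y # ys) (\<lambda>x. x ^ k)
        = divided_difference ys (poly (\<Sum>j<k. Polynomial.smult (y ^ (k - 1 - j)) (monom 1 j)))"
      by (simp only: poly_monom_fun divided_difference_poly_Cons[OF False] synthetic_div_monom)
    also have "\<dots> = (\<Sum>j<k. y ^ (k - 1 - j) * divided_difference ys (poly (monom 1 j)))"
      by (rule divided_difference_poly_sum[OF False]) simp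
    finally show ?thesis using Cons.IH[OF False] False by (simp add: poly_monom_fun)
  qed
qed simp

section \<open>Node vectors and the Prony recurrence\<close>

definition npoly :: "nat \<Rightarrow> cvec \<Rightarrow> complex poly" where
  "npoly r w = (\<Prod>j\<in>{1..r}. [:- w j, 1:])"

text \<open>\<open>w\<close> enumerates with multiplicity the roots of the characteristic polynomial of a linear recurrence for
\<open>\<mu>\<close>. In contrast to the Prony problem and to Pade approximation, this condition is polynomial in \<open>\<mu>\<close> and \<open>w\<close>,
so it passes to limits and to analytic continuations.\<close>

definition nodes :: "nat \<Rightarrow> cvec \<Rightarrow> cvec \<Rightarrow> bool" where
  "nodes r \<mu> w \<longleftrightarrow> w \<in> cspace {1..r} \<and> (\<forall>i<r. (\<Sum>k\<le>r. coeff (npoly r w) k * \<mu> (k + i)) = 0)"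

abbreviation nodelist :: "nat \<Rightarrow> cvec \<Rightarrow> complex list" where
  "nodelist r w \<equiv> map w (sorted_list_of_set {1..r})"

lemma npoly_linprod: "npoly r w = linprod (nodelist r w)"
  by (simp add: npoly_def linprod_map_distinct)

lemma degree_npoly [simp]: "degree (npoly r w) = r"
  by (simp add: npoly_linprod)

lemma npoly_nonzero [simp]: "npoly r w \<noteq> 0"
  by (simp add: npoly_linprod)

lemma lead_coeff_npoly [simp]: "coeff (npoly r w) r = 1"
  using lead_coeff_linprod[of "nodelist r w"] by (simp add: npoly_linprod)

lemma poly_npoly: "poly (npoly r w) z = (\<Prod>j\<in>{1..r}. z - w j)"
  by (simp add: npoly_def poly_prod)

lemma multiplicity_in_eq: "multiplicity_in r w \<tau> = count_list (nodelist r w) \<tau>"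
proof -
  have "count_list (map w xs) \<tau> = card {i \<in> set xs. w i = \<tau>}" if "distinct xs" for xs
    using that
  proof (induction xs)
    case (Cons x xs)
    have "{i \<in> set (x # xs). w i = \<tau>} = (if w x = \<tau> then insert x {i \<in> set xs. w i = \<tau>} else {i \<in> set xs. w i = \<tau>})"
      by auto
    with Cons show ?case by simp
  qed simp
  then show ?thesis by (simp add: multiplicity_in_def)
qed

lemma V_space_iff:
  "g \<in> V_space r w \<longleftrightarrow> (\<exists>c. g = (\<lambda>f. \<Sum>(\<tau>, l)\<in>hermite_data (nodelist r w). c \<tau> l * (deriv ^^ l) f \<tau>))"
  unfolding V_space_def mem_Collect_eq hermite_data_def multiplicity_in_eq
  by (subst sum.Sigma[symmetric]) (simp_all add: image_image)

lemma V_space_poly_linear: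
  assumes "g \<in> V_space r w" "finite A"
  shows "g (poly (\<Sum>k\<in>A. Polynomial.smult (a k) (p k))) = (\<Sum>k\<in>A. a k * g (poly (p k)))"
proof -
  obtain c where g: "g = (\<lambda>f. \<Sum>(\<tau>, l)\<in>hermite_data (nodelist r w). c \<tau> l * (deriv ^^ l) f \<tau>)"
    using assms(1) unfolding V_space_iff by (rule exE)
  show ?thesis
    unfolding g higher_deriv_poly higher_pderiv_sum higher_pderiv_smult poly_sum poly_smult
      sum_distrib_left case_prod_beta
    by (subst sum.swap) (intro sum.cong refl, simp only: mult_ac)
qed

lemma poly_as_sum: "degree p < n \<Longrightarrow> (\<Sum>k<n. Polynomial.smult (coeff p k) (monom 1 k)) = (p :: complex poly)"
  by (intro poly_eqI) (auto simp: coeff_sum_monom coeff_eq_0)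

lemma V_space_poly_moments:
  assumes "g \<in> V_space r w" "degree p < n"
  shows "g (poly p) = (\<Sum>k<n. coeff p k * g (\<lambda>x. x ^ k))"
  using V_space_poly_linear[OF assms(1), of "{..<n}" "coeff p" "monom 1"]
  by (simp only: poly_as_sum[OF assms(2)] poly_monom_fun finite_lessThan)

lemma V_space_poly_dvd:
  assumes "g \<in> V_space r w" "npoly r w dvd p"
  shows "g (poly p) = 0"
proof -
  obtain c where g: "g = (\<lambda>f. \<Sum>(\<tau>, l)\<in>hermite_data (nodelist r w). c \<tau> l * (deriv ^^ l) f \<tau>)"
    using assms(1) unfolding V_space_iff by (rule exE)
  have *: "poly ((pderiv ^^ l) p) \<tau> = 0" if "(\<tau>, l) \<in> hermite_data (nodelist r w)" for \<tau> l
    using assms(2) that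
    unfolding npoly_linprod hermite_data_vanish_iff_dvd[symmetric] hermite_data_def
    by blast
  show ?thesis unfolding g higher_deriv_poly
    by (rule sum.neutral) (use * in auto)
qed

text \<open>Functionals in \<open>V_space r w\<close> see a function only through its Hermite data at \<open>w\<close>, so they are determined by
their values on polynomials of degree below \<open>r\<close>.\<close>

lemma V_space_interpolate:
  assumes "1 \<le> r"
  shows "\<exists>P. degree P < r \<and> (\<forall>g\<in>V_space r w. g f = g (poly P))"
proof -
  have "nodelist r w \<noteq> []" using assms by (simp add: sorted_list_of_set_eq_Nil_iff)
  then obtain P where P: "degree P < r"
    "\<forall>(y, l)\<in>hermite_data (nodelist r w). poly ((pderiv ^^ l) P) y = (deriv ^^ l) f y"
    using hermite_exists[of "nodelist r w" "\<lambda>y l. (deriv ^^ l) f y"] by auto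
  show ?thesis
  proof (intro exI conjI ballI)
    show "degree P < r" by fact
    fix g assume "g \<in> V_space r w"
    then obtain c where g: "g = (\<lambda>f. \<Sum>(\<tau>, l)\<in>hermite_data (nodelist r w). c \<tau> l * (deriv ^^ l) f \<tau>)"
      unfolding V_space_iff by (rule exE)
    show "g f = g (poly P)" unfolding g higher_deriv_poly
      by (rule sum.cong) (use P(2) in auto)
  qed
qed

lemma sum_coeff_shift:
  fixes p :: "complex poly"
  assumes "degree p \<le> r" "r + i < n"
  shows "(\<Sum>k<n. coeff (monom 1 i * p) k * m k) = (\<Sum>k\<le>r. coeff p k * m (k + i))"
proof -
  have "(\<Sum>k\<le>r. coeff p k * m (k + i)) = (\<Sum>k\<in>(\<lambda>k. k + i) ` {..r}. coeff (monom 1 i * p) k * m k)"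
    by (subst sum.reindex) (simp_all add: inj_on_def coeff_monom_mult)
  also have "\<dots> = (\<Sum>k<n. coeff (monom 1 i * p) k * m k)"
  proof (rule sum.mono_neutral_left)
    show "\<forall>k\<in>{..<n} - (\<lambda>k. k + i) ` {..r}. coeff (monom 1 i * p) k * m k = 0"
    proof
      fix k assume k: "k \<in> {..<n} - (\<lambda>k. k + i) ` {..r}"
      have "i \<le> k \<Longrightarrow> \<not> k - i \<le> r"
      proof
        assume "i \<le> k" "k - i \<le> r"
        then have "k \<in> (\<lambda>k. k + i) ` {..r}" by (intro image_eqI[of _ _ "k - i"]) simp_all
        with k show False by blast
      qed
      then have "i \<le> k \<Longrightarrow> degree p < k - i" using assms(1) by linarith
      then have "coeff (monom 1 i * p) k = 0"
        by (simp add: coeff_monom_mult coeff_eq_0)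
      then show "coeff (monom 1 i * p) k * m k = 0" by simp
    qed
  qed (use assms in auto)
  finally show ?thesis by simp
qed

lemma degree_monom_npoly: "degree (monom 1 i * npoly r w) = i + r"
  by (simp add: degree_mult_eq degree_monom_eq)

text \<open>Apply the functional to \<open>x ^ i * npoly r w\<close>, which it annihilates.\<close>

lemma prony_solution_nodes:
  assumes "prony_solution r \<mu> w g"
  shows "nodes r \<mu> w"
  unfolding nodes_def
proof (intro conjI allI impI)
  show "w \<in> cspace {1..r}" using assms by (simp add: prony_solution_def)
  fix i assume i: "i < r"
  have g: "g \<in> V_space r w" "\<And>k. k < 2 * r \<Longrightarrow> g (\<lambda>x. x ^ k) = \<mu> k"
    using assms by (auto simp: prony_solution_def)
  have "(\<Sum>k\<le>r. coeff (npoly r w) k * \<mu> (k + i)) = (\<Sum>k<2 * r. coeff (monom 1 i * npoly r w) k * \<mu> k)"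
    by (rule sum_coeff_shift[symmetric]) (use i in simp_all)
  also have "\<dots> = (\<Sum>k<2 * r. coeff (monom 1 i * npoly r w) k * g (\<lambda>x. x ^ k))"
    by (intro sum.cong refl) (simp add: g(2))
  also have "\<dots> = g (poly (monom 1 i * npoly r w))"
    by (rule V_space_poly_moments[OF g(1), symmetric]) (use i in \<open>simp add: degree_monom_npoly\<close>)
  also have "\<dots> = 0" by (rule V_space_poly_dvd[OF g(1)]) simp
  finally show "(\<Sum>k\<le>r. coeff (npoly r w) k * \<mu> (k + i)) = 0" .
qed

text \<open>A monic recurrence of order \<open>r\<close> determines a sequence from its first \<open>r\<close> terms. This is why \<open>r\<close> of the
\<open>2 * r\<close> equations of the linear system imply the others.\<close>

lemma recurrence_unique:
  assumes "\<forall>i<r. (\<Sum>k\<le>r. coeff (npoly r w) k * a (k + i)) = 0"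
    and "\<forall>i<r. (\<Sum>k\<le>r. coeff (npoly r w) k * b (k + i)) = 0"
    and "\<forall>k<r. a k = b k" and "k < 2 * r"
  shows "a k = (b k :: complex)"
  using assms(4)
proof (induction k rule: less_induct)
  case (less k)
  show ?case
  proof (cases "k < r")
    case False
    define i where "i = k - r"
    have i: "i < r" "k = r + i" using False less.prems by (auto simp: i_def)
    have "(\<Sum>k<r. coeff (npoly r w) k * a (k + i)) = (\<Sum>k<r. coeff (npoly r w) k * b (k + i))"
      by (intro sum.cong refl arg_cong2[of _ _ _ _ "(*)"] less.IH) (use i less.prems in auto)
    moreover have "(\<Sum>k<r. coeff (npoly r w) k * a (k + i)) + a (r + i) = 0"
      "(\<Sum>k<r. coeff (npoly r w) k * b (k + i)) + b (r + i) = 0"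
      using assms(1,2) i(1) by (simp_all add: lessThan_Suc_atMost[symmetric])
    ultimately show ?thesis unfolding i(2) by (simp add: add_eq_0_iff)
  qed (use assms(3) in simp)
qed

text \<open>In the coordinate \<open>u = 1 / z\<close> the expansion becomes a power series \<open>A\<close> with \<open>A * q = p\<close>, where \<open>p\<close> and \<open>q\<close> are the
reversed numerator and denominator. As \<open>p\<close> has degree below \<open>r\<close>, the coefficients of \<open>u ^ (r + i)\<close> on the
left vanish, and these are the sums of the recurrence.\<close>

lemma pade_recurrence:
  assumes pade: "is_pade r \<mu> P Q" and r: "1 \<le> r" and i: "i < r"
  shows "(\<Sum>k\<le>r. coeff Q k * \<mu> (k + i)) = 0"
proof -
  have Q: "lead_coeff Q = 1" "degree Q = r" "degree P < r" using pade unfolding is_pade_def by blast+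
  obtain c where c: "\<forall>k<2 * r. c k = \<mu> k"
    and ev: "\<forall>\<^sub>F z in at_infinity. (\<lambda>k. c k / z ^ (k + 1)) sums (poly P z / poly Q z)"
    using pade unfolding is_pade_def by blast
  define A where "A = Abs_fps c"
  define q where "q = reflect_poly Q"
  define p where "p = monom 1 (r - 1 - degree P) * reflect_poly P"
  have q0: "poly q 0 = 1" using Q(1) by (simp add: q_def)
  have "isCont (poly q) 0" by simp
  then have "((poly q) \<longlongrightarrow> 1) (at 0)" using q0 by (simp add: isCont_def)
  then have evq: "\<forall>\<^sub>F u in at 0. poly q u \<noteq> 0" by (rule tendsto_imp_eventually_ne) simp
  have evc: "\<forall>\<^sub>F u in at 0. (\<lambda>k. c k / inverse u ^ (k + 1)) sums (poly P (inverse u) / poly Q (inverse u))"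
    by (rule eventually_compose_filterlim[OF ev filterlim_inverse_at_infinity])
  have ev0: "\<forall>\<^sub>F u in at 0. u \<noteq> (0 :: complex)" by (simp add: eventually_at_filter)
  have key: "summable (\<lambda>k. c k * u ^ k) \<and> eval_fps A u * poly q u = poly p u"
    if u: "u \<noteq> 0" "poly q u \<noteq> 0" and s: "(\<lambda>k. c k / inverse u ^ (k + 1)) sums (poly P (inverse u) / poly Q (inverse u))" for u
  proof -
    have "(\<lambda>k. c k / inverse u ^ (k + 1)) = (\<lambda>k. (c k * u ^ k) * u)"
      using u(1) by (simp add: field_simps)
    with s have s': "(\<lambda>k. (c k * u ^ k) * u) sums (poly P (inverse u) / poly Q (inverse u))" by simp
    then have "summable (\<lambda>k. (c k * u ^ k) * u)" by (rule sums_summable)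
    from summable_mult2[OF this, of "inverse u"]
    have sm: "summable (\<lambda>k. c k * u ^ k)" using u(1) by (simp add: mult.assoc)
    then have "(\<lambda>k. (c k * u ^ k) * u) sums (eval_fps A u * u)"
      unfolding eval_fps_def A_def by (intro sums_mult2) (simp add: summable_sums)
    from sums_unique2[OF this s'] have 1: "eval_fps A u * u = poly P (inverse u) / poly Q (inverse u)" .
    have q: "poly q u = u ^ r * poly Q (inverse u)"
      unfolding q_def using poly_reflect_poly_nz[OF u(1), of Q] by (simp only: Q(2))
    then have Qnz: "poly Q (inverse u) \<noteq> 0" using u(2) by auto
    have "eval_fps A u * poly q u = (eval_fps A u * u) * poly Q (inverse u) * u ^ (r - 1)"
      unfolding q using r by (simp add: power_eq_if)
    also have "\<dots> = poly P (inverse u) * u ^ (r - 1)" unfolding 1 using Qnz by simp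
    also have "\<dots> = poly p u"
    proof -
      have "u ^ (r - 1) = u ^ (r - 1 - degree P) * u ^ degree P"
        using Q(3) by (simp flip: power_add)
      then show ?thesis
        unfolding p_def poly_mult poly_monom using poly_reflect_poly_nz[OF u(1), of P] by simp
    qed
    finally show ?thesis using sm by blast
  qed
  have evk: "\<forall>\<^sub>F u in at 0. summable (\<lambda>k. c k * u ^ k) \<and> eval_fps A u * poly q u = poly p u"
    using ev0 evq evc by eventually_elim (rule key)
  have rad: "fps_conv_radius A > 0"
  proof -
    obtain u where u: "u \<noteq> 0" "summable (\<lambda>k. c k * u ^ k)"
      using eventually_happens'[OF at_neq_bot eventually_conj[OF ev0 evk]] by blast
    from conv_radius_geI[OF u(2)] have "ereal (norm u) \<le> fps_conv_radius A"
      by (simp add: fps_conv_radius_def A_def)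
    moreover have "0 < ereal (norm u)" using u(1) by simp
    ultimately show ?thesis by (rule less_le_trans[rotated])
  qed
  have cA: "(eval_fps A \<longlongrightarrow> eval_fps A 0) (at 0)"
    using continuous_eval_fps[of 0 A UNIV] rad by (simp add: continuous_within zero_ereal_def)
  have cq: "((\<lambda>u. eval_fps A u * poly q u) \<longlongrightarrow> eval_fps A 0 * poly q 0) (at 0)"
    by (intro tendsto_mult cA) (use \<open>isCont (poly q) 0\<close> in \<open>simp add: isCont_def\<close>)
  have "isCont (poly p) 0" by simp
  then have "((poly p) \<longlongrightarrow> poly p 0) (at 0)" by (simp add: isCont_def)
  moreover have evp: "\<forall>\<^sub>F u in at 0. eval_fps A u * poly q u = poly p u"
    using evk by eventually_elim blast
  from cq evp have "((poly p) \<longlongrightarrow> eval_fps A 0 * poly q 0) (at 0)" by (rule Lim_transform_eventually)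
  ultimately have at0: "eval_fps A 0 * poly q 0 = poly p 0"
    using tendsto_unique[OF at_neq_bot] by blast
  have evn: "\<forall>\<^sub>F u in nhds 0. eval_fps A u * poly q u = poly p u"
    unfolding eventually_nhds_conv_at using evp at0 by blast
  have evr: "\<forall>\<^sub>F u in nhds 0. ereal (norm (u :: complex)) < fps_conv_radius A"
  proof -
    have "open (eball (0 :: complex) (fps_conv_radius A))" by (rule open_eball)
    moreover have "(0 :: complex) \<in> eball 0 (fps_conv_radius A)" using rad by (simp add: zero_ereal_def)
    ultimately have "\<forall>\<^sub>F u in nhds 0. u \<in> eball (0 :: complex) (fps_conv_radius A)" by (rule eventually_nhds_in_open)
    then show ?thesis by eventually_elim simp
  qed
  have "A * fps_of_poly q = fps_of_poly p"
  proof (rule eval_fps_eqD)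
    have "0 < min (fps_conv_radius A) (fps_conv_radius (fps_of_poly q))" using rad by simp
    also have "\<dots> \<le> fps_conv_radius (A * fps_of_poly q)" by (rule fps_conv_radius_mult)
    finally show "0 < fps_conv_radius (A * fps_of_poly q)" .
    show "0 < fps_conv_radius (fps_of_poly p)" by simp
    show "\<forall>\<^sub>F z in nhds 0. eval_fps (A * fps_of_poly q) z = eval_fps (fps_of_poly p) z"
      using evn evr by eventually_elim (simp add: eval_fps_mult)
  qed
  then have "fps_nth (A * fps_of_poly q) (r + i) = fps_nth (fps_of_poly p) (r + i)" by (rule arg_cong)
  also have "fps_nth (fps_of_poly p) (r + i) = 0"
  proof -
    have "degree p \<le> (r - 1 - degree P) + degree P"
      unfolding p_def using degree_mult_le[of "monom (1::complex) (r - 1 - degree P)" "reflect_poly P"]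
        degree_reflect_poly_le[of P] degree_monom_le[of "1::complex" "r - 1 - degree P"] by linarith
    then have "degree p < r + i" using Q(3) by linarith
    then show ?thesis by (simp add: coeff_eq_0)
  qed
  also have "fps_nth (A * fps_of_poly q) (r + i) = (\<Sum>k\<le>r. coeff Q k * \<mu> (k + i))"
  proof -
    have "fps_nth (A * fps_of_poly q) (r + i) = (\<Sum>k = 0..r + i. c k * coeff q (r + i - k))"
      by (simp add: fps_mult_nth A_def)
    also have "\<dots> = (\<Sum>k\<in>(\<lambda>k. k + i) ` {..r}. c k * coeff q (r + i - k))"
    proof (rule sum.mono_neutral_right)
      show "\<forall>k\<in>{0..r + i} - (\<lambda>k. k + i) ` {..r}. c k * coeff q (r + i - k) = 0"
      proof
        fix k assume k: "k \<in> {0..r + i} - (\<lambda>k. k + i) ` {..r}"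
        have "k < i"
        proof (rule ccontr)
          assume "\<not> k < i"
          then have "k = (k - i) + i" "k - i \<in> {..r}" using k by auto
          then have "k \<in> (\<lambda>k. k + i) ` {..r}" by (rule image_eqI)
          with k show False by blast
        qed
        then show "c k * coeff q (r + i - k) = 0" by (simp add: q_def coeff_reflect_poly Q(2))
      qed
    qed auto
    also have "\<dots> = (\<Sum>k\<le>r. c (k + i) * coeff q (r - k))"
      by (subst sum.reindex) (simp_all add: inj_on_def)
    also have "\<dots> = (\<Sum>k\<le>r. coeff Q k * \<mu> (k + i))"
      by (intro sum.cong refl) (use c i in \<open>simp add: q_def coeff_reflect_poly Q(2) mult.commute\<close>)
    finally show ?thesis .
  qed
  finally show ?thesis .
qed

section \<open>The basis of divided differences and the linear system\<close>

lemma sorted_list_of_smallest: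
  assumes "finite X"
  shows "sorted_list_of_set (smallest l X) = take l (sorted_list_of_set X)"
  unfolding smallest_def
  by (rule sorted_list_of_set.idem_if_sorted_distinct) (simp_all add: sorted_wrt_take)

definition block :: "cvec \<Rightarrow> nat set \<Rightarrow> nat \<Rightarrow> complex list" where
  "block w X l = map w (take l (sorted_list_of_set X))"

lemma Delta_smallest: "finite X \<Longrightarrow> Delta w (smallest l X) = divided_difference (block w X l)"
  by (simp add: Delta_def sorted_list_of_smallest block_def)

lemma block_nonempty: "finite X \<Longrightarrow> l \<in> {1..card X} \<Longrightarrow> block w X l \<noteq> []"
  by (auto simp: block_def sorted_list_of_set_eq_Nil_iff)

lemma length_block: "finite X \<Longrightarrow> l \<le> card X \<Longrightarrow> length (block w X l) = l"
  by (simp add: block_def)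

lemma block_Suc:
  "finite X \<Longrightarrow> l < card X \<Longrightarrow> block w X (Suc l) = block w X l @ [w (sorted_list_of_set X ! l)]"
  by (simp add: block_def take_Suc_conv_app_nth)

definition rest :: "nat \<Rightarrow> cvec \<Rightarrow> nat set \<Rightarrow> complex poly" where
  "rest r w X = (\<Prod>j\<in>{1..r} - X. [:- w j, 1:])"

text \<open>The Newton polynomial of the part \<open>X\<close> for position \<open>l\<close>, multiplied by the linear factors of all points
outside \<open>X\<close>. The second factor makes it invisible to the other parts, the first to shorter
divided differences of \<open>X\<close>.\<close>

definition testpoly :: "nat \<Rightarrow> cvec \<Rightarrow> nat set \<Rightarrow> nat \<Rightarrow> complex poly" where
  "testpoly r w X l = linprod (block w X (l - 1)) * rest r w X"

lemma linprod_block_dvd_mono: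
  assumes "l \<le> l'"
  shows "linprod (block w X l) dvd linprod (block w X l')"
proof -
  have "take l' xs = take l xs @ drop l (take l' xs)" for xs :: "nat list"
    using assms by (metis append_take_drop_id min.absorb1 take_take)
  from this[of "sorted_list_of_set X"] have "block w X l' = block w X l @ map w (drop l (take l' (sorted_list_of_set X)))"
    unfolding block_def by (metis map_append)
  then show ?thesis by simp
qed

lemma linprod_block_dvd_rest:
  assumes "finite X" "X \<subseteq> {1..r} - Y"
  shows "linprod (block w X l) dvd rest r w Y"
proof -
  have "linprod (block w X l) = (\<Prod>i\<in>set (take l (sorted_list_of_set X)). [:- w i, 1:])"
    unfolding block_def by (rule linprod_map_distinct) simp
  moreover have "set (take l (sorted_list_of_set X)) \<subseteq> {1..r} - Y"
    using assms set_take_subset by fastforce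
  ultimately show ?thesis unfolding rest_def
    by (simp only:) (rule prod_dvd_prod_subset, simp_all)
qed

lemma linprod_block_dvd_npoly:
  assumes "finite X" "X \<subseteq> {1..r}"
  shows "linprod (block w X l) dvd npoly r w"
  using linprod_block_dvd_rest[of X r "{}"] assms by (simp add: rest_def npoly_def)

lemma degree_rest:
  assumes "X \<subseteq> {1..r}"
  shows "degree (rest r w X) + card X = r"
proof -
  have "rest r w X = linprod (map w (sorted_list_of_set ({1..r} - X)))"
    by (simp add: rest_def linprod_map_distinct)
  then have "degree (rest r w X) = card ({1..r} - X)" by simp
  also have "\<dots> = r - card X" using assms by (simp add: card_Diff_subset finite_subset)
  finally show ?thesis using card_mono[OF _ assms] by simp
qed

lemma degree_testpoly:
  assumes "X \<subseteq> {1..r}" "l \<in> {1..card X}"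
  shows "degree (testpoly r w X l) < r"
proof -
  have "length (block w X (l - 1)) = l - 1"
    using assms finite_subset[OF assms(1)] by (intro length_block) auto
  then have "degree (testpoly r w X l) \<le> (l - 1) + degree (rest r w X)"
    unfolding testpoly_def using degree_mult_le[of "linprod (block w X (l - 1))"] by simp
  with degree_rest[OF assms(1), of w] assms(2) show ?thesis by auto
qed

lemma dd_testpoly_other:
  assumes "finite X" "X \<subseteq> {1..r} - Y" "l \<in> {1..card X}"
  shows "divided_difference (block w X l) (poly (testpoly r w Y m)) = 0"
  using assms
  by (intro divided_difference_poly_dvd block_nonempty) (simp_all add: testpoly_def linprod_block_dvd_rest)

lemma dd_testpoly_lower:
  assumes "finite X" "l \<in> {1..card X}" "l < m"
  shows "divided_difference (block w X l) (poly (testpoly r w X m)) = 0"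
  using assms
  by (intro divided_difference_poly_dvd block_nonempty) (simp_all add: testpoly_def dvd_mult2 linprod_block_dvd_mono)

text \<open>The diagonal entries of the linear system with respect to the test polynomials.\<close>

definition pivot :: "nat \<Rightarrow> cvec \<Rightarrow> nat set \<Rightarrow> nat \<Rightarrow> complex" where
  "pivot r w X l = poly (rest r w X) (w (sorted_list_of_set X ! (l - 1)))"

lemma dd_testpoly_diag:
  assumes "finite X" "l \<in> {1..card X}"
  shows "divided_difference (block w X l) (poly (testpoly r w X l)) = pivot r w X l"
proof -
  obtain m where l: "l = Suc m" using assms(2) by (cases l) auto
  have "block w X l = block w X m @ [w (sorted_list_of_set X ! m)]"
    unfolding l by (rule block_Suc) (use assms l in auto)
  then show ?thesis
    by (simp only: testpoly_def pivot_def l diff_Suc_1 divided_difference_poly_last)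
qed

definition dd_sum :: "nat set set \<Rightarrow> cvec \<Rightarrow> (nat set \<times> nat \<Rightarrow> complex) \<Rightarrow> complex poly \<Rightarrow> complex" where
  "dd_sum \<C> w b p = (\<Sum>(X, l)\<in>conf_index \<C>. b (X, l) * divided_difference (block w X l) (poly p))"

lemma partition_finite:
  assumes "partition_on {1..r} \<C>"
  shows "finite \<C>" "X \<in> \<C> \<Longrightarrow> finite X" "X \<in> \<C> \<Longrightarrow> X \<subseteq> {1..r}" "finite (conf_index \<C>)"
proof -
  show C: "finite \<C>" using finite_elements[OF _ assms] by simp
  show sub: "X \<in> \<C> \<Longrightarrow> X \<subseteq> {1..r}" for X using assms by (auto simp: partition_on_def)
  show "X \<in> \<C> \<Longrightarrow> finite X" using sub finite_subset by blast
  show "finite (conf_index \<C>)" unfolding conf_index_def using C by (intro finite_SigmaI) simp_all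
qed

lemma partition_disjoint:
  fixes r :: nat
  assumes "partition_on {1..r} \<C>" "X \<in> \<C>" "Y \<in> \<C>" "X \<noteq> Y"
  shows "X \<subseteq> {1..r} - Y"
proof -
  have "X \<inter> Y = {}"
    using disjointD[OF partition_onD2[OF assms(1)] assms(2-4)] .
  then show ?thesis using partition_finite(3)[OF assms(1,2)] by blast
qed

lemma card_conf_index:
  assumes "partition_on {1..r} \<C>"
  shows "card (conf_index \<C>) = r"
proof -
  have "card (conf_index \<C>) = (\<Sum>X\<in>\<C>. card X)"
    unfolding conf_index_def using partition_finite(1)[OF assms] by (subst card_SigmaI) simp_all
  also have "\<dots> = card (\<Union>\<C>)"
    by (rule card_Union_disjoint[OF partition_onD2[OF assms] partition_finite(2)[OF assms], symmetric])
  also have "\<Union>\<C> = {1..r}" using assms by (simp add: partition_on_def)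
  finally show ?thesis by simp
qed

text \<open>This is where subordination enters: a point in \<open>X\<close> differs from every point outside \<open>X\<close>.\<close>

lemma pivot_nonzero:
  assumes C: "partition_on {1..r} \<C>" and "subordinated r w \<C>" "X \<in> \<C>" "l \<in> {1..card X}"
  shows "pivot r w X l \<noteq> 0"
proof -
  define i where "i = sorted_list_of_set X ! (l - 1)"
  have "i \<in> set (sorted_list_of_set X)"
    unfolding i_def using assms(4) by (intro nth_mem) (cases l, auto)
  then have i: "i \<in> X" using partition_finite(2)[OF C assms(3)] by simp
  have "w i \<noteq> w j" if "j \<in> {1..r} - X" for j
  proof
    assume eq: "w i = w j"
    have ij: "i \<in> {1..r}" "j \<in> {1..r}" "i \<noteq> j"
      using i that partition_finite(3)[OF C assms(3)] by auto
    then obtain Y where Y: "Y \<in> \<C>" "i \<in> Y" "j \<in> Y"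
      using assms(2) eq unfolding subordinated_def by blast
    then have "Y \<noteq> X" using that by blast
    from partition_disjoint[OF C Y(1) assms(3) this] Y(2) i show False by blast
  qed
  then show ?thesis unfolding pivot_def i_def[symmetric] rest_def poly_prod by simp
qed

lemma dd_sum_linear:
  assumes "partition_on {1..r} \<C>" "finite A"
  shows "dd_sum \<C> w b (\<Sum>k\<in>A. Polynomial.smult (a k) (p k)) = (\<Sum>k\<in>A. a k * dd_sum \<C> w b (p k))"
proof -
  have "dd_sum \<C> w b (\<Sum>k\<in>A. Polynomial.smult (a k) (p k)) =
    (\<Sum>(X, l)\<in>conf_index \<C>. \<Sum>k\<in>A. a k * (b (X, l) * divided_difference (block w X l) (poly (p k))))"
    unfolding dd_sum_def
  proof (intro sum.cong refl, clarify)
    fix X l assume "(X, l) \<in> conf_index \<C>"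
    then have "block w X l \<noteq> []"
      using partition_finite(2)[OF assms(1)] by (intro block_nonempty) (auto simp: conf_index_def)
    from divided_difference_poly_sum[OF this assms(2), of a p]
    show "b (X, l) * divided_difference (block w X l) (poly (\<Sum>k\<in>A. Polynomial.smult (a k) (p k))) =
      (\<Sum>k\<in>A. a k * (b (X, l) * divided_difference (block w X l) (poly (p k))))"
      by (simp only: sum_distrib_left mult_ac)
  qed
  also have "\<dots> = (\<Sum>k\<in>A. a k * dd_sum \<C> w b (p k))"
    unfolding dd_sum_def sum_distrib_left case_prod_beta by (rule sum.swap)
  finally show ?thesis .
qed

lemma dd_sum_moments:
  assumes "partition_on {1..r} \<C>" "degree p < n"
  shows "dd_sum \<C> w b p = (\<Sum>k<n. coeff p k * dd_sum \<C> w b (monom 1 k))"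
  using dd_sum_linear[OF assms(1), of "{..<n}" w b "coeff p" "monom 1"]
  by (simp only: poly_as_sum[OF assms(2)] finite_lessThan)

lemma sum_conf_index:
  assumes "partition_on {1..r} \<C>"
  shows "(\<Sum>(X, l)\<in>conf_index \<C>. f X l) = (\<Sum>X\<in>\<C>. \<Sum>l\<in>{1..card X}. f X l)"
  unfolding conf_index_def using partition_finite(1)[OF assms] by (subst sum.Sigma) simp_all

text \<open>The linear system is triangular: on the test polynomial for \<open>(X, m)\<close> only the coordinates \<open>(X, l)\<close> with
\<open>l \<ge> m\<close> contribute.\<close>

lemma dd_sum_testpoly:
  assumes C: "partition_on {1..r} \<C>" and X: "X \<in> \<C>" and m: "m \<in> {1..card X}"
  shows "dd_sum \<C> w b (testpoly r w X m) = b (X, m) * pivot r w X m +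
    (\<Sum>l\<in>{m<..card X}. b (X, l) * divided_difference (block w X l) (poly (testpoly r w X m)))"
proof -
  define D where "D Y l = divided_difference (block w Y l) (poly (testpoly r w X m))" for Y l
  note fin = partition_finite[OF C]
  have "dd_sum \<C> w b (testpoly r w X m) = (\<Sum>Y\<in>\<C>. \<Sum>l\<in>{1..card Y}. b (Y, l) * D Y l)"
    unfolding dd_sum_def D_def by (rule sum_conf_index[OF C])
  also have "\<dots> = (\<Sum>l\<in>{1..card X}. b (X, l) * D X l) + (\<Sum>Y\<in>\<C> - {X}. \<Sum>l\<in>{1..card Y}. b (Y, l) * D Y l)"
    using fin(1) X by (subst sum.remove) simp_all
  also have "(\<Sum>Y\<in>\<C> - {X}. \<Sum>l\<in>{1..card Y}. b (Y, l) * D Y l) = 0"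
  proof (intro sum.neutral ballI)
    fix Y l assume Y: "Y \<in> \<C> - {X}" and l: "l \<in> {1..card Y}"
    have "D Y l = 0" unfolding D_def
      by (rule dd_testpoly_other[OF _ _ l]) (use Y X fin(2) partition_disjoint[OF C, of Y X] in blast)+
    then show "b (Y, l) * D Y l = 0" by simp
  qed
  also have "(\<Sum>l\<in>{1..card X}. b (X, l) * D X l) = (\<Sum>l\<in>{m..card X}. b (X, l) * D X l)"
  proof (rule sum.mono_neutral_right)
    show "\<forall>l\<in>{1..card X} - {m..card X}. b (X, l) * D X l = 0"
    proof
      fix l assume "l \<in> {1..card X} - {m..card X}"
      then have "l \<in> {1..card X}" "l < m" by auto
      from dd_testpoly_lower[OF fin(2)[OF X] this] show "b (X, l) * D X l = 0"
        unfolding D_def by simp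
    qed
  qed (use m in auto)
  also have "{m..card X} = insert m {m<..card X}" using m by auto
  also have "(\<Sum>l\<in>insert m {m<..card X}. b (X, l) * D X l) = b (X, m) * D X m + (\<Sum>l\<in>{m<..card X}. b (X, l) * D X l)"
    by (rule sum.insert) simp_all
  also have "D X m = pivot r w X m"
    unfolding D_def by (rule dd_testpoly_diag[OF fin(2)[OF X] m])
  finally show ?thesis by (simp add: D_def)
qed

text \<open>Back substitution, from the longest divided difference of each part downwards.\<close>

lemma dd_sum_injective:
  assumes C: "partition_on {1..r} \<C>" and sub: "subordinated r w \<C>"
    and 0: "\<forall>k<r. dd_sum \<C> w b (monom 1 k) = 0"
  shows "\<forall>p\<in>conf_index \<C>. b p = 0"
proof -
  have "b (X, m) = 0" if X: "X \<in> \<C>" and "m \<in> {1..card X}" for X m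
    using that(2)
  proof (induction "card X - m" arbitrary: m rule: less_induct)
    case less
    have "dd_sum \<C> w b (testpoly r w X m) = 0"
      unfolding dd_sum_moments[OF C degree_testpoly[OF partition_finite(3)[OF C X] less.prems]]
      using 0 by simp
    moreover have "(\<Sum>l\<in>{m<..card X}. b (X, l) * divided_difference (block w X l) (poly (testpoly r w X m))) = 0"
    proof (intro sum.neutral ballI)
      fix l assume "l \<in> {m<..card X}"
      then have "b (X, l) = 0" using less.prems by (intro less.hyps) auto
      then show "b (X, l) * divided_difference (block w X l) (poly (testpoly r w X m)) = 0" by simp
    qed
    ultimately show ?case
      using dd_sum_testpoly[OF C X less.prems, of w b] pivot_nonzero[OF C sub X less.prems] by simp
  qed
  then show ?thesis by (auto simp: conf_index_def)
qed

lemma dd_sum_solvable: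
  assumes C: "partition_on {1..r} \<C>" and sub: "subordinated r w \<C>"
  shows "\<exists>b\<in>conf_index \<C> \<rightarrow>\<^sub>E UNIV. \<forall>k<r. dd_sum \<C> w b (monom 1 k) = m k"
proof -
  define a where "a k p = divided_difference (block w (fst p) (snd p)) (poly (monom 1 k))" for k p
  have a: "(\<Sum>p\<in>conf_index \<C>. a k p * c p) = dd_sum \<C> w c (monom 1 k)" for k c
    unfolding dd_sum_def a_def by (simp add: case_prod_beta mult.commute)
  have "\<exists>c. \<forall>k\<in>{..<r}. (\<Sum>p\<in>conf_index \<C>. a k p * c p) = m k"
  proof (rule square_system_solvable)
    show "\<forall>p\<in>conf_index \<C>. c p = 0" if "\<forall>k\<in>{..<r}. (\<Sum>p\<in>conf_index \<C>. a k p * c p) = 0" for c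
      using that unfolding a by (intro dd_sum_injective[OF C sub]) simp
  qed (use card_conf_index[OF C] partition_finite(4)[OF C] in simp_all)
  then obtain c where c: "\<forall>k\<in>{..<r}. dd_sum \<C> w c (monom 1 k) = m k"
    unfolding a by (rule exE)
  have "dd_sum \<C> w (restrict c (conf_index \<C>)) q = dd_sum \<C> w c q" for q
    unfolding dd_sum_def by (intro sum.cong) auto
  with c show ?thesis by (intro bexI[of _ "restrict c (conf_index \<C>)"]) auto
qed

lemma B_combination_eq:
  assumes "partition_on {1..r} \<C>"
  shows "B_combination \<C> w b = (\<lambda>f. \<Sum>(X, l)\<in>conf_index \<C>. b (X, l) * divided_difference (block w X l) f)"
  unfolding B_combination_def using partition_finite(2)[OF assms]
  by (intro ext sum.cong refl) (auto simp: conf_index_def Delta_smallest)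

lemma B_combination_poly:
  assumes "partition_on {1..r} \<C>"
  shows "B_combination \<C> w b (poly p) = dd_sum \<C> w b p"
  unfolding B_combination_eq[OF assms] dd_sum_def ..

lemma order_linprod: "Polynomial.order y (linprod ys) = count_list ys y"
proof (induction ys)
  case (Cons a ys)
  have "[:- a, 1:] * linprod ys \<noteq> 0"
    unfolding linprod_simps(2)[symmetric] by (rule linprod_nonzero)
  from order_mult[OF this, of y] show ?case
    unfolding linprod_simps(2) order_linear_factor Cons.IH by simp
qed simp

lemma block_hermite_data:
  assumes "finite X" "X \<subseteq> {1..r}"
  shows "hermite_data (block w X l) \<subseteq> hermite_data (nodelist r w)"
proof -
  have "linprod (block w X l) dvd linprod (nodelist r w)"
    using linprod_block_dvd_npoly[OF assms] by (simp add: npoly_linprod)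
  then have cnt: "count_list (block w X l) y \<le> count_list (nodelist r w) y" for y
    unfolding linprod_dvd_iff_order order_linprod using linprod_nonzero by blast
  show ?thesis
  proof
    fix p assume p: "p \<in> hermite_data (block w X l)"
    obtain y j where yj: "p = (y, j)" by (cases p)
    have "j < count_list (nodelist r w) y"
      using p cnt[of y] by (simp add: hermite_data_def yj)
    moreover from this have "y \<in> set (nodelist r w)"
      by (metis count_list_0_iff less_nat_zero_code)
    ultimately show "p \<in> hermite_data (nodelist r w)" by (simp add: hermite_data_def yj)
  qed
qed

lemma block_dd_in_V_space:
  assumes "finite X" "X \<subseteq> {1..r}" "l \<in> {1..card X}"
  shows "divided_difference (block w X l) \<in> V_space r w"
proof -
  obtain a where a: "\<forall>f. divided_difference (block w X l) f =
      (\<Sum>(y, j)\<in>hermite_data (block w X l). a y j * (deriv ^^ j) f y)"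
    using divided_difference_data[OF block_nonempty[OF assms(1,3)]] by (rule exE)
  \<comment> \<open>Extension by zero, as \<open>V_space\<close> sums over the derivatives at all nodes.\<close>
  define c where "c y j = (if (y, j) \<in> hermite_data (block w X l) then a y j else 0)" for y j
  have "divided_difference (block w X l) f = (\<Sum>(y, j)\<in>hermite_data (nodelist r w). c y j * (deriv ^^ j) f y)" for f
    unfolding a[rule_format]
    by (rule sum.mono_neutral_cong_left[OF _ block_hermite_data[OF assms(1,2)]]) (auto simp: c_def)
  then show ?thesis unfolding V_space_iff by blast
qed

lemma V_space_add: "g \<in> V_space r w \<Longrightarrow> h \<in> V_space r w \<Longrightarrow> (\<lambda>f. a * g f + h f) \<in> V_space r w"
proof -
  assume "g \<in> V_space r w" "h \<in> V_space r w"
  then obtain c d where "g = (\<lambda>f. \<Sum>(\<tau>, l)\<in>hermite_data (nodelist r w). c \<tau> l * (deriv ^^ l) f \<tau>)"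
    "h = (\<lambda>f. \<Sum>(\<tau>, l)\<in>hermite_data (nodelist r w). d \<tau> l * (deriv ^^ l) f \<tau>)"
    unfolding V_space_iff by blast
  then have "(\<lambda>f. a * g f + h f) = (\<lambda>f. \<Sum>(\<tau>, l)\<in>hermite_data (nodelist r w). (a * c \<tau> l + d \<tau> l) * (deriv ^^ l) f \<tau>)"
    by (simp only: sum_distrib_left sum.distrib[symmetric] case_prod_unfold distrib_right mult.assoc)
  then show ?thesis unfolding V_space_iff by (intro exI[of _ "\<lambda>\<tau> l. a * c \<tau> l + d \<tau> l"])
qed

lemma V_space_zero: "(\<lambda>f. 0) \<in> V_space r w"
  unfolding V_space_iff by (intro exI[of _ "\<lambda>_ _. 0"]) (simp add: case_prod_beta)

lemma V_space_sum:
  assumes "finite A" "\<And>p. p \<in> A \<Longrightarrow> g p \<in> V_space r w"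
  shows "(\<lambda>f. \<Sum>p\<in>A. a p * g p f) \<in> V_space r w"
  using assms
proof (induction A rule: finite_induct)
  case empty
  show ?case using V_space_zero by simp
next
  case (insert p A)
  have "(\<lambda>f. a p * g p f + (\<Sum>p\<in>A. a p * g p f)) \<in> V_space r w"
    by (rule V_space_add) (use insert in blast)+
  then show ?case by (simp only: sum.insert[OF insert.hyps])
qed

lemma B_combination_in_V_space:
  assumes C: "partition_on {1..r} \<C>"
  shows "B_combination \<C> w b \<in> V_space r w"
  unfolding B_combination_eq[OF C] case_prod_beta
proof (rule V_space_sum[OF partition_finite(4)[OF C]])
  fix p assume "p \<in> conf_index \<C>"
  then have "fst p \<in> \<C>" "snd p \<in> {1..card (fst p)}" by (auto simp: conf_index_def)
  then show "divided_difference (block w (fst p) (snd p)) \<in> V_space r w"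
    by (intro block_dd_in_V_space partition_finite[OF C])
qed

text \<open>Surjectivity: solve for the first \<open>r\<close> moments of \<open>g\<close>. The result agrees with \<open>g\<close> on polynomials of degree below \<open>r\<close>,
hence everywhere.\<close>

lemma B_combination_bij:
  assumes C: "partition_on {1..r} \<C>" and sub: "subordinated r w \<C>" and r: "1 \<le> r"
  shows "bij_betw (B_combination \<C> w) (conf_index \<C> \<rightarrow>\<^sub>E UNIV) (V_space r w)"
  unfolding bij_betw_def
proof (intro conjI inj_onI equalityI subsetI)
  fix b b' assume bb: "b \<in> conf_index \<C> \<rightarrow>\<^sub>E UNIV" "b' \<in> conf_index \<C> \<rightarrow>\<^sub>E (UNIV :: complex set)"
    and eq: "B_combination \<C> w b = B_combination \<C> w b'"
  have "dd_sum \<C> w (\<lambda>p. b p - b' p) q = dd_sum \<C> w b q - dd_sum \<C> w b' q" for q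
    unfolding dd_sum_def by (simp add: sum_subtractf[symmetric] case_prod_beta left_diff_distrib)
  then have "\<forall>k<r. dd_sum \<C> w (\<lambda>p. b p - b' p) (monom 1 k) = 0"
    unfolding B_combination_poly[OF C, symmetric] eq by simp
  from dd_sum_injective[OF C sub this] show "b = b'"
    by (intro PiE_ext[OF bb]) simp
next
  fix g assume "g \<in> B_combination \<C> w ` (conf_index \<C> \<rightarrow>\<^sub>E UNIV)"
  then show "g \<in> V_space r w" using B_combination_in_V_space[OF C] by blast
next
  fix g assume g: "g \<in> V_space r w"
  obtain b where b: "b \<in> conf_index \<C> \<rightarrow>\<^sub>E UNIV" "\<forall>k<r. dd_sum \<C> w b (monom 1 k) = g (\<lambda>x. x ^ k)"
    using dd_sum_solvable[OF C sub, of "\<lambda>k. g (\<lambda>x. x ^ k)"] by (elim bexE)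
  have "B_combination \<C> w b f = g f" for f
  proof -
    obtain P where P: "degree P < r" "\<forall>g\<in>V_space r w. g f = g (poly P)"
      using V_space_interpolate[OF r, of w f] by (elim exE conjE)
    have "B_combination \<C> w b f = dd_sum \<C> w b P"
      using bspec[OF P(2) B_combination_in_V_space[OF C, of w b]] unfolding B_combination_poly[OF C] .
    also have "\<dots> = g (poly P)"
      unfolding dd_sum_moments[OF C P(1)] V_space_poly_moments[OF g P(1)]
      using b(2) by (intro sum.cong) simp_all
    also have "\<dots> = g f" using bspec[OF P(2) g] by simp
    finally show ?thesis .
  qed
  then have "g = B_combination \<C> w b" by (intro ext) simp
  then show "g \<in> B_combination \<C> w ` (conf_index \<C> \<rightarrow>\<^sub>E UNIV)" using b(1) by blast
qed

lemma solves_linear_system_iff: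
  assumes C: "partition_on {1..r} \<C>"
  shows "solves_linear_system r \<C> \<mu> w b \<longleftrightarrow> b \<in> (conf_index \<C> \<rightarrow>\<^sub>E UNIV) \<and>
    (\<forall>k<2 * r. dd_sum \<C> w b (monom 1 k) = \<mu> k)"
  unfolding solves_linear_system_def B_combination_poly[OF C, symmetric] poly_monom_fun[symmetric]
  by (simp add: B_combination_def)

text \<open>The first \<open>r\<close> equations determine the solution. Its moments and \<open>\<mu>\<close> satisfy the same recurrence of
order \<open>r\<close>, so all \<open>2 * r\<close> equations hold.\<close>

lemma linear_system_unique_solution:
  assumes C: "partition_on {1..r} \<C>" and sub: "subordinated r w \<C>" and nd: "nodes r \<mu> w"
  shows "\<exists>!b. solves_linear_system r \<C> \<mu> w b"
proof -
  obtain b where b: "b \<in> conf_index \<C> \<rightarrow>\<^sub>E UNIV" "\<forall>k<r. dd_sum \<C> w b (monom 1 k) = \<mu> k"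
    using dd_sum_solvable[OF C sub, of \<mu>] by (elim bexE)
  have "solves_linear_system r \<C> \<mu> w b"
    unfolding solves_linear_system_iff[OF C]
  proof (intro conjI allI impI b(1))
    fix k assume "k < 2 * r"
    show "dd_sum \<C> w b (monom 1 k) = \<mu> k"
    proof (rule recurrence_unique[of r w, OF _ _ b(2) \<open>k < 2 * r\<close>])
      show "\<forall>i<r. (\<Sum>k\<le>r. coeff (npoly r w) k * \<mu> (k + i)) = 0"
        using nd by (simp add: nodes_def)
      show "\<forall>i<r. (\<Sum>k\<le>r. coeff (npoly r w) k * dd_sum \<C> w b (monom 1 (k + i))) = 0"
      proof (intro allI impI)
        fix i assume "i < r"
        have "(\<Sum>k\<le>r. coeff (npoly r w) k * dd_sum \<C> w b (monom 1 (k + i))) =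
          (\<Sum>k<2 * r. coeff (monom 1 i * npoly r w) k * dd_sum \<C> w b (monom 1 k))"
          by (rule sum_coeff_shift[symmetric]) (use \<open>i < r\<close> in simp_all)
        also have "\<dots> = B_combination \<C> w b (poly (monom 1 i * npoly r w))"
          unfolding B_combination_poly[OF C]
          by (rule dd_sum_moments[OF C, symmetric]) (use \<open>i < r\<close> in \<open>simp add: degree_monom_npoly\<close>)
        also have "\<dots> = 0"
          by (rule V_space_poly_dvd[OF B_combination_in_V_space[OF C]]) simp
        finally show "(\<Sum>k\<le>r. coeff (npoly r w) k * dd_sum \<C> w b (monom 1 (k + i))) = 0" .
      qed
    qed
  qed
  moreover have "b' = b" if "solves_linear_system r \<C> \<mu> w b'" for b'
  proof -
    have b': "b' \<in> conf_index \<C> \<rightarrow>\<^sub>E UNIV" "\<forall>k<r. dd_sum \<C> w b' (monom 1 k) = \<mu> k"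
      using that unfolding solves_linear_system_iff[OF C] by auto
    have "dd_sum \<C> w (\<lambda>p. b' p - b p) q = dd_sum \<C> w b' q - dd_sum \<C> w b q" for q
      unfolding dd_sum_def by (simp add: sum_subtractf[symmetric] case_prod_beta left_diff_distrib)
    then have "\<forall>k<r. dd_sum \<C> w (\<lambda>p. b' p - b p) (monom 1 k) = 0"
      using b(2) b'(2) by simp
    from dd_sum_injective[OF C sub this] show "b' = b"
      by (intro PiE_ext[OF b'(1) b(1)]) simp
  qed
  ultimately show ?thesis by blast
qed

lemma coeff_linear_mult:
  "coeff ([:- y, 1:] * p) k = (if k = 0 then 0 else coeff p (k - 1)) - y * coeff p k" for y :: complex
  by (cases k) simp_all

lemma continuous_on_coeff_linprod:
  fixes f :: "'s::topological_space \<Rightarrow> cvec"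
  assumes "\<And>i. continuous_on S (\<lambda>s. f s i)"
  shows "continuous_on S (\<lambda>s. coeff (linprod (map (f s) xs)) k)"
proof (induction xs arbitrary: k)
  case (Cons x xs)
  have "continuous_on S (\<lambda>s. (if k = 0 then 0 else coeff (linprod (map (f s) xs)) (k - 1)) -
      f s x * coeff (linprod (map (f s) xs)) k)"
  proof (intro continuous_on_diff continuous_on_mult assms Cons.IH)
    show "continuous_on S (\<lambda>s. if k = 0 then 0 else coeff (linprod (map (f s) xs)) (k - 1))"
      by (cases "k = 0") (simp_all add: Cons.IH)
  qed
  then show ?case by (simp only: list.map linprod_simps coeff_linear_mult)
qed simp

lemma continuous_on_hsym:
  fixes f :: "'s::topological_space \<Rightarrow> cvec"
  assumes "\<And>i. continuous_on S (\<lambda>s. f s i)"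
  shows "continuous_on S (\<lambda>s. hsym (map (f s) xs) k)"
proof (induction xs arbitrary: k)
  case (Cons x xs)
  show ?case
    by (cases "xs = []") (simp_all add: continuous_on_power continuous_on_sum continuous_on_mult assms Cons)
qed simp

lemma dd_block_poly:
  assumes "finite X" "l \<in> {1..card X}" "degree p < n"
  shows "divided_difference (block w X l) (poly p) = (\<Sum>k<n. coeff p k * hsym (block w X l) k)"
proof -
  have ne: "block w X l \<noteq> []" using assms(1,2) by (rule block_nonempty)
  have "divided_difference (block w X l) (poly p) =
      (\<Sum>k<n. coeff p k * divided_difference (block w X l) (poly (monom 1 k)))"
    using divided_difference_poly_sum[OF ne, of "{..<n}" "coeff p" "monom 1"]
    by (simp only: poly_as_sum[OF assms(3)] finite_lessThan)
  then show ?thesis by (simp only: poly_monom_fun[symmetric] divided_difference_power[OF ne])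
qed

lemma rest_linprod: "rest r w X = linprod (map w (sorted_list_of_set ({1..r} - X)))"
  by (simp add: rest_def linprod_map_distinct)

lemma testpoly_linprod:
  "testpoly r w X l = linprod (map w (take (l - 1) (sorted_list_of_set X) @ sorted_list_of_set ({1..r} - X)))"
  by (simp add: testpoly_def rest_linprod block_def)

text \<open>Back substitution in the triangular system expresses each coordinate by continuous functions of moments and
nodes and by coordinates that are already known to be continuous. Moments and nodes may depend on any
parameter; the pairs \<open>(\<mu>, w)\<close> themselves are the parameter later on.\<close>

lemma linear_system_solution_continuous:
  fixes \<mu> w :: "'s::topological_space \<Rightarrow> cvec"
  assumes C: "partition_on {1..r} \<C>"
    and sub: "\<And>s. s \<in> S \<Longrightarrow> subordinated r (w s) \<C>"
    and sol: "\<And>s k. s \<in> S \<Longrightarrow> k < r \<Longrightarrow> dd_sum \<C> (w s) (b s) (monom 1 k) = \<mu> s k"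
    and cm: "\<And>i. continuous_on S (\<lambda>s. \<mu> s i)" and cw: "\<And>i. continuous_on S (\<lambda>s. w s i)"
    and p: "p \<in> conf_index \<C>"
  shows "continuous_on S (\<lambda>s. b s p)"
proof -
  have "continuous_on S (\<lambda>s. b s (X, m))" if X: "X \<in> \<C>" and "m \<in> {1..card X}" for X m
    using that(2)
  proof (induction "card X - m" arbitrary: m rule: less_induct)
    case less
    note fin = partition_finite[OF C]
    have dg: "degree (testpoly r (w s) X m) < r" for s
      by (rule degree_testpoly[OF fin(3)[OF X] less.prems])
    have cc: "continuous_on S (\<lambda>s. coeff (testpoly r (w s) X m) k)" for k
      unfolding testpoly_linprod by (rule continuous_on_coeff_linprod[OF cw])
    have cd: "continuous_on S (\<lambda>s. divided_difference (block (w s) X l) (poly (testpoly r (w s) X m)))"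
      if "l \<in> {1..card X}" for l
      unfolding dd_block_poly[OF fin(2)[OF X] that dg] unfolding block_def
      by (intro continuous_on_sum continuous_on_mult cc continuous_on_hsym cw)
    have eq: "b s (X, m) = ((\<Sum>k<r. coeff (testpoly r (w s) X m) k * \<mu> s k) -
        (\<Sum>l\<in>{m<..card X}. b s (X, l) * divided_difference (block (w s) X l) (poly (testpoly r (w s) X m))))
        / pivot r (w s) X m" if s: "s \<in> S" for s
    proof -
      have "(\<Sum>k<r. coeff (testpoly r (w s) X m) k * \<mu> s k) = dd_sum \<C> (w s) (b s) (testpoly r (w s) X m)"
        unfolding dd_sum_moments[OF C dg] by (intro sum.cong refl) (simp add: sol[OF s])
      also note dd_sum_testpoly[OF C X less.prems]
      finally have "(\<Sum>k<r. coeff (testpoly r (w s) X m) k * \<mu> s k) -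
        (\<Sum>l\<in>{m<..card X}. b s (X, l) * divided_difference (block (w s) X l) (poly (testpoly r (w s) X m)))
        = b s (X, m) * pivot r (w s) X m" by simp
      then show ?thesis using pivot_nonzero[OF C sub[OF s] X less.prems] by simp
    qed
    have "continuous_on S (\<lambda>s. ((\<Sum>k<r. coeff (testpoly r (w s) X m) k * \<mu> s k) -
        (\<Sum>l\<in>{m<..card X}. b s (X, l) * divided_difference (block (w s) X l) (poly (testpoly r (w s) X m))))
        / pivot r (w s) X m)"
    proof (intro continuous_on_divide continuous_on_diff continuous_on_sum continuous_on_mult cc cm)
      show "continuous_on S (\<lambda>s. b s (X, l))" if "l \<in> {m<..card X}" for l
        by (rule less.hyps) (use that less.prems in auto)
      show "continuous_on S (\<lambda>s. divided_difference (block (w s) X l) (poly (testpoly r (w s) X m)))"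
        if "l \<in> {m<..card X}" for l
        by (rule cd) (use that less.prems in auto)
      show "continuous_on S (\<lambda>s. pivot r (w s) X m)"
        unfolding pivot_def rest_def poly_prod by (simp, intro continuous_intros cw)
      show "\<forall>s\<in>S. pivot r (w s) X m \<noteq> 0"
        using pivot_nonzero[OF C sub X less.prems] by blast
    qed
    then show ?case by (rule continuous_on_eq) (simp add: eq)
  qed
  then show ?thesis using p by (auto simp: conf_index_def)
qed

section \<open>The algebraic equation of a coordinate\<close>

definition is_poly_fun :: "'v set \<Rightarrow> (('v \<Rightarrow> complex) \<Rightarrow> complex) \<Rightarrow> bool" where
  "is_poly_fun V f \<longleftrightarrow> (\<exists>K. poly_span V K f)"

lemma poly_fun_add:
  assumes "finite V" "is_poly_fun V f" "is_poly_fun V g" shows "is_poly_fun V (\<lambda>x. f x + g x)"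
proof -
  obtain K L where "poly_span V K f" "poly_span V L g" using assms by (auto simp: is_poly_fun_def)
  then have "poly_span V (max K L) f" "poly_span V (max K L) g"
    using assms(1) by (auto intro: poly_span_mono)
  then show ?thesis unfolding is_poly_fun_def by (intro exI[of _ "max K L"] poly_span_add)
qed

lemma poly_fun_mult:
  "finite V \<Longrightarrow> is_poly_fun V f \<Longrightarrow> is_poly_fun V g \<Longrightarrow> is_poly_fun V (\<lambda>x. f x * g x)"
  unfolding is_poly_fun_def by (elim exE, rule exI, rule poly_span_mult)

lemma poly_fun_const: "finite V \<Longrightarrow> is_poly_fun V (\<lambda>x. a)"
  unfolding is_poly_fun_def by (rule exI, rule poly_span_const)

lemma poly_fun_var: "finite V \<Longrightarrow> v \<in> V \<Longrightarrow> is_poly_fun V (\<lambda>x. x v)"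
  unfolding is_poly_fun_def by (rule exI, rule poly_span_var)

lemma poly_fun_sum:
  assumes V: "finite V" and "\<And>i. i \<in> A \<Longrightarrow> is_poly_fun V (f i)"
  shows "is_poly_fun V (\<lambda>x. \<Sum>i\<in>A. f i x)"
  using assms(2)
  by (induction A rule: infinite_finite_induct) (simp_all add: poly_fun_const poly_fun_add V)

lemma poly_fun_power: "finite V \<Longrightarrow> is_poly_fun V f \<Longrightarrow> is_poly_fun V (\<lambda>x. f x ^ n)"
  by (induction n) (simp_all add: poly_fun_const poly_fun_mult)

lemma poly_fun_hsym:
  assumes V: "finite V" and "\<And>i. i \<in> set xs \<Longrightarrow> v i \<in> V"
  shows "is_poly_fun V (\<lambda>x. hsym (map (\<lambda>i. x (v i)) xs) k)"
  using assms(2)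
proof (induction xs arbitrary: k)
  case (Cons a xs)
  show ?case
  proof (cases "xs = []")
    case True
    then show ?thesis using poly_fun_power[OF V poly_fun_var[OF V]] Cons.prems by simp
  next
    case False
    have "is_poly_fun V (\<lambda>x. \<Sum>j<k. x (v a) ^ (k - 1 - j) * hsym (map (\<lambda>i. x (v i)) xs) j)"
      by (intro poly_fun_sum poly_fun_mult poly_fun_power poly_fun_var V Cons.IH Cons.prems) simp_all
    then show ?thesis using False by simp
  qed
qed (simp add: poly_fun_const V)

lemma polynomial_fun_sum:
  "(\<And>i. i \<in> A \<Longrightarrow> polynomial_fun I (f i)) \<Longrightarrow> polynomial_fun I (\<lambda>x. \<Sum>i\<in>A. f i x)"
  by (induction A rule: infinite_finite_induct) (auto intro: polynomial_fun.intros)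

lemma polynomial_fun_prod:
  "(\<And>i. i \<in> A \<Longrightarrow> polynomial_fun I (f i)) \<Longrightarrow> polynomial_fun I (\<lambda>x. \<Prod>i\<in>A. f i x)"
  by (induction A rule: infinite_finite_induct) (auto intro: polynomial_fun.intros)

lemma polynomial_fun_power: "polynomial_fun I f \<Longrightarrow> polynomial_fun I (\<lambda>x. f x ^ n)"
  by (induction n) (auto intro: polynomial_fun.intros)

lemma dd_sum_monom:
  assumes "partition_on {1..r} \<C>"
  shows "dd_sum \<C> w b (monom 1 k) = (\<Sum>p\<in>conf_index \<C>. b p * hsym (block w (fst p) (snd p)) k)"
  unfolding dd_sum_def case_prod_beta
proof (intro sum.cong refl)
  fix p assume "p \<in> conf_index \<C>"
  then have ne: "block w (fst p) (snd p) \<noteq> []"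
    by (intro block_nonempty partition_finite[OF assms]) (auto simp: conf_index_def)
  show "b (fst p, snd p) * divided_difference (block w (fst p) (snd p)) (poly (monom 1 k)) =
      b p * hsym (block w (fst p) (snd p)) k"
    by (simp only: poly_monom_fun[symmetric] divided_difference_power[OF ne] prod.collapse)
qed

text \<open>The moments \<open>\<mu> k\<close> and the coordinate with index \<open>p0\<close> are polynomials in \<open>r\<close> nodes and \<open>r\<close> coordinates.
They are \<open>2 * r + 1\<close> in number, so there is a relation between them. Its leading coefficient as a polynomial in the
coordinate is a nonzero polynomial in the moments, which is expressed by nonvanishing on products of infinite sets.\<close>

lemma coordinate_algebraic_relation:
  assumes C: "partition_on {1..r} \<C>" and p0: "p0 \<in> conf_index \<C>"
  shows "\<exists>n q. (\<forall>k. polynomial_fun {..<2 * r} (q k)) \<and>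
    (\<forall>A. (\<forall>i<2 * r. infinite (A i)) \<longrightarrow> (\<exists>\<mu>\<in>PiE {..<2 * r} A. q n \<mu> \<noteq> 0)) \<and>
    (\<forall>\<mu> w b. (\<forall>k<2 * r. dd_sum \<C> w b (monom 1 k) = \<mu> k) \<longrightarrow> (\<Sum>k\<le>n. q k \<mu> * b p0 ^ k) = 0)"
proof -
  \<comment> \<open>Variables: the nodes are tagged by \<open>Inl\<close>, the coordinates by \<open>Inr\<close>. In the list \<open>f\<close> of
    polynomials, position \<open>2 * r\<close> is taken by the coordinate itself.\<close>
  define V where "V = Inl ` {1..r} \<union> Inr ` conf_index \<C>"
  define I where "I = {..<2 * r}"
  have fin: "finite V" "finite I" "2 * r \<notin> I"
    using partition_finite(4)[OF C] by (auto simp: V_def I_def)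
  have cardV: "card V = 2 * r"
    unfolding V_def using partition_finite(4)[OF C]
    by (subst card_Un_disjoint) (auto simp: card_image card_conf_index[OF C])
  define F where "F k x = (\<Sum>p\<in>conf_index \<C>. x (Inr p) *
      hsym (map (\<lambda>i. x (Inl i)) (take (snd p) (sorted_list_of_set (fst p)))) k)"
    for k and x :: "nat + nat set \<times> nat \<Rightarrow> complex"
  define f where "f i = (if i < 2 * r then F i else (\<lambda>x. x (Inr p0)))" for i
  have "is_poly_fun V (f i)" for i
  proof (cases "i < 2 * r")
    case True
    have "is_poly_fun V (F i)" unfolding F_def
    proof (intro poly_fun_sum poly_fun_mult poly_fun_var poly_fun_hsym fin(1))
      fix p j assume p: "p \<in> conf_index \<C>"
      show "Inr p \<in> V" using p by (simp add: V_def)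
      assume "j \<in> set (take (snd p) (sorted_list_of_set (fst p)))"
      then have "j \<in> set (sorted_list_of_set (fst p))" by (rule in_set_takeD)
      moreover have "fst p \<in> \<C>" using p by (auto simp: conf_index_def)
      ultimately show "Inl j \<in> V"
        using partition_finite(2,3)[OF C] by (auto simp: V_def)
    qed
    with True show ?thesis by (simp add: f_def)
  next
    case False
    then show ?thesis using poly_fun_var[OF fin(1), of "Inr p0"] p0 by (simp add: f_def V_def)
  qed
  then obtain Kf where Kf: "\<And>i. poly_span V (Kf i) (f i)" unfolding is_poly_fun_def by metis
  define K where "K = Max (Kf ` insert (2 * r) I)"
  have pK: "poly_span V K (f i)" if "i \<in> insert (2 * r) I" for i
    by (rule poly_span_mono[OF fin(1) Kf]) (use that fin in \<open>auto simp: K_def intro!: Max_ge\<close>)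
  have "finite (insert (2 * r) I)" "card V < card (insert (2 * r) I)"
    using fin cardV by (simp_all add: I_def)
  from algebraic_dependence[of V "insert (2 * r) I" K f, OF fin(1) this]
  have "\<exists>n c. (\<exists>e\<in>insert (2 * r) I \<rightarrow>\<^sub>E {..n}. c e \<noteq> 0) \<and>
    (\<forall>x. (\<Sum>e\<in>insert (2 * r) I \<rightarrow>\<^sub>E {..n}. c e * (\<Prod>i\<in>insert (2 * r) I. f i x ^ e i)) = 0)"
    using pK by blast
  then obtain N c where c: "\<exists>e\<in>insert (2 * r) I \<rightarrow>\<^sub>E {..N}. c e \<noteq> 0"
    and rel: "\<forall>x. (\<Sum>e\<in>insert (2 * r) I \<rightarrow>\<^sub>E {..N}. c e * (\<Prod>i\<in>insert (2 * r) I. f i x ^ e i)) = 0"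
    by (elim exE conjE)
  define q where "q k \<mu> = (\<Sum>e\<in>I \<rightarrow>\<^sub>E {..N}. c (e(2 * r := k)) * (\<Prod>i\<in>I. \<mu> i ^ e i))"
    for k and \<mu> :: cvec
  \<comment> \<open>The powers of the coordinate that occur in the relation; \<open>n\<close> is the highest one.\<close>
  define G where "G = {k. k \<le> N \<and> (\<exists>e\<in>I \<rightarrow>\<^sub>E {..N}. c (e(2 * r := k)) \<noteq> 0)}"
  have "finite G" by (rule finite_subset[of _ "{..N}"]) (auto simp: G_def)
  have "G \<noteq> {}"
  proof -
    obtain e where e: "e \<in> insert (2 * r) I \<rightarrow>\<^sub>E {..N}" "c e \<noteq> 0" using c by blast
    have "e(2 * r := undefined) \<in> I \<rightarrow>\<^sub>E {..N}" "c ((e(2 * r := undefined))(2 * r := e (2 * r))) \<noteq> 0"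
      "e (2 * r) \<le> N"
      using e fin(3) by (auto simp: PiE_def Pi_def extensional_def)
    then have "e (2 * r) \<in> G" unfolding G_def by blast
    then show ?thesis by blast
  qed
  define n where "n = Max G"
  have n: "n \<in> G" "\<And>k. k \<in> G \<Longrightarrow> k \<le> n"
    using Max_in[OF \<open>finite G\<close> \<open>G \<noteq> {}\<close>] Max_ge[OF \<open>finite G\<close>] by (auto simp: n_def)
  have q0: "q k \<mu> = 0" if "n < k" "k \<le> N" for k \<mu>
  proof -
    have "k \<notin> G" using n(2) that(1) by (auto simp: not_le[symmetric])
    then show ?thesis unfolding q_def using that(2) by (intro sum.neutral) (auto simp: G_def)
  qed
  have "\<exists>\<mu>\<in>PiE {..<2 * r} A. q n \<mu> \<noteq> 0" if A: "\<forall>i<2 * r. infinite (A i)" for A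
    using polynomial_nonvanishing[OF fin(2), of A N "\<lambda>e. c (e(2 * r := n))"] A n(1)
    unfolding q_def G_def I_def by simp
  moreover have "polynomial_fun {..<2 * r} (q k)" for k
    unfolding q_def I_def
    by (intro polynomial_fun_sum polynomial_fun.mult polynomial_fun.const polynomial_fun_prod
        polynomial_fun_power polynomial_fun.coord)
  moreover have "(\<Sum>k\<le>n. q k \<mu> * b p0 ^ k) = 0"
    if mu: "\<forall>k<2 * r. dd_sum \<C> w b (monom 1 k) = \<mu> k" for \<mu> w b
  proof -
    define x where "x = case_sum w b"
    have f1: "f i x = \<mu> i" if "i \<in> I" for i
      using mu that unfolding dd_sum_monom[OF C] block_def
      by (simp add: f_def F_def x_def I_def)
    have f2: "f (2 * r) x = b p0" by (simp add: f_def x_def)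
    have trm: "(\<Prod>i\<in>insert (2 * r) I. f i x ^ (e(2 * r := k)) i) = b p0 ^ k * (\<Prod>i\<in>I. \<mu> i ^ e i)" for e k
    proof -
      have "(\<Prod>i\<in>I. f i x ^ (e(2 * r := k)) i) = (\<Prod>i\<in>I. \<mu> i ^ e i)"
        by (intro prod.cong refl) (use fin(3) f1 in auto)
      then show ?thesis using fin by (simp add: f2)
    qed
    have "0 = (\<Sum>e\<in>insert (2 * r) I \<rightarrow>\<^sub>E {..N}. c e * (\<Prod>i\<in>insert (2 * r) I. f i x ^ e i))"
      using rel by simp
    also have "\<dots> = (\<Sum>k\<le>N. q k \<mu> * b p0 ^ k)"
      unfolding sum_PiE_insert[OF fin(2,3) finite_atMost] trm q_def sum_distrib_right
      by (simp only: mult_ac)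
    also have "\<dots> = (\<Sum>k\<le>n. q k \<mu> * b p0 ^ k)"
      by (rule sum.mono_neutral_right) (use n(1) q0 in \<open>auto simp: G_def\<close>)
    finally show ?thesis by simp
  qed
  ultimately show ?thesis by blast
qed

section \<open>The topology of coordinate spaces\<close>

lemma mem_polydisc: "q \<in> polydisc I p e \<longleftrightarrow> q \<in> cspace I \<and> (\<forall>i\<in>I. dist (p i) (q i) < e)"
  by (auto simp: polydisc_def cspace_def)

lemma centre_in_polydisc: "p \<in> cspace I \<Longrightarrow> 0 < e \<Longrightarrow> p \<in> polydisc I p e"
  by (simp add: mem_polydisc)

lemma polydisc_subset_cspace: "polydisc I p e \<subseteq> cspace I"
  by (auto simp: mem_polydisc)

lemma polydisc_mono: "d \<le> e \<Longrightarrow> polydisc I p d \<subseteq> polydisc I p e"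
  by (force simp: mem_polydisc)

lemma polydisc_nested:
  assumes "q \<in> polydisc I p e" "finite I"
  shows "\<exists>d>0. polydisc I q d \<subseteq> polydisc I p e"
proof (cases "I = {}")
  case True
  then show ?thesis by (intro exI[of _ 1]) (auto simp: mem_polydisc)
next
  case False
  define d where "d = Min ((\<lambda>i. e - dist (p i) (q i)) ` I)"
  have "d > 0" using assms False by (auto simp: d_def mem_polydisc)
  have d: "d \<le> e - dist (p i) (q i)" if "i \<in> I" for i
    using assms(2) that by (auto simp: d_def)
  show ?thesis
  proof (intro exI[of _ d] conjI subsetI)
    fix x assume x: "x \<in> polydisc I q d"
    have "dist (p i) (x i) < e" if "i \<in> I" for i
      using d[OF that] x that dist_triangle[of "p i" "x i" "q i"] by (force simp: mem_polydisc)
    then show "x \<in> polydisc I p e" using x by (simp add: mem_polydisc)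
  qed fact
qed

lemma openin_polydisc:
  assumes "finite I"
  shows "openin (top_of_set (cspace I)) (polydisc I p e)"
proof -
  define X where "X i = (if i \<in> I then ball (p i) e else UNIV)" for i
  have X: "i \<in> I \<Longrightarrow> X i = ball (p i) e" "i \<notin> I \<Longrightarrow> X i = UNIV" for i
    by (simp_all add: X_def)
  have "open (Pi\<^sub>E UNIV X)"
  proof (rule open_PiE)
    show "open (X i)" for i by (cases "i \<in> I") (simp_all add: X)
    show "finite {i. X i \<noteq> UNIV}"
      by (rule finite_subset[OF _ assms]) (use X(2) in blast)
  qed
  moreover have "polydisc I p e = cspace I \<inter> Pi\<^sub>E UNIV X"
  proof (intro equalityI subsetI)
    fix q assume q: "q \<in> cspace I \<inter> Pi\<^sub>E UNIV X"
    have "dist (p i) (q i) < e" if "i \<in> I" for i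
    proof -
      have "q i \<in> X i" using q by (simp add: PiE_iff)
      then show ?thesis by (simp only: X(1)[OF that] mem_ball)
    qed
    then show "q \<in> polydisc I p e" using q by (simp add: mem_polydisc)
  next
    fix q assume q: "q \<in> polydisc I p e"
    have "q i \<in> X i" for i
      using q by (cases "i \<in> I") (simp_all add: X mem_polydisc)
    then show "q \<in> cspace I \<inter> Pi\<^sub>E UNIV X" using q by (simp add: mem_polydisc PiE_iff)
  qed
  ultimately show ?thesis by (simp only: openin_open_Int)
qed

text \<open>Polydiscs with a common radius are a neighbourhood basis, since only finitely many coordinates matter.\<close>

lemma openin_contains_polydisc:
  assumes "finite I" "openin (top_of_set (cspace I)) N" "p \<in> N"
  shows "\<exists>e>0. polydisc I p e \<subseteq> N"
proof -
  obtain T where T: "open T" "N = cspace I \<inter> T" using assms(2) by (auto simp: openin_open)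
  have "openin (product_topology (\<lambda>i. euclidean) UNIV) T" "p \<in> T"
    using T assms(3) by (auto simp: open_fun_def)
  from product_topology_open_contains_basis[OF this] obtain X where
    X: "p \<in> (\<Pi>\<^sub>E i\<in>UNIV. X i)" "\<forall>i. openin euclidean (X i)" "(\<Pi>\<^sub>E i\<in>UNIV. X i) \<subseteq> T"
    by blast
  have "\<forall>i. \<exists>e>0. ball (p i) e \<subseteq> X i"
    using X(1,2) by (auto simp: PiE_iff open_contains_ball)
  then obtain f where f: "\<And>i. f i > 0" "\<And>i. ball (p i) (f i) \<subseteq> X i" by metis
  define e where "e = Min (insert 1 (f ` I))"
  have e: "e > 0" "\<And>i. i \<in> I \<Longrightarrow> e \<le> f i" using f(1) assms(1) by (auto simp: e_def)
  show ?thesis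
  proof (intro exI[of _ e] conjI subsetI)
    fix q assume q: "q \<in> polydisc I p e"
    have "q i \<in> X i" for i
    proof (cases "i \<in> I")
      case True
      then have "q i \<in> ball (p i) (f i)" using q e(2)[OF True] by (force simp: mem_polydisc)
      then show ?thesis using f(2) by blast
    next
      case False
      then have "q i = p i" using q assms(3) T(2) by (auto simp: mem_polydisc cspace_def PiE_iff extensional_def)
      then show ?thesis using X(1) by (simp add: PiE_iff)
    qed
    then have "q \<in> T" using X(3) by (auto simp: PiE_iff)
    then show "q \<in> N" using q T(2) by (simp add: mem_polydisc)
  qed (fact e(1))
qed

lemma continuous_on_polydisc_nbhd:
  fixes f :: "cvec \<Rightarrow> 'b::metric_space"
  assumes I: "finite I" and N: "openin (top_of_set (cspace I)) N" and f: "continuous_on N f"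
    and p: "p \<in> N" and e: "0 < e"
  shows "\<exists>d>0. polydisc I p d \<subseteq> N \<and> (\<forall>q\<in>polydisc I p d. dist (f q) (f p) < e)"
proof -
  have "openin (top_of_set N) (N \<inter> f -` ball (f p) e)"
    using f by (rule continuous_openin_preimage_gen) simp
  then have "openin (top_of_set (cspace I)) (N \<inter> f -` ball (f p) e)"
    using N by (rule openin_trans)
  moreover have "p \<in> N \<inter> f -` ball (f p) e" using p e by simp
  ultimately obtain d where "d > 0" "polydisc I p d \<subseteq> N \<inter> f -` ball (f p) e"
    using openin_contains_polydisc[OF I] by blast
  then show ?thesis by (intro exI[of _ d]) (auto simp: dist_commute)
qed

lemma continuous_on_polydiscI:
  fixes f :: "cvec \<Rightarrow> 'b::metric_space"
  assumes I: "finite I" and N: "N \<subseteq> cspace I"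
    and *: "\<And>p e. p \<in> N \<Longrightarrow> 0 < e \<Longrightarrow> \<exists>d>0. \<forall>q\<in>polydisc I p d. q \<in> N \<longrightarrow> dist (f q) (f p) < e"
  shows "continuous_on N f"
  unfolding continuous_on_topological
proof (intro ballI allI impI)
  fix p B assume p: "p \<in> N" and B: "open B" "f p \<in> B"
  obtain e where e: "e > 0" "ball (f p) e \<subseteq> B" using B open_contains_ball by blast
  obtain d where d: "d > 0" "\<forall>q\<in>polydisc I p d. q \<in> N \<longrightarrow> dist (f q) (f p) < e" using *[OF p e(1)] by blast
  obtain A where A: "open A" "polydisc I p d = cspace I \<inter> A"
    using openin_polydisc[OF I, of p d] by (auto simp: openin_open)
  have "p \<in> A" using A(2) centre_in_polydisc[of p I d] p N d(1) by blast
  moreover have "\<forall>y\<in>N. y \<in> A \<longrightarrow> f y \<in> B"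
  proof (intro ballI impI)
    fix y assume "y \<in> N" "y \<in> A"
    then have "dist (f y) (f p) < e" using d(2) A(2) N by blast
    then show "f y \<in> B" using e(2) by (auto simp: dist_commute)
  qed
  ultimately show "\<exists>A. open A \<and> p \<in> A \<and> (\<forall>y\<in>N. y \<in> A \<longrightarrow> f y \<in> B)" using A(1) by blast
qed

lemma eventually_path_in_openin:
  fixes \<gamma> :: "real \<Rightarrow> cvec"
  assumes "continuous_on T \<gamma>" "\<gamma> ` T \<subseteq> cspace I" "openin (top_of_set (cspace I)) N" "t \<in> T" "\<gamma> t \<in> N"
  shows "\<forall>\<^sub>F s in at t within T. \<gamma> s \<in> N"
proof -
  obtain A where A: "open A" "N = cspace I \<inter> A" using assms(3) by (auto simp: openin_open)
  have "(\<gamma> \<longlongrightarrow> \<gamma> t) (at t within T)" using assms(1,4) by (simp add: continuous_on_def)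
  then have "\<forall>\<^sub>F s in at t within T. \<gamma> s \<in> A"
    using A assms(5) by (intro topological_tendstoD) auto
  moreover have "\<forall>\<^sub>F s in at t within T. s \<in> T" by (simp add: eventually_at_filter)
  ultimately show ?thesis by eventually_elim (use A(2) assms(2) in blast)
qed

lemma eventually_openin_within:
  assumes "openin (top_of_set S) N" "p \<in> N"
  shows "\<forall>\<^sub>F q in at p within S. q \<in> N"
proof -
  obtain A where A: "open A" "N = S \<inter> A" using assms(1) by (auto simp: openin_open)
  have "\<forall>\<^sub>F q in at p within S. q \<in> A" "\<forall>\<^sub>F q in at p within S. q \<in> S"
    using A assms(2) by (auto simp: eventually_at_topological)
  then show ?thesis by eventually_elim (use A(2) in blast)
qed

section \<open>The denominator polynomial\<close>

lemma det_mat_expansion: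
  fixes a :: "nat \<Rightarrow> nat \<Rightarrow> complex"
  shows "Determinant.det (Matrix.mat n n (\<lambda>(i, j). a i j)) =
    (\<Sum>p | p permutes {0..<n}. signof p * (\<Prod>i = 0..<n. a i (p i)))"
proof -
  have "Determinant.det (Matrix.mat n n (\<lambda>(i, j). a i j)) =
    (\<Sum>p | p permutes {0..<n}. signof p * (\<Prod>i = 0..<n. Matrix.mat n n (\<lambda>(i, j). a i j) $$ (i, p i)))"
    by (rule det_def') simp
  also have "\<dots> = (\<Sum>p | p permutes {0..<n}. signof p * (\<Prod>i = 0..<n. a i (p i)))"
  proof (intro sum.cong refl arg_cong2[of _ _ _ _ "(*)"] prod.cong)
    fix p i assume "p \<in> {p. p permutes {0..<n}}" "i \<in> {0..<n}"
    then have "p i < n" "i < n" using permutes_in_image[of p "{0..<n}" i] by simp_all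
    then show "Matrix.mat n n (\<lambda>(i, j). a i j) $$ (i, p i) = a i (p i)" by simp
  qed
  finally show ?thesis .
qed

lemma polynomial_fun_det:
  assumes "\<And>i j. i < n \<Longrightarrow> j < n \<Longrightarrow> polynomial_fun I (f i j)"
  shows "polynomial_fun I (\<lambda>\<mu>. Determinant.det (Matrix.mat n n (\<lambda>(i, j). f i j \<mu>)))"
  unfolding det_mat_expansion
proof (intro polynomial_fun_sum polynomial_fun.mult polynomial_fun.const polynomial_fun_prod assms)
  fix p i assume "p \<in> {p. p permutes {0..<n}}" "i \<in> {0..<n}"
  then show "i < n" "p i < n" using permutes_in_image[of p "{0..<n}" i] by simp_all
qed

lemma polynomial_fun_continuous:
  fixes f :: "'s::topological_space \<Rightarrow> cvec"
  assumes "polynomial_fun I p" "\<And>i. i \<in> I \<Longrightarrow> continuous_on S (\<lambda>s. f s i)"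
  shows "continuous_on S (\<lambda>s. p (f s))"
  using assms(1)
proof induction
  case (coord i)
  then show ?case by (rule assms(2))
qed (intro continuous_intros; assumption)+

lemma polynomial_fun_differentiable:
  assumes "polynomial_fun I p" "\<And>i. i \<in> I \<Longrightarrow> (\<lambda>z. f z i) field_differentiable at z0"
  shows "(\<lambda>z. p (f z)) field_differentiable at z0"
  using assms(1)
proof induction
  case (coord i)
  then show ?case by (rule assms(2))
next
  case (add p q)
  then show ?case by (intro field_differentiable_add)
next
  case (mult p q)
  then show ?case by (intro field_differentiable_mult)
qed simp

definition hdet :: "nat \<Rightarrow> cvec \<Rightarrow> complex" where
  "hdet r \<mu> = Determinant.det (hankel r r \<mu>)"

text \<open>The numerator of Cramer's rule for the \<open>k\<close>-th coefficient of the recurrence.\<close>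

definition qnum :: "nat \<Rightarrow> nat \<Rightarrow> cvec \<Rightarrow> complex" where
  "qnum r k \<mu> = Determinant.det (Matrix.mat r r (\<lambda>(i, j). if j = k then - \<mu> (r + i) else \<mu> (i + j)))"

definition qcoeff :: "nat \<Rightarrow> nat \<Rightarrow> cvec \<Rightarrow> complex" where
  "qcoeff r k \<mu> = qnum r k \<mu> / hdet r \<mu>"

definition den :: "nat \<Rightarrow> cvec \<Rightarrow> complex poly" where
  "den r \<mu> = (\<Sum>k<Suc r. Polynomial.smult (if k < r then qcoeff r k \<mu> else 1) (monom 1 k))"

lemma coeff_den: "coeff (den r \<mu>) k = (if k < r then qcoeff r k \<mu> else if k = r then 1 else 0)"
  unfolding den_def coeff_sum_monom by simp

lemma polynomial_fun_hdet: "polynomial_fun {..<2 * r} (hdet r)"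
  unfolding hdet_def hankel_def by (intro polynomial_fun_det polynomial_fun.coord) simp

lemma polynomial_fun_qnum: "polynomial_fun {..<2 * r} (qnum r k)"
  unfolding qnum_def
proof (intro polynomial_fun_det)
  fix i j assume ij: "i < r" "j < r"
  have "polynomial_fun {..<2 * r} (\<lambda>\<mu>. (-1) * \<mu> (r + i))" "polynomial_fun {..<2 * r} (\<lambda>\<mu>. \<mu> (i + j))"
    using ij by (intro polynomial_fun.mult polynomial_fun.const polynomial_fun.coord; simp)+
  then show "polynomial_fun {..<2 * r} (\<lambda>\<mu>. if j = k then - \<mu> (r + i) else \<mu> (i + j))"
    by (cases "j = k") simp_all
qed

lemma hankel_system_coeff:
  assumes "hdet r \<mu> \<noteq> 0" and "\<forall>i<r. (\<Sum>k<r. \<mu> (k + i) * c k) = - \<mu> (r + i)" and "k < r"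
  shows "c k = qcoeff r k \<mu>"
proof -
  define A where "A = hankel r r \<mu>"
  have A: "A \<in> carrier_mat r r" by (simp add: A_def hankel_def)
  define x where "x = Matrix.vec r c"
  have Ax: "A *\<^sub>v x = Matrix.vec r (\<lambda>i. - \<mu> (r + i))"
  proof (rule eq_vecI)
    fix i assume "i < dim_vec (Matrix.vec r (\<lambda>i. - \<mu> (r + i)))"
    then have i: "i < r" by simp
    have "(A *\<^sub>v x) $ i = (\<Sum>k<r. \<mu> (k + i) * c k)"
      using i by (simp add: A_def hankel_def x_def scalar_prod_def lessThan_atLeast0 add.commute)
    then show "(A *\<^sub>v x) $ i = Matrix.vec r (\<lambda>i. - \<mu> (r + i)) $ i" using i assms(2) by simp
  qed (simp add: A_def hankel_def)
  have "replace_col A (A *\<^sub>v x) k = Matrix.mat r r (\<lambda>(i, j). if j = k then - \<mu> (r + i) else \<mu> (i + j))"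
    unfolding Ax replace_col_def by (intro eq_matI) (auto simp: A_def hankel_def)
  with cramer_lemma_mat[OF A, of x k] assms(3)
  have "qnum r k \<mu> = c k * hdet r \<mu>"
    by (simp add: qnum_def hdet_def A_def x_def)
  then show ?thesis using assms(1) by (simp add: qcoeff_def)
qed

lemma hankel_system_solvable:
  assumes "hdet r \<mu> \<noteq> 0"
  shows "\<exists>c. \<forall>i<r. (\<Sum>k<r. \<mu> (k + i) * c k) = m i"
proof -
  have "\<exists>c. \<forall>i\<in>{..<r}. (\<Sum>k\<in>{..<r}. \<mu> (k + i) * c k) = m i"
  proof (rule square_system_solvable)
    fix c assume 0: "\<forall>i\<in>{..<r}. (\<Sum>k\<in>{..<r}. \<mu> (k + i) * c k) = 0"
    define A where "A = hankel r r \<mu>"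
    have A: "A \<in> carrier_mat r r" by (simp add: A_def hankel_def)
    have Ax: "A *\<^sub>v Matrix.vec r c = 0\<^sub>v r"
    proof (rule eq_vecI)
      fix i assume "i < dim_vec (0\<^sub>v r :: complex Matrix.vec)"
      then have i: "i < r" by simp
      have "(A *\<^sub>v Matrix.vec r c) $ i = (\<Sum>k<r. \<mu> (k + i) * c k)"
        using i by (simp add: A_def hankel_def scalar_prod_def lessThan_atLeast0 add.commute)
      then show "(A *\<^sub>v Matrix.vec r c) $ i = 0\<^sub>v r $ i" using i 0 by simp
    qed (simp add: A_def hankel_def)
    have "Matrix.vec r c = 0\<^sub>v r"
    proof (rule ccontr)
      assume "Matrix.vec r c \<noteq> 0\<^sub>v r"
      with Ax have "Determinant.det A = 0"
        unfolding det_0_iff_vec_prod_zero[OF A] by (intro exI[of _ "Matrix.vec r c"]) simp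
      with assms show False by (simp add: hdet_def A_def)
    qed
    show "\<forall>k\<in>{..<r}. c k = 0"
    proof
      fix k assume "k \<in> {..<r}"
      then show "c k = 0" using arg_cong[OF \<open>Matrix.vec r c = 0\<^sub>v r\<close>, of "\<lambda>v. Matrix.vec_index v k"] by simp
    qed
  qed simp_all
  then show ?thesis by (simp only: Ball_def lessThan_iff)
qed

lemma recurrence_split:
  assumes "coeff p r = 1"
  shows "(\<Sum>k\<le>r. coeff p k * \<mu> (k + i)) = 0 \<longleftrightarrow> (\<Sum>k<r. \<mu> (k + i) * coeff p k) = - (\<mu> (r + i) :: complex)"
  using assms by (simp add: lessThan_Suc_atMost[symmetric] mult.commute eq_neg_iff_add_eq_0)

text \<open>If the Hankel determinant is nonzero, the recurrence has only one monic solution. Thus all node vectors of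
\<open>\<mu>\<close> enumerate the roots of the same polynomial, whose coefficients are rational functions of \<open>\<mu>\<close>.\<close>

lemma nodes_imp_npoly_den:
  assumes "nodes r \<mu> w" "hdet r \<mu> \<noteq> 0"
  shows "npoly r w = den r \<mu>"
proof (rule poly_eqI)
  fix k
  have "\<forall>i<r. (\<Sum>k<r. \<mu> (k + i) * coeff (npoly r w) k) = - \<mu> (r + i)"
    using assms(1) recurrence_split[of "npoly r w" r \<mu>] by (simp add: nodes_def)
  from hankel_system_coeff[OF assms(2) this, of k]
  have "k < r \<Longrightarrow> coeff (npoly r w) k = qcoeff r k \<mu>" .
  moreover have "coeff (npoly r w) k = 0" if "r < k" using that by (simp add: coeff_eq_0)
  ultimately show "coeff (npoly r w) k = coeff (den r \<mu>) k"
    unfolding coeff_den by (cases k r rule: linorder_cases) simp_all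
qed

lemma nodesI_den:
  assumes "w \<in> cspace {1..r}" "npoly r w = den r \<mu>" "hdet r \<mu> \<noteq> 0"
  shows "nodes r \<mu> w"
proof -
  obtain c where c: "\<forall>i<r. (\<Sum>k<r. \<mu> (k + i) * c k) = - \<mu> (r + i)"
    using hankel_system_solvable[OF assms(3), of "\<lambda>i. - \<mu> (r + i)"] by (rule exE)
  have "coeff (npoly r w) k = c k" if "k < r" for k
    using hankel_system_coeff[OF assms(3) c that] that by (simp add: assms(2) coeff_den)
  then have "\<forall>i<r. (\<Sum>k<r. \<mu> (k + i) * coeff (npoly r w) k) = - \<mu> (r + i)"
    using c by simp
  then show ?thesis
    unfolding nodes_def using assms(1) recurrence_split[of "npoly r w" r \<mu>] by simp
qed

lemma degree_den: "degree (den r \<mu>) = r"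
proof (rule antisym)
  show "degree (den r \<mu>) \<le> r" by (rule degree_le) (simp add: coeff_den)
  show "r \<le> degree (den r \<mu>)" by (rule le_degree) (simp add: coeff_den)
qed

lemma nodes_exist:
  assumes "hdet r \<mu> \<noteq> 0"
  shows "\<exists>w. nodes r \<mu> w"
proof -
  have lc: "lead_coeff (den r \<mu>) = 1" by (simp add: degree_den coeff_den)
  obtain root where root: "Polynomial.smult (lead_coeff (den r \<mu>)) (\<Prod>i<degree (den r \<mu>). [:- root i, 1:]) = den r \<mu>"
    by (rule complex_poly_decompose')
  define w where "w = restrict (\<lambda>i. root (i - 1)) {1..r}"
  have "npoly r w = (\<Prod>i\<in>{1..r}. [:- root (i - 1), 1:])"
    unfolding npoly_def by (intro prod.cong refl) (simp add: w_def)
  also have "\<dots> = (\<Prod>i<r. [:- root i, 1:])"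
    by (rule prod.reindex_bij_witness[of _ Suc "\<lambda>i. i - 1"]) auto
  also have "\<dots> = den r \<mu>" using root[unfolded lc smult_1_left] unfolding degree_den .
  finally have "npoly r w = den r \<mu>" .
  moreover have "w \<in> cspace {1..r}" by (simp add: w_def cspace_def)
  ultimately show ?thesis using nodesI_den[OF _ _ assms] by blast
qed

section \<open>The discriminant and the roots of the denominator\<close>

lemma poly_den: "poly (den r \<mu>) z = (\<Sum>k<r. qcoeff r k \<mu> * z ^ k) + z ^ r"
  unfolding den_def poly_sum poly_smult poly_monom by simp

lemma den_nonzero: "den r \<mu> \<noteq> 0"
  using coeff_den[of r \<mu> r] by auto

lemma poly_den_nodes:
  assumes "nodes r \<mu> w" "hdet r \<mu> \<noteq> 0"
  shows "poly (den r \<mu>) z = (\<Prod>j\<in>{1..r}. z - w j)"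
  unfolding nodes_imp_npoly_den[OF assms, symmetric] by (rule poly_npoly)

lemma root_den_iff:
  assumes "nodes r \<mu> w" "hdet r \<mu> \<noteq> 0"
  shows "poly (den r \<mu>) z = 0 \<longleftrightarrow> z \<in> w ` {1..r}"
  unfolding poly_den_nodes[OF assms] by (simp add: prod_zero_iff image_iff)

text \<open>The product of the distinct linear factors divides \<open>den r \<mu>\<close>, and both are monic of degree \<open>r\<close>.\<close>

lemma distinct_roots_nodes:
  assumes "hdet r \<mu> \<noteq> 0" "v \<in> cspace {1..r}" "inj_on v {1..r}"
    and root: "\<And>i. i \<in> {1..r} \<Longrightarrow> poly (den r \<mu>) (v i) = 0"
  shows "nodes r \<mu> v"
proof -
  have "linprod (nodelist r v) dvd den r \<mu>"
    unfolding linprod_dvd_iff_order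
  proof (intro disjI2 allI)
    fix y
    have card: "count_list (nodelist r v) y = card {i \<in> {1..r}. v i = y}"
      by (simp only: multiplicity_in_eq[symmetric] multiplicity_in_def)
    show "count_list (nodelist r v) y \<le> Polynomial.order y (den r \<mu>)"
    proof (cases "y \<in> v ` {1..r}")
      case True
      then obtain i where i: "i \<in> {1..r}" "y = v i" by blast
      have "{i \<in> {1..r}. v i = y} = {i}"
        using i assms(3) by (auto dest: inj_onD)
      moreover have "Polynomial.order y (den r \<mu>) \<noteq> 0"
        using root[OF i(1)] i(2) den_nonzero order_root by blast
      ultimately show ?thesis unfolding card by simp
    next
      case False
      then have "{i \<in> {1..r}. v i = y} = {}" by blast
      then show ?thesis unfolding card by (simp only: card.empty)
    qed
  qed
  then obtain c where c: "den r \<mu> = npoly r v * c" unfolding npoly_linprod by (rule dvdE)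
  have "c \<noteq> 0"
  proof
    assume "c = 0"
    with c have "den r \<mu> = 0" by simp
    then show False using den_nonzero by contradiction
  qed
  then have "degree (den r \<mu>) = degree (npoly r v) + degree c"
    unfolding c by (intro degree_mult_eq) simp_all
  then have "degree c = 0" by (simp add: degree_den)
  then obtain a where a: "c = [:a:]" by (rule degree_eq_zeroE)
  have "a = 1" using arg_cong[OF c, of "\<lambda>p. coeff p r"] unfolding a by (simp add: coeff_den)
  then have "npoly r v = den r \<mu>" using c unfolding a by simp
  then show ?thesis using nodesI_den assms by blast
qed

text \<open>The discriminant of the denominator, up to sign.\<close>

definition disc :: "nat \<Rightarrow> cvec \<Rightarrow> complex" where
  "disc r \<mu> = resultant (den r \<mu>) (pderiv (den r \<mu>))"

lemma disc_nonzero_iff: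
  assumes nd: "nodes r \<mu> w" and h: "hdet r \<mu> \<noteq> 0"
  shows "disc r \<mu> \<noteq> 0 \<longleftrightarrow> inj_on w {1..r}"
proof -
  define Q where "Q = den r \<mu>"
  have Q: "Q \<noteq> 0" "Q = linprod (nodelist r w)"
    using den_nonzero nodes_imp_npoly_den[OF nd h] by (simp_all add: Q_def npoly_linprod)
  have "disc r \<mu> = 0 \<longleftrightarrow> degree (gcd Q (pderiv Q)) \<noteq> 0"
    unfolding disc_def Q_def by (rule resultant_0_gcd)
  also have "\<dots> \<longleftrightarrow> (\<exists>z. poly Q z = 0 \<and> poly (pderiv Q) z = 0)"
  proof
    assume "degree (gcd Q (pderiv Q)) \<noteq> 0"
    then obtain z where "poly (gcd Q (pderiv Q)) z = 0"
      using fundamental_theorem_of_algebra[of "gcd Q (pderiv Q)"] unfolding constant_degree by blast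
    then have "[:- z, 1:] dvd gcd Q (pderiv Q)" by (simp only: poly_eq_0_iff_dvd)
    then show "\<exists>z. poly Q z = 0 \<and> poly (pderiv Q) z = 0"
      unfolding poly_eq_0_iff_dvd by (intro exI[of _ z]) (simp only: gcd_greatest_iff)
  next
    assume "\<exists>z. poly Q z = 0 \<and> poly (pderiv Q) z = 0"
    then obtain z where "[:- z, 1:] dvd gcd Q (pderiv Q)"
      unfolding poly_eq_0_iff_dvd gcd_greatest_iff by blast
    from dvd_imp_degree_le[OF this] Q(1) show "degree (gcd Q (pderiv Q)) \<noteq> 0" by simp
  qed
  also have "\<dots> \<longleftrightarrow> (\<exists>z. [:- z, 1:] ^ 2 dvd Q)"
    unfolding pderivs_vanish_iff_dvd[symmetric] by (simp add: numeral_2_eq_2 All_less_Suc2)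
  also have "\<dots> \<longleftrightarrow> (\<exists>z. 2 \<le> card {i \<in> {1..r}. w i = z})"
    unfolding Polynomial.order_divides Q(2) order_linprod multiplicity_in_eq[symmetric] multiplicity_in_def
    by (simp only: linprod_nonzero simp_thms)
  also have "\<dots> \<longleftrightarrow> \<not> inj_on w {1..r}"
  proof
    assume "\<exists>z. 2 \<le> card {i \<in> {1..r}. w i = z}"
    then obtain z where z: "2 \<le> card {i \<in> {1..r}. w i = z}" by (rule exE)
    obtain A where A: "A \<subseteq> {i \<in> {1..r}. w i = z}" "card A = 2"
      by (rule obtain_subset_with_card_n[OF z])
    then obtain a b where "A = {a, b}" "a \<noteq> b" unfolding card_2_iff by blast
    with A(1) show "\<not> inj_on w {1..r}" unfolding inj_on_def by blast
  next
    assume "\<not> inj_on w {1..r}"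
    then obtain a b where ab: "a \<in> {1..r}" "b \<in> {1..r}" "a \<noteq> b" "w a = w b" unfolding inj_on_def by blast
    have "card {a, b} \<le> card {i \<in> {1..r}. w i = w a}"
      by (rule card_mono) (use ab in auto)
    moreover have "card {a, b} = 2" using ab(3) by simp
    ultimately show "\<exists>z. 2 \<le> card {i \<in> {1..r}. w i = z}" by (intro exI[of _ "w a"]) (simp only:)
  qed
  finally show ?thesis by simp
qed

lemma holomorphic_on_if_const:
  "f holomorphic_on S \<Longrightarrow> g holomorphic_on S \<Longrightarrow> (\<lambda>z. if P then f z else g z) holomorphic_on S"
  by (cases P) simp_all

lemma holomorphic_on_det:
  assumes "\<And>i j. i < n \<Longrightarrow> j < n \<Longrightarrow> f i j holomorphic_on S"
  shows "(\<lambda>z. Determinant.det (Matrix.mat n n (\<lambda>(i, j). f i j z))) holomorphic_on S"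
  unfolding det_mat_expansion
proof (intro holomorphic_on_sum holomorphic_on_mult holomorphic_on_const holomorphic_on_prod assms)
  fix p i assume "p \<in> {p. p permutes {0..<n}}" "i \<in> {0..<n}"
  then show "i < n" "p i < n" using permutes_in_image[of p "{0..<n}" i] by simp_all
qed

lemma polynomial_fun_holomorphic:
  assumes "polynomial_fun I p" "\<And>i. i \<in> I \<Longrightarrow> (\<lambda>z. f z i) holomorphic_on S"
  shows "(\<lambda>z. p (f z)) holomorphic_on S"
  using assms(1)
proof induction
  case (coord i)
  then show ?case by (rule assms(2))
qed (intro holomorphic_on_const holomorphic_on_add holomorphic_on_mult; assumption)+

text \<open>The resultant is a determinant whose entries are zero or coefficients of the denominator and its derivative. The
size of the matrix does not depend on \<open>\<mu>\<close> because the denominator is monic of degree \<open>r\<close>.\<close>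

lemma disc_holomorphic:
  assumes f: "\<And>i. i < 2 * r \<Longrightarrow> (\<lambda>z. f z i) holomorphic_on S"
    and h: "\<And>z. z \<in> S \<Longrightarrow> hdet r (f z) \<noteq> 0"
  shows "(\<lambda>z. disc r (f z)) holomorphic_on S"
proof -
  have q: "(\<lambda>z. qcoeff r k (f z)) holomorphic_on S" for k
    unfolding qcoeff_def using f h
    by (intro holomorphic_on_divide polynomial_fun_holomorphic[OF polynomial_fun_qnum]
        polynomial_fun_holomorphic[OF polynomial_fun_hdet]) simp_all
  have c: "(\<lambda>z. coeff (den r (f z)) k) holomorphic_on S" for k
    unfolding coeff_den by (cases "k < r"; cases "k = r") (simp_all add: q)
  have c': "(\<lambda>z. coeff (pderiv (den r (f z))) k) holomorphic_on S" for k
    unfolding coeff_pderiv by (intro holomorphic_on_mult holomorphic_on_const c)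
  have "disc r \<mu> = Determinant.det (Matrix.mat (r + (r - 1)) (r + (r - 1)) (\<lambda>(i, j).
      if i < r - 1 then if i \<le> j \<and> j - i \<le> r then coeff (den r \<mu>) (r + i - j) else 0
      else if i - (r - 1) \<le> j \<and> j \<le> i then coeff (pderiv (den r \<mu>)) (i - j) else 0))" for \<mu>
    unfolding disc_def resultant_def sylvester_mat_def sylvester_mat_sub_def degree_pderiv degree_den ..
  moreover have "(\<lambda>z. Determinant.det (Matrix.mat (r + (r - 1)) (r + (r - 1)) (\<lambda>(i, j).
      if i < r - 1 then if i \<le> j \<and> j - i \<le> r then coeff (den r (f z)) (r + i - j) else 0
      else if i - (r - 1) \<le> j \<and> j \<le> i then coeff (pderiv (den r (f z))) (i - j) else 0))) holomorphic_on S"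
  proof (rule holomorphic_on_det)
    fix i j
    show "(\<lambda>z. if i < r - 1 then if i \<le> j \<and> j - i \<le> r then coeff (den r (f z)) (r + i - j) else 0
      else if i - (r - 1) \<le> j \<and> j \<le> i then coeff (pderiv (den r (f z))) (i - j) else 0) holomorphic_on S"
      by (intro holomorphic_on_if_const c c' holomorphic_on_const)
  qed
  ultimately show ?thesis by simp
qed

text \<open>The complex line through \<open>p\<close> and \<open>q\<close>, parametrised such that \<open>0\<close> and \<open>1\<close> are sent to \<open>p\<close> and \<open>q\<close>.\<close>

definition segment_point :: "nat set \<Rightarrow> cvec \<Rightarrow> cvec \<Rightarrow> complex \<Rightarrow> cvec" where
  "segment_point I p q z = (\<lambda>i\<in>I. p i + z * (q i - p i))"

lemma segment_point_simps:
  "p \<in> cspace I \<Longrightarrow> segment_point I p q 0 = p" "q \<in> cspace I \<Longrightarrow> segment_point I p q 1 = q"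
  "segment_point I p q z \<in> cspace I" "i \<in> I \<Longrightarrow> segment_point I p q z i = p i + z * (q i - p i)"
  by (auto simp: segment_point_def cspace_def PiE_iff extensional_def fun_eq_iff)

lemma continuous_segment_point: "continuous_on UNIV (segment_point I p q)"
proof (rule continuous_on_coordinatewise_then_product)
  fix i show "continuous_on UNIV (\<lambda>z. segment_point I p q z i)"
    by (cases "i \<in> I") (auto simp: segment_point_def intro!: continuous_intros)
qed

lemma segment_domain:
  assumes "finite I"
  shows "open {z. segment_point I p q z \<in> polydisc I c e}" "convex {z. segment_point I p q z \<in> polydisc I c e}"
proof -
  have eq: "{z. segment_point I p q z \<in> polydisc I c e} = (\<Inter>i\<in>I. (\<lambda>z. p i + z * (q i - p i)) -` ball (c i) e)"
    unfolding mem_polydisc by (auto simp add: segment_point_simps(3,4))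
  show "open {z. segment_point I p q z \<in> polydisc I c e}"
    unfolding eq using assms by (intro open_INT ballI open_vimage) (auto intro!: continuous_intros)
  have "convex ((\<lambda>z. p i + z * (q i - p i)) -` ball (c i) e)" for i
  proof (rule convexI)
    fix x y :: complex and u v :: real
    assume xy: "x \<in> (\<lambda>z. p i + z * (q i - p i)) -` ball (c i) e" "y \<in> (\<lambda>z. p i + z * (q i - p i)) -` ball (c i) e"
      and uv: "0 \<le> u" "0 \<le> v" "u + v = 1"
    have v: "v = 1 - u" using uv(3) by simp
    then have "p i + (u *\<^sub>R x + v *\<^sub>R y) * (q i - p i) =
        u *\<^sub>R (p i + x * (q i - p i)) + v *\<^sub>R (p i + y * (q i - p i))"
      unfolding v scaleR_conv_of_real by (simp add: algebra_simps)
    moreover have "u *\<^sub>R (p i + x * (q i - p i)) + v *\<^sub>R (p i + y * (q i - p i)) \<in> ball (c i) e"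
      using xy uv by (intro convexD[OF convex_ball]) simp_all
    ultimately show "u *\<^sub>R x + v *\<^sub>R y \<in> (\<lambda>z. p i + z * (q i - p i)) -` ball (c i) e"
      by simp
  qed
  then show "convex {z. segment_point I p q z \<in> polydisc I c e}"
    unfolding eq by (intro convex_INT)
qed

lemma open_imp_fsigma:
  fixes S :: "complex set"
  assumes "open S"
  shows "fsigma S"
proof -
  obtain C :: "nat \<Rightarrow> complex set" where C: "\<And>n. compact (C n)" "\<Union> (range C) = S"
    using open_Union_compact_subsets[OF assms] by metis
  have "fsigma (\<Union> (range C))"
    by (rule fsigma.intros) (rule compact_imp_closed[OF C(1)])
  then show ?thesis unfolding C(2) .
qed

text \<open>On the complex line from \<open>p\<close> to \<open>q\<close> the discriminant is a holomorphic function of one variable that is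
nonzero at \<open>p\<close>. It has countably many zeros, and an open connected subset of the plane stays path
connected without countably many points.\<close>

lemma path_off_discriminant:
  fixes r :: nat
  defines "I \<equiv> {..<2 * r}"
  assumes p: "p \<in> polydisc I c e" and q: "q \<in> polydisc I c e"
    and h: "\<And>\<nu>. \<nu> \<in> polydisc I c e \<Longrightarrow> hdet r \<nu> \<noteq> 0" and dp: "disc r p \<noteq> 0"
  shows "\<exists>\<gamma>. path \<gamma> \<and> path_image \<gamma> \<subseteq> polydisc I c e \<and> pathstart \<gamma> = p \<and> pathfinish \<gamma> = q \<and>
    (\<forall>t\<in>{0..<1}. disc r (\<gamma> t) \<noteq> 0)"
proof -
  have I: "finite I" by (simp add: I_def)
  define L where "L = segment_point I p q"
  define \<Omega> where "\<Omega> = {z. L z \<in> polydisc I c e}"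
  have \<Omega>: "open \<Omega>" "convex \<Omega>" unfolding \<Omega>_def L_def by (rule segment_domain[OF I])+
  have pq: "p \<in> cspace I" "q \<in> cspace I" using p q by (simp_all add: mem_polydisc)
  have L01: "L 0 = p" "L 1 = q" using pq by (simp_all add: L_def segment_point_simps)
  have \<Omega>01: "0 \<in> \<Omega>" "1 \<in> \<Omega>" using p q L01 by (simp_all add: \<Omega>_def)
  have hol: "(\<lambda>z. disc r (L z)) holomorphic_on \<Omega>"
  proof (rule disc_holomorphic)
    show "(\<lambda>z. L z i) holomorphic_on \<Omega>" if "i < 2 * r" for i
      using that by (simp add: L_def segment_point_simps I_def) (intro holomorphic_intros)
    show "hdet r (L z) \<noteq> 0" if "z \<in> \<Omega>" for z using that h by (simp add: \<Omega>_def)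
  qed
  \<comment> \<open>The point \<open>1\<close>, which may be a zero, is kept in the domain. An arc that ends in \<open>1\<close> does not pass through
    it earlier.\<close>
  define Z where "Z = {z \<in> \<Omega>. disc r (L z) = 0}"
  have Z: "countable Z"
  proof (cases "(\<lambda>z. disc r (L z)) constant_on \<Omega>")
    case True
    then obtain k where "\<forall>z\<in>\<Omega>. disc r (L z) = k" by (auto simp: constant_on_def)
    then have "Z = {}" using \<Omega>01(1) dp L01(1) by (auto simp: Z_def)
    then show ?thesis by simp
  next
    case False
    show ?thesis unfolding Z_def
      by (rule holomorphic_countable_zeros[OF hol \<Omega>(1) _ _ False])
         (intro convex_connected open_imp_fsigma \<Omega>)+
  qed
  have "path_connected (\<Omega> - (Z - {1}))"
    using \<Omega> Z by (intro path_connected_open_diff_countable convex_connected) simp_all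
  moreover have "0 \<in> \<Omega> - (Z - {1})" "1 \<in> \<Omega> - (Z - {1})" using \<Omega>01 dp L01 by (auto simp: Z_def)
  ultimately obtain g where g: "arc g" "path_image g \<subseteq> \<Omega> - (Z - {1})" "pathstart g = 0" "pathfinish g = 1"
    unfolding path_connected_arcwise using zero_neq_one by blast
  show ?thesis
  proof (intro exI[of _ "L \<circ> g"] conjI ballI)
    show "path (L \<circ> g)"
      using arc_imp_path[OF g(1)] continuous_segment_point[of I p q]
      by (intro path_continuous_image) (auto simp: L_def intro: continuous_on_subset)
    show "path_image (L \<circ> g) \<subseteq> polydisc I c e"
      unfolding path_image_compose using g(2) by (auto simp only: \<Omega>_def)
    show "pathstart (L \<circ> g) = p" "pathfinish (L \<circ> g) = q"
      using g(3,4) L01 by (simp_all add: pathstart_compose pathfinish_compose)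
    fix t :: real assume t: "t \<in> {0..<1}"
    have "g t \<noteq> g 1"
      using g(1) t unfolding arc_def by (auto dest: inj_onD)
    then have "g t \<noteq> 1" using g(4) by (simp add: pathfinish_def)
    moreover have "g t \<in> path_image g" unfolding path_image_def using t by (intro imageI) simp
    ultimately have "g t \<in> \<Omega> - Z" using g(2) by blast
    then show "disc r ((L \<circ> g) t) \<noteq> 0" by (simp add: Z_def)
  qed
qed

section \<open>Continuity of the roots and local branches\<close>

lemma polydisc_finite_conj:
  assumes "finite K" "\<And>k. k \<in> K \<Longrightarrow> \<exists>d>0. \<forall>q\<in>polydisc I p d. P k q"
  shows "\<exists>d>0. \<forall>q\<in>polydisc I p d. \<forall>k\<in>K. P k q"
  using assms
proof (induction K rule: finite_induct)
  case empty
  show ?case by (intro exI[of _ 1]) simp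
next
  case (insert k K)
  obtain d where d: "d > 0" "\<forall>q\<in>polydisc I p d. P k q" using insert.prems by blast
  obtain d' where d': "d' > 0" "\<forall>q\<in>polydisc I p d'. \<forall>k\<in>K. P k q" using insert.IH insert.prems by blast
  show ?case
    using d d' polydisc_mono[of "min d d'" d I p] polydisc_mono[of "min d d'" d' I p]
    by (intro exI[of _ "min d d'"]) auto
qed

lemma monic_root_bound:
  fixes z :: complex
  assumes "(\<Sum>k<r. a k * z ^ k) + z ^ r = 0"
  shows "norm z \<le> 1 + (\<Sum>k<r. norm (a k))"
proof (cases "norm z \<le> 1")
  case True
  then show ?thesis using sum_nonneg[of "{..<r}" "\<lambda>k. norm (a k)"] by simp
next
  case False
  have r: "r > 0" using assms by (cases r) auto
  have "norm z ^ r = norm (\<Sum>k<r. a k * z ^ k)"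
    using assms by (metis add_eq_0_iff norm_minus_cancel norm_power)
  also have "\<dots> \<le> (\<Sum>k<r. norm (a k) * norm z ^ k)"
    by (rule order.trans[OF norm_sum]) (simp add: norm_mult norm_power)
  also have "\<dots> \<le> (\<Sum>k<r. norm (a k) * norm z ^ (r - 1))"
    using False by (intro sum_mono mult_left_mono power_increasing) auto
  also have "\<dots> = (\<Sum>k<r. norm (a k)) * norm z ^ (r - 1)" by (rule sum_distrib_right[symmetric])
  finally have "norm z * norm z ^ (r - 1) \<le> (\<Sum>k<r. norm (a k)) * norm z ^ (r - 1)"
    using r by (simp add: power_eq_if)
  moreover have "0 < norm z ^ (r - 1)" using False by (intro zero_less_power) linarith
  ultimately have "norm z \<le> (\<Sum>k<r. norm (a k))" by (rule mult_right_le_imp_le)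
  then show ?thesis by simp
qed

lemma small_product_factor:
  fixes f :: "'a \<Rightarrow> complex"
  assumes "finite A" "norm (\<Prod>j\<in>A. f j) < \<rho> ^ card A" "0 < \<rho>"
  shows "\<exists>j\<in>A. norm (f j) < \<rho>"
proof (rule ccontr)
  assume "\<not> ?thesis"
  then have "(\<Prod>j\<in>A. \<rho>) \<le> (\<Prod>j\<in>A. norm (f j))"
    using assms(3) by (intro prod_mono) (auto simp: not_less)
  with assms(2) show False by (simp add: prod_norm)
qed

lemma continuous_on_coord: "continuous_on S (\<lambda>s :: cvec. s i)"
  by (rule continuous_on_product_then_coordinatewise[OF continuous_on_id])

lemma continuous_on_hdet: "continuous_on S (hdet r)"
  by (rule polynomial_fun_continuous[OF polynomial_fun_hdet continuous_on_coord])

lemma continuous_on_qcoeff: "(\<And>\<mu>. \<mu> \<in> S \<Longrightarrow> hdet r \<mu> \<noteq> 0) \<Longrightarrow> continuous_on S (qcoeff r k)"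
  unfolding qcoeff_def
  by (intro continuous_on_divide continuous_on_hdet
      polynomial_fun_continuous[OF polynomial_fun_qnum continuous_on_coord]) blast

lemma openin_hdet_nonzero: "openin (top_of_set (cspace I)) {\<mu> \<in> cspace I. hdet r \<mu> \<noteq> 0}"
proof -
  have "openin (top_of_set (cspace I)) (cspace I \<inter> hdet r -` (- {0}))"
    by (intro continuous_openin_preimage_gen continuous_on_hdet) auto
  moreover have "cspace I \<inter> hdet r -` (- {0}) = {\<mu> \<in> cspace I. hdet r \<mu> \<noteq> 0}" by auto
  ultimately show ?thesis by simp
qed

text \<open>Continuity of the roots as a set. A root \<open>z\<close> of a monic polynomial with nearby coefficients is bounded, so the value
of the original polynomial at \<open>z\<close> is small; as this value is the product of the differences of \<open>z\<close> and the
nodes, one of them is small. The argument is symmetric in the two polynomials.\<close>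

lemma roots_near:
  fixes r :: nat
  defines "I \<equiv> {..<2 * r}"
  assumes r: "1 \<le> r" and \<mu>: "\<mu> \<in> cspace I" and h: "hdet r \<mu> \<noteq> 0" and nd: "nodes r \<mu> w" and \<rho>: "0 < \<rho>"
  shows "\<exists>d>0. \<forall>\<nu>\<in>polydisc I \<mu> d. hdet r \<nu> \<noteq> 0 \<and>
    (\<forall>z. poly (den r \<nu>) z = 0 \<longrightarrow> (\<exists>j\<in>{1..r}. dist z (w j) < \<rho>)) \<and>
    (\<forall>j\<in>{1..r}. \<exists>z. poly (den r \<nu>) z = 0 \<and> dist z (w j) < \<rho>)"
proof -
  define N where "N = {\<mu> \<in> cspace I. hdet r \<mu> \<noteq> 0}"
  have N: "openin (top_of_set (cspace I)) N" unfolding N_def by (rule openin_hdet_nonzero)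
  \<comment> \<open>\<open>B\<close> bounds all roots of denominators whose coefficients differ by at most \<open>1\<close> from those at \<open>\<mu>\<close>.
    On the disc of radius \<open>B\<close> two such denominators differ by less than \<open>\<eta> * C \<le> \<rho> ^ r\<close> if their coefficients
    differ by less than \<open>\<eta>\<close>.\<close>
  define B where "B = 1 + (\<Sum>k<r. norm (qcoeff r k \<mu>) + 1)"
  have B: "B \<ge> 1" by (simp add: B_def sum_nonneg)
  define C where "C = (\<Sum>k<r. B ^ k) + 1"
  have C: "C > 0" using B by (simp add: C_def add_nonneg_pos sum_nonneg)
  define \<eta> where "\<eta> = min 1 (\<rho> ^ r / C)"
  have \<eta>: "\<eta> > 0" "\<eta> \<le> 1" "\<eta> * C \<le> \<rho> ^ r"
    using C \<rho> by (simp_all add: \<eta>_def min_mult_distrib_right min_le_iff_disj)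
  have "\<exists>d>0. \<forall>\<nu>\<in>polydisc I \<mu> d. \<forall>k\<in>{..<r}. dist (qcoeff r k \<nu>) (qcoeff r k \<mu>) < \<eta> \<and> \<nu> \<in> N"
  proof (rule polydisc_finite_conj)
    fix k
    have "continuous_on N (qcoeff r k)" by (rule continuous_on_qcoeff) (simp add: N_def)
    from continuous_on_polydisc_nbhd[OF _ N this _ \<eta>(1), of \<mu>]
    show "\<exists>d>0. \<forall>\<nu>\<in>polydisc I \<mu> d. dist (qcoeff r k \<nu>) (qcoeff r k \<mu>) < \<eta> \<and> \<nu> \<in> N"
      using \<mu> h by (auto simp: N_def I_def)
  qed simp
  then obtain d where d: "d > 0" "\<forall>\<nu>\<in>polydisc I \<mu> d. \<forall>k\<in>{..<r}. dist (qcoeff r k \<nu>) (qcoeff r k \<mu>) < \<eta> \<and> \<nu> \<in> N"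
    by (elim exE conjE)
  show ?thesis
  proof (intro exI[of _ d] conjI d(1) ballI)
    fix \<nu> assume \<nu>: "\<nu> \<in> polydisc I \<mu> d"
    have close: "norm (qcoeff r k \<nu> - qcoeff r k \<mu>) < \<eta>" if "k < r" for k
      using d(2) \<nu> that by (simp add: dist_norm)
    show h\<nu>: "hdet r \<nu> \<noteq> 0" using bspec[OF bspec[OF d(2) \<nu>], of 0] r by (simp add: N_def)
    have diff: "norm (poly (den r \<nu>) z - poly (den r \<mu>) z) < \<rho> ^ r" if "norm z \<le> B" for z
    proof -
      have "poly (den r \<nu>) z - poly (den r \<mu>) z = (\<Sum>k<r. (qcoeff r k \<nu> - qcoeff r k \<mu>) * z ^ k)"
        by (simp add: poly_den sum_subtractf left_diff_distrib)
      also have "norm \<dots> \<le> (\<Sum>k<r. norm ((qcoeff r k \<nu> - qcoeff r k \<mu>) * z ^ k))" by (rule norm_sum)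
      also have "\<dots> \<le> (\<Sum>k<r. \<eta> * B ^ k)"
        unfolding norm_mult norm_power
        by (intro sum_mono mult_mono power_mono that less_imp_le[OF close]) (use \<eta> in auto)
      also have "\<dots> = \<eta> * (C - 1)" by (simp add: C_def sum_distrib_left)
      also have "\<dots> < \<eta> * C" using \<eta>(1) by simp
      also have "\<dots> \<le> \<rho> ^ r" by (rule \<eta>(3))
      finally show ?thesis .
    qed
    have bound\<nu>: "norm z \<le> B" if "poly (den r \<nu>) z = 0" for z
    proof -
      have "norm z \<le> 1 + (\<Sum>k<r. norm (qcoeff r k \<nu>))"
        using that unfolding poly_den by (rule monic_root_bound)
      also have "\<dots> \<le> B" unfolding B_def
      proof (intro add_left_mono sum_mono)
        fix k assume "k \<in> {..<r}"
        then have "norm (qcoeff r k \<nu> - qcoeff r k \<mu>) < 1" using close[of k] \<eta>(2) by simp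
        then show "norm (qcoeff r k \<nu>) \<le> norm (qcoeff r k \<mu>) + 1"
          using norm_triangle_sub[of "qcoeff r k \<nu>" "qcoeff r k \<mu>"] by linarith
      qed
      finally show ?thesis .
    qed
    show "\<forall>z. poly (den r \<nu>) z = 0 \<longrightarrow> (\<exists>j\<in>{1..r}. dist z (w j) < \<rho>)"
    proof (intro allI impI)
      fix z assume z: "poly (den r \<nu>) z = 0"
      have "norm (\<Prod>j\<in>{1..r}. z - w j) < \<rho> ^ card {1..r}"
        using diff[OF bound\<nu>[OF z]] z unfolding poly_den_nodes[OF nd h] by simp
      from small_product_factor[OF _ this \<rho>] show "\<exists>j\<in>{1..r}. dist z (w j) < \<rho>"
        by (simp add: dist_norm)
    qed
    fix j assume j: "j \<in> {1..r}"
    obtain v where v: "nodes r \<nu> v" using nodes_exist[OF h\<nu>] by (rule exE)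
    have root: "poly (den r \<mu>) (w j) = 0" unfolding root_den_iff[OF nd h] using j by blast
    have "norm (w j) \<le> 1 + (\<Sum>k<r. norm (qcoeff r k \<mu>))"
      using root unfolding poly_den by (rule monic_root_bound)
    also have "\<dots> \<le> B" unfolding B_def by (intro add_left_mono sum_mono) simp
    finally have "norm (poly (den r \<nu>) (w j)) < \<rho> ^ r" using diff[of "w j"] root by simp
    then have "norm (\<Prod>i\<in>{1..r}. w j - v i) < \<rho> ^ card {1..r}"
      unfolding poly_den_nodes[OF v h\<nu>] by simp
    from small_product_factor[OF _ this \<rho>] obtain i where i: "i \<in> {1..r}" "norm (w j - v i) < \<rho>" by auto
    have "poly (den r \<nu>) (v i) = 0" unfolding root_den_iff[OF v h\<nu>] using i(1) by blast
    then show "\<exists>z. poly (den r \<nu>) z = 0 \<and> dist z (w j) < \<rho>"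
      using i(2) by (intro exI[of _ "v i"]) (simp add: dist_norm norm_minus_commute)
  qed
qed

text \<open>A quotient is differentiable at a zero of the numerator even if the denominator is only continuous. For the
roots of the denominator polynomial this replaces the implicit function theorem.\<close>

lemma field_differentiable_divide_root:
  fixes n D :: "complex \<Rightarrow> complex"
  assumes "n field_differentiable at z0" "n z0 = 0" "isCont D z0" "D z0 \<noteq> 0"
  shows "(\<lambda>z. n z / D z) field_differentiable at z0"
proof -
  obtain l where "DERIV n z0 :> l" using assms(1) by (auto simp: field_differentiable_def)
  then obtain g where g: "\<forall>z. n z - n z0 = g z * (z - z0)" "isCont g z0" "g z0 = l"
    unfolding CARAT_DERIV by blast
  have "DERIV (\<lambda>z. n z / D z) z0 :> g z0 / D z0"
    unfolding CARAT_DERIV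
  proof (intro exI[of _ "\<lambda>z. g z / D z"] conjI allI refl)
    show "isCont (\<lambda>z. g z / D z) z0" using g(2) assms(3,4) by (rule isCont_divide)
    show "n z / D z - n z0 / D z0 = g z / D z * (z - z0)" for z
      using g(1)[rule_format, of z] assms(2) by simp
  qed
  then show ?thesis by (auto simp: field_differentiable_def)
qed

lemma separation_exists:
  fixes w :: "'a \<Rightarrow> complex"
  assumes "finite A" "inj_on w A"
  shows "\<exists>\<rho>>0. \<forall>i\<in>A. \<forall>j\<in>A. i \<noteq> j \<longrightarrow> 3 * \<rho> \<le> dist (w i) (w j)"
proof -
  define D where "D = (\<lambda>(i, j). dist (w i) (w j)) ` {(i, j) \<in> A \<times> A. i \<noteq> j}"
  have fin: "finite D" unfolding D_def
    by (intro finite_imageI finite_subset[OF _ finite_cartesian_product[OF assms(1) assms(1)]]) auto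
  have pos: "x > 0" if "x \<in> D" for x
    using that assms(2) by (auto simp: D_def inj_on_def)
  define m where "m = Min (insert 1 D)"
  have m: "m > 0" "\<And>x. x \<in> D \<Longrightarrow> m \<le> x" using fin pos by (auto simp: m_def)
  have "3 * (m / 3) \<le> dist (w i) (w j)" if "i \<in> A" "j \<in> A" "i \<noteq> j" for i j
    using m(2)[of "dist (w i) (w j)"] that by (force simp: D_def)
  with m(1) show ?thesis by (intro exI[of _ "m / 3"]) auto
qed

lemma isCont_line_coordinate: "isCont (\<lambda>z. (p(i := z)) k) z0" for p :: cvec
  by (cases "k = i") simp_all

lemma differentiable_line_coordinate: "(\<lambda>z. (p(i := z)) k) field_differentiable at z0" for p :: cvec
  by (cases "k = i") simp_all

lemma coordinate_line_eventually:
  fixes p :: cvec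
  assumes "p \<in> polydisc I c e" "i \<in> I" "finite I"
  shows "\<forall>\<^sub>F z in at (p i). p(i := z) \<in> polydisc I c e"
proof -
  obtain d where d: "d > 0" "polydisc I p d \<subseteq> polydisc I c e" using polydisc_nested[OF assms(1,3)] by blast
  have "p(i := z) \<in> polydisc I p d" if "dist z (p i) < d" for z
    using that assms(1,2) d(1) by (auto simp: mem_polydisc cspace_def PiE_iff extensional_def dist_commute)
  then show ?thesis using d unfolding eventually_at by blast
qed

text \<open>The branch chooses for each node the root close to it. It is continuous because the roots are, and
differentiable because a root can be isolated from the others. Uniqueness serves to identify branches found in different ways.\<close>

lemma local_branch:
  fixes r :: nat
  defines "I \<equiv> {..<2 * r}"
  assumes r: "1 \<le> r" and \<mu>: "\<mu> \<in> cspace I" and h: "hdet r \<mu> \<noteq> 0" and nd: "nodes r \<mu> w"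
    and inj: "inj_on w {1..r}"
  shows "\<exists>e>0. \<exists>\<rho>>0. \<exists>f. holomorphic_map I {1..r} (polydisc I \<mu> e) f \<and> f \<mu> = w \<and>
    (\<forall>i\<in>{1..r}. \<forall>j\<in>{1..r}. i \<noteq> j \<longrightarrow> 3 * \<rho> \<le> dist (w i) (w j)) \<and>
    (\<forall>\<nu>\<in>polydisc I \<mu> e. hdet r \<nu> \<noteq> 0 \<and> nodes r \<nu> (f \<nu>) \<and> (\<forall>i\<in>{1..r}. dist (f \<nu> i) (w i) < \<rho>) \<and>
      (\<forall>w'. nodes r \<nu> w' \<and> (\<forall>i\<in>{1..r}. dist (w' i) (w i) < \<rho>) \<longrightarrow> w' = f \<nu>))"
proof -
  have fI: "finite I" by (simp add: I_def)
  obtain \<rho> where \<rho>: "\<rho> > 0" and sep: "\<And>i j. i \<in> {1..r} \<Longrightarrow> j \<in> {1..r} \<Longrightarrow> i \<noteq> j \<Longrightarrow> 3 * \<rho> \<le> dist (w i) (w j)"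
    using separation_exists[OF finite_atLeastAtMost inj] by blast
  obtain e where e: "e > 0" and near0: "\<forall>\<nu>\<in>polydisc I \<mu> e. hdet r \<nu> \<noteq> 0 \<and>
    (\<forall>z. poly (den r \<nu>) z = 0 \<longrightarrow> (\<exists>j\<in>{1..r}. dist z (w j) < \<rho>)) \<and>
    (\<forall>j\<in>{1..r}. \<exists>z. poly (den r \<nu>) z = 0 \<and> dist z (w j) < \<rho>)"
    using roots_near[OF r \<mu>[unfolded I_def] h nd \<rho>] unfolding I_def by (elim exE conjE)
  have near: "hdet r \<nu> \<noteq> 0" "j \<in> {1..r} \<Longrightarrow> \<exists>z. poly (den r \<nu>) z = 0 \<and> dist z (w j) < \<rho>"
    if "\<nu> \<in> polydisc I \<mu> e" for \<nu> j
    using bspec[OF near0 that] by blast+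
  define P where "P = polydisc I \<mu> e"
  have Pc: "P \<subseteq> cspace I" unfolding P_def by (rule polydisc_subset_cspace)
  define f where "f \<nu> = (\<lambda>j\<in>{1..r}. SOME z. poly (den r \<nu>) z = 0 \<and> dist z (w j) < \<rho>)" for \<nu>
  have f: "poly (den r \<nu>) (f \<nu> j) = 0" "dist (f \<nu> j) (w j) < \<rho>" if "\<nu> \<in> P" "j \<in> {1..r}" for \<nu> j
    using someI_ex[OF near(2)[OF that[unfolded P_def]]] that(2) by (simp_all add: f_def)
  have fc: "f \<nu> \<in> cspace {1..r}" for \<nu> by (simp add: f_def cspace_def)
  have fsep: "\<rho> < dist (f \<nu> i) (f \<nu>' j)" if "\<nu> \<in> P" "\<nu>' \<in> P" "i \<in> {1..r}" "j \<in> {1..r}" "i \<noteq> j" for \<nu> \<nu>' i j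
  proof -
    have "3 * \<rho> \<le> dist (w i) (w j)" by (rule sep[OF that(3,4,5)])
    also have "\<dots> \<le> dist (w i) (f \<nu> i) + dist (f \<nu> i) (w j)" by (rule dist_triangle)
    also have "dist (f \<nu> i) (w j) \<le> dist (f \<nu> i) (f \<nu>' j) + dist (f \<nu>' j) (w j)" by (rule dist_triangle)
    finally show ?thesis using f(2)[OF that(1,3)] f(2)[OF that(2,4)] by (simp add: dist_commute)
  qed
  have finj: "inj_on (f \<nu>) {1..r}" if "\<nu> \<in> P" for \<nu>
  proof (rule inj_onI, rule ccontr)
    fix i j assume "i \<in> {1..r}" "j \<in> {1..r}" "f \<nu> i = f \<nu> j" "i \<noteq> j"
    with fsep[OF that that, of i j] \<rho> show False by simp
  qed
  have fn: "nodes r \<nu> (f \<nu>)" if "\<nu> \<in> P" for \<nu>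
    by (rule distinct_roots_nodes[OF near(1) fc finj f(1)]) (use that in \<open>simp_all add: P_def\<close>)
  have uniq: "w' = f \<nu>" if \<nu>: "\<nu> \<in> P" and w': "nodes r \<nu> w'" "\<forall>i\<in>{1..r}. dist (w' i) (w i) < \<rho>" for \<nu> w'
  proof -
    have h\<nu>: "hdet r \<nu> \<noteq> 0" using near(1) \<nu> by (simp add: P_def)
    have "w' i = f \<nu> i" if i: "i \<in> {1..r}" for i
    proof -
      have "poly (den r \<nu>) (w' i) = 0" unfolding root_den_iff[OF w'(1) h\<nu>] using i by blast
      then obtain j where j: "j \<in> {1..r}" "w' i = f \<nu> j" unfolding root_den_iff[OF fn[OF \<nu>] h\<nu>] by blast
      have "dist (w i) (w j) \<le> dist (w i) (w' i) + dist (w' i) (w j)" by (rule dist_triangle)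
      also have "\<dots> < 3 * \<rho>" using bspec[OF w'(2) i] f(2)[OF \<nu> j(1)] j(2) \<rho> by (simp add: dist_commute)
      finally have "i = j" using sep[OF i j(1)] by linarith
      then show ?thesis using j by simp
    qed
    moreover have "w' \<in> cspace {1..r}" using w'(1) by (simp add: nodes_def)
    ultimately show ?thesis using fc[of \<nu>] unfolding cspace_def by (intro PiE_ext[of w' "{1..r}" "\<lambda>_. UNIV" "f \<nu>"])
  qed
  have cont: "continuous_on P (\<lambda>\<nu>. f \<nu> i)" if i: "i \<in> {1..r}" for i
  proof (rule continuous_on_polydiscI[OF fI Pc])
    fix p \<epsilon> assume p: "p \<in> P" and \<epsilon>: "(0::real) < \<epsilon>"
    have hp: "hdet r p \<noteq> 0" "p \<in> cspace I" using near(1) p Pc by (auto simp: P_def)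
    have "0 < min \<rho> \<epsilon>" using \<rho> \<epsilon> by simp
    from roots_near[OF r hp(2)[unfolded I_def] hp(1) fn[OF p] this] obtain d where d: "d > 0"
      and d0: "\<forall>\<nu>\<in>polydisc I p d. hdet r \<nu> \<noteq> 0 \<and>
        (\<forall>z. poly (den r \<nu>) z = 0 \<longrightarrow> (\<exists>j\<in>{1..r}. dist z (f p j) < min \<rho> \<epsilon>)) \<and>
        (\<forall>j\<in>{1..r}. \<exists>z. poly (den r \<nu>) z = 0 \<and> dist z (f p j) < min \<rho> \<epsilon>)"
      unfolding I_def by (elim exE conjE)
    have d1: "\<exists>j\<in>{1..r}. dist z (f p j) < min \<rho> \<epsilon>"
      if "\<nu> \<in> polydisc I p d" "poly (den r \<nu>) z = 0" for \<nu> z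
      using bspec[OF d0 that(1)] that(2) by blast
    show "\<exists>d>0. \<forall>q\<in>polydisc I p d. q \<in> P \<longrightarrow> dist (f q i) (f p i) < \<epsilon>"
    proof (intro exI[of _ d] conjI d ballI impI)
      fix q assume q: "q \<in> polydisc I p d" "q \<in> P"
      obtain j where j: "j \<in> {1..r}" "dist (f q i) (f p j) < min \<rho> \<epsilon>"
        using d1[OF q(1) f(1)[OF q(2) i]] by blast
      have "j = i"
      proof (rule ccontr)
        assume "j \<noteq> i"
        then have "\<rho> < dist (f q i) (f p j)" by (intro fsep[OF q(2) p i j(1)]) simp
        then show False using j(2) by simp
      qed
      then show "dist (f q i) (f p i) < \<epsilon>" using j(2) by simp
    qed
  qed
  have hol: "holomorphic_map I {1..r} P f"
    unfolding holomorphic_map_def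
  proof (intro conjI ballI)
    show "openin (top_of_set (cspace I)) P" unfolding P_def by (rule openin_polydisc[OF fI])
    show "f ` P \<subseteq> cspace {1..r}" using fc by blast
    show "continuous_on P f"
    proof (rule continuous_on_coordinatewise_then_product)
      fix i show "continuous_on P (\<lambda>\<nu>. f \<nu> i)"
      proof (cases "i \<in> {1..r}")
        case False
        then have "f \<nu> i = undefined" for \<nu> unfolding f_def restrict_def by (simp only: if_False)
        then show ?thesis by simp
      qed (rule cont)
    qed
    fix p i j assume p: "p \<in> P" and i: "i \<in> I" and j: "j \<in> {1..r}"
    define \<zeta> where "\<zeta> = f p j"
    \<comment> \<open>Evaluating \<open>den\<close> at the fixed point \<open>\<zeta>\<close> isolates the \<open>j\<close>-th root:
      \<open>n z = (\<zeta> - f (p(i := z)) j) * D z\<close>, where \<open>D\<close> is continuous and nonzero.\<close>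
    define n where "n z = poly (den r (p(i := z))) \<zeta>" for z
    define D where "D z = (\<Prod>k\<in>{1..r} - {j}. \<zeta> - f (p(i := z)) k)" for z
    have ev: "\<forall>\<^sub>F z in at (p i). p(i := z) \<in> P"
      using coordinate_line_eventually[OF _ i fI] p by (simp add: P_def)
    have hp: "hdet r p \<noteq> 0" using near(1) p by (simp add: P_def)
    have "(\<lambda>z. hdet r (p(i := z))) field_differentiable at (p i)" "(\<lambda>z. qnum r k (p(i := z))) field_differentiable at (p i)" for k
      by (rule polynomial_fun_differentiable[OF polynomial_fun_hdet differentiable_line_coordinate]
          polynomial_fun_differentiable[OF polynomial_fun_qnum differentiable_line_coordinate])+
    then have qd: "(\<lambda>z. qcoeff r k (p(i := z))) field_differentiable at (p i)" for k
      unfolding qcoeff_def by (intro field_differentiable_divide) (simp_all add: hp)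
    have nd': "n field_differentiable at (p i)"
      unfolding n_def poly_den
      by (intro field_differentiable_add field_differentiable_sum field_differentiable_mult qd field_differentiable_const)
    have n0: "n (p i) = 0" using f(1)[OF p j] by (simp add: n_def \<zeta>_def)
    have fl: "isCont (\<lambda>z. f (p(i := z)) k) (p i)" if k: "k \<in> {1..r}" for k
    proof -
      obtain d where d: "d > 0" "\<And>z. dist z (p i) < d \<Longrightarrow> z \<noteq> p i \<Longrightarrow> p(i := z) \<in> P"
        using ev unfolding eventually_at by blast
      have dP: "p(i := z) \<in> P" if "z \<in> ball (p i) d" for z
        using d(2)[of z] that p by (cases "z = p i") (simp_all add: dist_commute)
      have "continuous_on (ball (p i) d) (\<lambda>z. f (p(i := z)) k)"
      proof (rule continuous_on_compose2[OF cont[OF k]])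
        show "continuous_on (ball (p i) d) (\<lambda>z. p(i := z))"
          by (intro continuous_on_coordinatewise_then_product continuous_at_imp_continuous_on ballI
              isCont_line_coordinate)
      qed (use dP in blast)
      then show ?thesis
        using d(1) by (simp add: continuous_on_eq_continuous_at)
    qed
    have D: "isCont D (p i)" unfolding D_def by (intro continuous_prod continuous_diff continuous_const fl) simp
    have Dnz: "D z \<noteq> 0" if "p(i := z) \<in> P" for z
    proof -
      have "\<zeta> \<noteq> f (p(i := z)) k" if "k \<in> {1..r} - {j}" for k
      proof -
        have "\<rho> < dist \<zeta> (f (p(i := z)) k)"
          unfolding \<zeta>_def by (rule fsep[OF p \<open>p(i := z) \<in> P\<close> j]) (use that in blast)+
        then show ?thesis using \<rho> by (metis dist_self less_asym)
      qed
      then show ?thesis by (simp add: D_def)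
    qed
    have "(\<lambda>z. n z / D z) field_differentiable at (p i)"
      by (rule field_differentiable_divide_root[OF nd' n0 D]) (rule Dnz, simp add: p)
    then have "(\<lambda>z. \<zeta> - n z / D z) field_differentiable at (p i)"
      by (intro field_differentiable_diff field_differentiable_const)
    moreover have eq: "\<zeta> - n z / D z = f (p(i := z)) j" if z: "p(i := z) \<in> P" for z
    proof -
      have "hdet r (p(i := z)) \<noteq> 0" using near(1) z by (simp add: P_def)
      then have "n z = (\<Prod>k\<in>{1..r}. \<zeta> - f (p(i := z)) k)"
        unfolding n_def by (rule poly_den_nodes[OF fn[OF z]])
      also have "\<dots> = (\<zeta> - f (p(i := z)) j) * D z"
        unfolding D_def by (rule prod.remove[OF finite_atLeastAtMost j])
      finally show ?thesis using Dnz[OF z] by simp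
    qed
    ultimately show "(\<lambda>z. f (p(i := z)) j) field_differentiable at (p i)"
    proof -
      assume "(\<lambda>z. \<zeta> - n z / D z) field_differentiable at (p i)"
      then obtain l where l: "((\<lambda>z. \<zeta> - n z / D z) has_field_derivative l) (at (p i))"
        unfolding field_differentiable_def by (rule exE)
      have "\<forall>\<^sub>F z in nhds (p i). p(i := z) \<in> P"
        using ev p unfolding eventually_nhds_conv_at by simp
      then have "\<forall>\<^sub>F z in nhds (p i). \<zeta> - n z / D z = f (p(i := z)) j"
        by eventually_elim (rule eq)
      from DERIV_cong_ev[OF refl this refl, of l] l
      have "((\<lambda>z. f (p(i := z)) j) has_field_derivative l) (at (p i))" by simp
      then show ?thesis by (auto simp: field_differentiable_def)
    qed
  qed
  have "f \<mu> = w"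
    using uniq[of \<mu> w] nd \<mu> e \<rho> centre_in_polydisc[of \<mu> I e] by (simp add: P_def)
  show ?thesis
  proof (rule exI[of _ e], intro conjI e, rule exI[of _ \<rho>], intro conjI \<rho>, rule exI[of _ f],
      intro conjI ballI allI impI \<open>f \<mu> = w\<close>)
    show "holomorphic_map I {1..r} (polydisc I \<mu> e) f" using hol unfolding P_def .
    show "3 * \<rho> \<le> dist (w i) (w j)" if "i \<in> {1..r}" "j \<in> {1..r}" "i \<noteq> j" for i j
      using that by (rule sep)
    fix \<nu> assume \<nu>: "\<nu> \<in> polydisc I \<mu> e"
    then show "hdet r \<nu> \<noteq> 0" by (rule near(1))
    from \<nu> have \<nu>P: "\<nu> \<in> P" unfolding P_def .
    then show "nodes r \<nu> (f \<nu>)" by (rule fn)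
    show "dist (f \<nu> i) (w i) < \<rho>" if "i \<in> {1..r}" for i using \<nu>P that by (rule f(2))
    show "w' = f \<nu>" if "nodes r \<nu> w' \<and> (\<forall>i\<in>{1..r}. dist (w' i) (w i) < \<rho>)" for w'
      using uniq[OF \<nu>P] that by blast
  qed
qed

section \<open>Lifting paths to node vectors\<close>

text \<open>Along a path that avoids the discriminant the roots form a covering space of the parameter set: the local
branches are the sheets.\<close>

lemma root_covering_space:
  fixes \<gamma> :: "real \<Rightarrow> cvec" and r :: nat
  defines "I \<equiv> {..<2 * r}"
  assumes r: "1 \<le> r" and cont: "continuous_on S \<gamma>" and sub: "\<gamma> ` S \<subseteq> cspace I"
    and h: "\<And>t. t \<in> S \<Longrightarrow> hdet r (\<gamma> t) \<noteq> 0" and d: "\<And>t. t \<in> S \<Longrightarrow> disc r (\<gamma> t) \<noteq> 0"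
  shows "covering_space {(t, z). t \<in> S \<and> poly (den r (\<gamma> t)) z = 0} fst S"
proof
  define E where "E = {(t, z). t \<in> S \<and> poly (den r (\<gamma> t)) z = 0}"
  have fI: "finite I" by (simp add: I_def)
  show "continuous_on {(t, z). t \<in> S \<and> poly (den r (\<gamma> t)) z = 0} fst" by (intro continuous_intros)
  show "fst ` {(t, z). t \<in> S \<and> poly (den r (\<gamma> t)) z = 0} = S"
  proof (intro equalityI subsetI)
    fix t assume t: "t \<in> S"
    obtain w where w: "nodes r (\<gamma> t) w" using nodes_exist[OF h[OF t]] by (rule exE)
    have "poly (den r (\<gamma> t)) (w 1) = 0" unfolding root_den_iff[OF w h[OF t]] using r by (intro imageI) simp
    then show "t \<in> fst ` {(t, z). t \<in> S \<and> poly (den r (\<gamma> t)) z = 0}"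
      using t by (intro image_eqI[of _ _ "(t, w 1)"]) simp_all
  qed auto
  fix t assume t: "t \<in> S"
  obtain w where w: "nodes r (\<gamma> t) w" using nodes_exist[OF h[OF t]] by (rule exE)
  have inj: "inj_on w {1..r}" using disc_nonzero_iff[OF w h[OF t]] d[OF t] by blast
  have \<gamma>t: "\<gamma> t \<in> cspace {..<2 * r}" using sub t by (auto simp: I_def)
  obtain e \<rho> f where e: "e > 0" and \<rho>: "\<rho> > 0" and hol: "holomorphic_map I {1..r} (polydisc I (\<gamma> t) e) f"
    and sep: "\<forall>i\<in>{1..r}. \<forall>j\<in>{1..r}. i \<noteq> j \<longrightarrow> 3 * \<rho> \<le> dist (w i) (w j)"
    and f: "\<forall>\<nu>\<in>polydisc I (\<gamma> t) e. hdet r \<nu> \<noteq> 0 \<and> nodes r \<nu> (f \<nu>) \<and> (\<forall>i\<in>{1..r}. dist (f \<nu> i) (w i) < \<rho>) \<and>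
      (\<forall>w'. nodes r \<nu> w' \<and> (\<forall>i\<in>{1..r}. dist (w' i) (w i) < \<rho>) \<longrightarrow> w' = f \<nu>)"
    using local_branch[OF r \<gamma>t h[OF t] w inj] unfolding I_def by (elim exE conjE)
  have f1: "hdet r \<nu> \<noteq> 0" "nodes r \<nu> (f \<nu>)" "i \<in> {1..r} \<Longrightarrow> dist (f \<nu> i) (w i) < \<rho>"
    if "\<nu> \<in> polydisc I (\<gamma> t) e" for \<nu> i
    using bspec[OF f that] by blast+
  define T where "T = {s \<in> S. \<gamma> s \<in> polydisc I (\<gamma> t) e}"
  have T: "openin (top_of_set S) T"
  proof -
    obtain A where A: "open A" "polydisc I (\<gamma> t) e = cspace I \<inter> A"
      using openin_polydisc[OF fI, of "\<gamma> t" e] by (auto simp: openin_open)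
    have "T = S \<inter> \<gamma> -` A" using A(2) sub by (auto simp: T_def)
    then show ?thesis using continuous_openin_preimage_gen[OF cont A(1)] by simp
  qed
  have tT: "t \<in> T" using t centre_in_polydisc[OF _ e, of "\<gamma> t" I] \<gamma>t by (simp add: T_def I_def)
  \<comment> \<open>The sheets: roots that are close to the \<open>i\<close>-th node over \<open>t\<close>.\<close>
  define U where "U i = E \<inter> fst -` T \<inter> (E \<inter> snd -` ball (w i) \<rho>)" for i
  have memU: "(s, z) \<in> U i \<longleftrightarrow> s \<in> T \<and> poly (den r (\<gamma> s)) z = 0 \<and> dist (w i) z < \<rho>" for s z i
    by (rule iffI; simp add: U_def E_def T_def)
  have rootf: "poly (den r (\<gamma> s)) z = 0 \<longleftrightarrow> (\<exists>j\<in>{1..r}. z = f (\<gamma> s) j)" if "s \<in> T" for s z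
  proof -
    have "\<gamma> s \<in> polydisc I (\<gamma> t) e" using that by (simp add: T_def)
    from root_den_iff[OF f1(2)[OF this] f1(1)[OF this]] show ?thesis by (simp add: image_iff)
  qed
  have close: "i \<in> {1..r} \<Longrightarrow> dist (w i) (f (\<gamma> s) i) < \<rho>" if "s \<in> T" for s i
    using f1(3)[of "\<gamma> s" i] that by (simp add: T_def dist_commute)
  have same: "i = j" if "i \<in> {1..r}" "j \<in> {1..r}" "dist (w i) z < \<rho>" "dist (w j) z < \<rho>" for i j z
  proof (rule ccontr)
    assume "i \<noteq> j"
    then have "3 * \<rho> \<le> dist (w i) (w j)" using sep that(1,2) by blast
    also have "\<dots> \<le> dist (w i) z + dist (w j) z" by (rule dist_triangle2)
    finally show False using that(3,4) \<rho> by linarith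
  qed
  show "\<exists>T. t \<in> T \<and> openin (top_of_set S) T \<and>
      (\<exists>v. \<Union>v = {(t, z). t \<in> S \<and> poly (den r (\<gamma> t)) z = 0} \<inter> fst -` T \<and>
        (\<forall>u\<in>v. openin (top_of_set {(t, z). t \<in> S \<and> poly (den r (\<gamma> t)) z = 0}) u) \<and>
        pairwise disjnt v \<and> (\<forall>u\<in>v. \<exists>q. homeomorphism u T fst q))"
    unfolding E_def[symmetric]
  proof (rule exI[of _ T], intro conjI tT T, rule exI[of _ "U ` {1..r}"], intro conjI ballI)
    show "\<Union> (U ` {1..r}) = E \<inter> fst -` T"
    proof (intro equalityI subsetI)
      fix x assume x: "x \<in> E \<inter> fst -` T"
      obtain s z where sz: "x = (s, z)" by (cases x)
      have s: "s \<in> T" "poly (den r (\<gamma> s)) z = 0" using x by (auto simp: sz E_def)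
      then obtain j where j: "j \<in> {1..r}" "z = f (\<gamma> s) j" using rootf by blast
      have "x \<in> U j" unfolding sz memU using s close[OF s(1) j(1)] j(2) by blast
      then show "x \<in> \<Union> (U ` {1..r})" using j(1) by blast
    qed (unfold U_def, blast)
    fix u assume "u \<in> U ` {1..r}"
    then obtain i where i: "i \<in> {1..r}" "u = U i" by blast
    show "openin (top_of_set E) u"
      unfolding i(2) U_def
    proof (rule openin_Int)
      show "openin (top_of_set E) (E \<inter> fst -` T)"
        by (rule continuous_openin_preimage[OF _ _ T]) (auto simp: E_def intro!: continuous_intros)
      show "openin (top_of_set E) (E \<inter> snd -` ball (w i) \<rho>)"
        by (intro continuous_openin_preimage_gen continuous_intros) simp
    qed
    show "\<exists>q. homeomorphism u T fst q"
    proof (intro exI[of _ "\<lambda>s. (s, f (\<gamma> s) i)"] homeomorphismI)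
      show "continuous_on u fst" by (intro continuous_intros)
      have cf: "continuous_on (polydisc I (\<gamma> t) e) f" using hol by (simp add: holomorphic_map_def)
      have c\<gamma>: "continuous_on T \<gamma>" using cont by (rule continuous_on_subset) (auto simp: T_def)
      have "continuous_on T (\<lambda>s. f (\<gamma> s))"
        by (rule continuous_on_compose2[OF cf c\<gamma>]) (auto simp: T_def)
      then have "continuous_on T (\<lambda>s. f (\<gamma> s) i)"
        by (rule continuous_on_product_then_coordinatewise)
      then show "continuous_on T (\<lambda>s. (s, f (\<gamma> s) i))"
        by (rule continuous_on_Pair[OF continuous_on_id])
      show "fst ` u \<subseteq> T" unfolding i(2) U_def by blast
      show "(\<lambda>s. (s, f (\<gamma> s) i)) ` T \<subseteq> u"
      proof (rule image_subsetI)
        fix s assume s: "s \<in> T"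
        then show "(s, f (\<gamma> s) i) \<in> u"
          unfolding i(2) memU using close[OF s i(1)] rootf[OF s] i(1) by blast
      qed
      show "(fst x, f (\<gamma> (fst x)) i) = x" if "x \<in> u" for x
      proof -
        obtain s z where sz: "x = (s, z)" by (cases x)
        have s: "s \<in> T" "poly (den r (\<gamma> s)) z = 0" "dist (w i) z < \<rho>"
          using that unfolding i(2) sz memU by blast+
        then obtain j where j: "j \<in> {1..r}" "z = f (\<gamma> s) j" using rootf by blast
        have "i = j" using same[OF i(1) j(1) s(3)] close[OF s(1) j(1)] j(2) by blast
        then show ?thesis by (simp add: sz j(2))
      qed
    qed simp
  next
    show "pairwise disjnt (U ` {1..r})"
    proof (rule pairwiseI)
      fix u v assume "u \<in> U ` {1..r}" "v \<in> U ` {1..r}" "u \<noteq> v"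
      then obtain i j where ij: "i \<in> {1..r}" "j \<in> {1..r}" "u = U i" "v = U j" "i \<noteq> j" by blast
      show "disjnt u v" unfolding disjnt_iff
      proof (intro allI notI)
        fix x assume "x \<in> u \<and> x \<in> v"
        then have "dist (w i) (snd x) < \<rho>" "dist (w j) (snd x) < \<rho>" unfolding ij(3,4) by (simp_all add: U_def)
        from same[OF ij(1,2) this] ij(5) show False by contradiction
      qed
    qed
  qed
qed

text \<open>Each node is lifted on its own through the covering space of the roots. Two lifts that meet once coincide, so the lifted
nodes stay distinct and together they exhaust the roots.\<close>

lemma lift_nodes:
  fixes \<gamma> :: "real \<Rightarrow> cvec" and r :: nat
  assumes r: "1 \<le> r" and cont: "continuous_on {0..<1} \<gamma>" and sub: "\<gamma> ` {0..<1} \<subseteq> cspace {..<2 * r}"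
    and h: "\<And>t. t \<in> {0..<1} \<Longrightarrow> hdet r (\<gamma> t) \<noteq> 0" and d: "\<And>t. t \<in> {0..<1} \<Longrightarrow> disc r (\<gamma> t) \<noteq> 0"
    and w0: "nodes r (\<gamma> 0) w0"
  shows "\<exists>W. W 0 = w0 \<and> (\<forall>t\<in>{0..<1}. nodes r (\<gamma> t) (W t)) \<and> (\<forall>j. continuous_on {0..<1} (\<lambda>t. W t j))"
proof -
  define S where "S = {0..<1 :: real}"
  define E where "E = {(t, z). t \<in> S \<and> poly (den r (\<gamma> t)) z = 0}"
  have S0: "0 \<in> S" by (simp add: S_def)
  have cov: "covering_space E fst S"
    unfolding E_def S_def by (rule root_covering_space[OF r cont sub h d])
  have convS: "convex S" by (simp add: S_def)
  have "\<forall>j\<in>{1..r}. \<exists>g. continuous_on S g \<and> g \<in> S \<rightarrow> E \<and> g 0 = (0, w0 j) \<and> (\<forall>t\<in>S. fst (g t) = t)"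
  proof
    fix j assume j: "j \<in> {1..r}"
    have E0: "(0, w0 j) \<in> E"
      unfolding E_def using root_den_iff[OF w0 h, of "w0 j"] S0 j by (auto simp: S_def)
    obtain g where "continuous_on S g" "g \<in> S \<rightarrow> E" "g 0 = (0, w0 j)" "\<And>y. y \<in> S \<Longrightarrow> fst (g y) = y"
      by (rule covering_space_lift_strong[OF cov E0 S0 convex_imp_simply_connected[OF convS]
            convex_imp_locally_path_connected[OF convS] continuous_on_id]) simp_all
    then show "\<exists>g. continuous_on S g \<and> g \<in> S \<rightarrow> E \<and> g 0 = (0, w0 j) \<and> (\<forall>t\<in>S. fst (g t) = t)"
      by blast
  qed
  from bchoice[OF this] obtain g where G: "\<forall>j\<in>{1..r}. continuous_on S (g j) \<and> g j \<in> S \<rightarrow> E \<and>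
      g j 0 = (0, w0 j) \<and> (\<forall>t\<in>S. fst (g j t) = t)" by (rule exE)
  have g: "continuous_on S (g j)" "g j \<in> S \<rightarrow> E" "g j 0 = (0, w0 j)" "t \<in> S \<Longrightarrow> fst (g j t) = t"
    if "j \<in> {1..r}" for j t
    using bspec[OF G that] by blast+
  have inj0: "inj_on w0 {1..r}" using disc_nonzero_iff[OF w0 h] d by auto
  have root: "poly (den r (\<gamma> t)) (snd (g j t)) = 0" if "t \<in> S" "j \<in> {1..r}" for t j
  proof -
    have "g j t \<in> E" using g(2)[OF that(2)] that(1) by blast
    then show ?thesis using g(4)[OF that(2,1)] by (auto simp: E_def)
  qed
  define W where "W t = (\<lambda>j\<in>{1..r}. snd (g j t))" for t
  have inj: "inj_on (W t) {1..r}" if t: "t \<in> S" for t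
  proof (rule inj_onI)
    fix i j assume ij: "i \<in> {1..r}" "j \<in> {1..r}" and "W t i = W t j"
    then have "snd (g i t) = snd (g j t)" by (simp add: W_def)
    then have eq: "g i t = g j t" using g(4)[OF ij(1) t] g(4)[OF ij(2) t] by (simp add: prod_eq_iff)
    have "g i 0 = g j 0"
      by (rule covering_space_lift_unique[where f = "\<lambda>x. x" and T = S and a = t and ?g1.0 = "g i" and ?g2.0 = "g j", OF cov eq])
         (use g(1,2)[OF ij(1)] g(1,2)[OF ij(2)] g(4)[OF ij(1)] g(4)[OF ij(2)] convex_connected[OF convS] t S0
           in \<open>simp_all\<close>)
    then have "w0 i = w0 j" using g(3) ij by simp
    then show "i = j" using inj0 ij by (simp add: inj_onD)
  qed
  show ?thesis
  proof (intro exI[of _ W] conjI ballI allI)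
    show "W 0 = w0"
      using w0 g(3) by (auto simp: W_def nodes_def cspace_def PiE_iff extensional_def fun_eq_iff)
    fix t :: real assume "t \<in> {0..<1}"
    then have t: "t \<in> S" by (simp add: S_def)
    show "nodes r (\<gamma> t) (W t)"
      by (rule distinct_roots_nodes[OF _ _ inj[OF t]])
         (use t h[of t] root[OF t] in \<open>simp_all add: S_def W_def cspace_def\<close>)
  next
    fix j show "continuous_on {0..<1} (\<lambda>t. W t j)"
    proof (cases "j \<in> {1..r}")
      case True
      then have eq: "(\<lambda>t. W t j) = (\<lambda>t. snd (g j t))" by (simp add: W_def)
      show ?thesis unfolding eq using continuous_on_snd[OF g(1)[OF True]] by (simp only: S_def)
    next
      case False
      then have eq: "(\<lambda>t. W t j) = (\<lambda>t. undefined)" unfolding W_def restrict_def by (simp only: if_False)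
      show ?thesis unfolding eq by (rule continuous_on_const)
    qed
  qed
qed

section \<open>Persistence of the defining equations under continuation\<close>

text \<open>The identity theorem for separately holomorphic functions: the coordinates are moved one after the
other from the small polydisc to the target, using the identity theorem in one variable each time.\<close>

lemma identity_polydisc:
  fixes g :: "cvec \<Rightarrow> complex"
  assumes I: "finite I"
    and diff: "\<And>p i. p \<in> polydisc I c e \<Longrightarrow> i \<in> I \<Longrightarrow> (\<lambda>z. g (p(i := z))) field_differentiable at (p i)"
    and b: "b \<in> polydisc I c e" and d: "0 < d" and zero: "\<And>q. q \<in> polydisc I b d \<Longrightarrow> g q = 0"
    and q: "q \<in> polydisc I c e"
  shows "g q = 0"
proof -
  \<comment> \<open>The coordinates in \<open>J\<close> are free, the others are still close to those of \<open>b\<close>.\<close>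
  have claim: "\<forall>q\<in>polydisc I c e. (\<forall>i\<in>I - J. dist (b i) (q i) < d) \<longrightarrow> g q = 0" if "finite J" "J \<subseteq> I" for J
    using that
  proof (induction J rule: finite_induct)
    case empty
    then show ?case using zero by (auto simp: mem_polydisc)
  next
    case (insert k J)
    show ?case
    proof (intro ballI impI)
      fix q assume q: "q \<in> polydisc I c e" and close: "\<forall>i\<in>I - insert k J. dist (b i) (q i) < d"
      have k: "k \<in> I" using insert.prems by simp
      have upd: "q(k := z) \<in> polydisc I c e" if "z \<in> ball (c k) e" for z
        using q that k by (auto simp: mem_polydisc cspace_def PiE_iff extensional_def)
      have hol: "(\<lambda>z. g (q(k := z))) holomorphic_on ball (c k) e"
        unfolding holomorphic_on_def
      proof
        fix z assume "z \<in> ball (c k) e"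
        from diff[OF upd[OF this] k] have "(\<lambda>z. g (q(k := z))) field_differentiable at z" by simp
        then show "(\<lambda>z. g (q(k := z))) field_differentiable at z within ball (c k) e"
          by (rule field_differentiable_at_within)
      qed
      have "g (q(k := q k)) = 0"
      proof (rule analytic_continuation_open[of "ball (b k) d \<inter> ball (c k) e" "ball (c k) e" "\<lambda>z. g (q(k := z))" "\<lambda>z. 0"])
        have "b k \<in> ball (b k) d \<inter> ball (c k) e" using b d k by (simp add: mem_polydisc)
        then show "ball (b k) d \<inter> ball (c k) e \<noteq> {}" by blast
        show "q k \<in> ball (c k) e" using q k by (simp add: mem_polydisc)
        show "g (q(k := z)) = 0" if z: "z \<in> ball (b k) d \<inter> ball (c k) e" for z
        proof -
          have "\<forall>i\<in>I - J. dist (b i) ((q(k := z)) i) < d" using close z by simp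
          then show ?thesis using insert.IH insert.prems upd[of z] z by blast
        qed
      qed (use hol in auto)
      then show "g q = 0" by simp
    qed
  qed
  from claim[OF I subset_refl] q show ?thesis by simp
qed

lemma differentiable_coeff_linprod:
  assumes "\<And>x. x \<in> set xs \<Longrightarrow> (\<lambda>z. F z x) field_differentiable at z0"
  shows "(\<lambda>z. coeff (linprod (map (F z) xs)) k) field_differentiable at z0"
  using assms
proof (induction xs arbitrary: k)
  case (Cons x xs)
  have IH: "(\<lambda>z. coeff (linprod (map (F z) xs)) k) field_differentiable at z0" for k
    by (rule Cons.IH) (use Cons.prems in simp)
  have "(\<lambda>z. (if k = 0 then 0 else coeff (linprod (map (F z) xs)) (k - 1)) -
      F z x * coeff (linprod (map (F z) xs)) k) field_differentiable at z0"
  proof (intro field_differentiable_diff field_differentiable_mult IH Cons.prems)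
    show "(\<lambda>z. if k = 0 then 0 else coeff (linprod (map (F z) xs)) (k - 1)) field_differentiable at z0"
      by (cases "k = 0") (simp_all add: IH)
  qed simp
  then show ?case by (simp only: list.map linprod_simps coeff_linear_mult)
qed simp

definition nodes_germ :: "nat \<Rightarrow> (cvec \<Rightarrow> cvec) \<Rightarrow> cvec \<Rightarrow> bool" where
  "nodes_germ r f p \<longleftrightarrow> (\<exists>e>0. \<forall>\<nu>\<in>polydisc {..<2 * r} p e. nodes r \<nu> (f \<nu>))"

lemma nodes_germ_at: "nodes_germ r f p \<Longrightarrow> p \<in> cspace {..<2 * r} \<Longrightarrow> nodes r p (f p)"
  unfolding nodes_germ_def using centre_in_polydisc by blast

lemma nodes_germ_same_germ:
  assumes "same_germ {..<2 * r} p f g" "nodes_germ r f p"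
  shows "nodes_germ r g p"
proof -
  obtain V where V: "openin (top_of_set (cspace {..<2 * r})) V" "p \<in> V" "\<forall>q\<in>V. f q = g q"
    using assms(1) unfolding same_germ_def by blast
  obtain e where e: "e > 0" "polydisc {..<2 * r} p e \<subseteq> V"
    using openin_contains_polydisc[OF _ V(1,2)] by auto
  obtain e' where e': "e' > 0" "\<forall>\<nu>\<in>polydisc {..<2 * r} p e'. nodes r \<nu> (f \<nu>)"
    using assms(2) unfolding nodes_germ_def by blast
  have "nodes r \<nu> (g \<nu>)" if "\<nu> \<in> polydisc {..<2 * r} p (min e e')" for \<nu>
  proof -
    have "\<nu> \<in> V" "\<nu> \<in> polydisc {..<2 * r} p e'"
      using that e(2) polydisc_mono[of "min e e'" e "{..<2 * r}" p]
        polydisc_mono[of "min e e'" e' "{..<2 * r}" p] by auto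
    then show ?thesis using V(3) e'(2) by force
  qed
  then show ?thesis unfolding nodes_germ_def using e(1) e'(1) by (intro exI[of _ "min e e'"]) simp
qed

lemma same_germ_sym: "same_germ I p f g \<Longrightarrow> same_germ I p g f"
  unfolding same_germ_def by (metis (no_types))

text \<open>The sums of the recurrence are holomorphic functions on the domain of \<open>f\<close>, so they vanish on a polydisc if they
vanish near one of its points.\<close>

lemma nodes_germ_spreads:
  fixes r :: nat
  defines "I \<equiv> {..<2 * r}"
  assumes hol: "holomorphic_map I {1..r} N f" and P: "polydisc I c e \<subseteq> N"
    and b: "b \<in> polydisc I c e" "nodes_germ r f b" and q: "q \<in> polydisc I c e"
  shows "nodes r q (f q)"
  unfolding nodes_def
proof (intro conjI allI impI)
  show "f q \<in> cspace {1..r}" using hol P q unfolding holomorphic_map_def by blast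
  fix i assume i: "i < r"
  obtain d where d: "d > 0" "\<forall>\<nu>\<in>polydisc I b d. nodes r \<nu> (f \<nu>)"
    using b(2) unfolding nodes_germ_def I_def by blast
  show "(\<Sum>k\<le>r. coeff (npoly r (f q)) k * q (k + i)) = 0"
  proof (rule identity_polydisc[of I c e "\<lambda>q. \<Sum>k\<le>r. coeff (npoly r (f q)) k * q (k + i)" b d q])
    fix p l assume p: "p \<in> polydisc I c e" and l: "l \<in> I"
    have "(\<lambda>z. f (p(l := z)) j) field_differentiable at (p l)" if "j \<in> {1..r}" for j
      using hol p l P that unfolding holomorphic_map_def by blast
    then show "(\<lambda>z. \<Sum>k\<le>r. coeff (npoly r (f (p(l := z)))) k * (p(l := z)) (k + i)) field_differentiable at (p l)"
      unfolding npoly_linprod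
      by (intro field_differentiable_sum field_differentiable_mult differentiable_coeff_linprod
          differentiable_line_coordinate) simp
  qed (use d b q i in \<open>simp_all add: I_def nodes_def\<close>)
qed

text \<open>The set of parameters at which the germ satisfies the recurrence is open, and by the preceding lemma so is its
complement.\<close>

lemma continuation_nodes_germ:
  fixes r :: nat
  defines "I \<equiv> {..<2 * r}"
  assumes cont: "continuous_on {0..<1} \<gamma>" and sub: "\<gamma> ` {0..<1} \<subseteq> cspace I"
    and ca: "continues_along I {1..r} f \<gamma> \<Phi>" and f: "nodes_germ r f (\<gamma> 0)" and t: "t \<in> {0..<1}"
  shows "nodes_germ r (\<Phi> t) (\<gamma> t)"
proof -
  have loc: "\<forall>t\<in>{0..<1}. \<forall>\<^sub>F s in at t within {0..<1}. nodes_germ r (\<Phi> t) (\<gamma> t) = nodes_germ r (\<Phi> s) (\<gamma> s)"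
  proof
    fix t :: real assume t: "t \<in> {0..<1}"
    obtain N where N: "holomorphic_map I {1..r} N (\<Phi> t)" "\<gamma> t \<in> N"
      "\<forall>\<^sub>F s in at t within {0..<1}. \<gamma> s \<in> N \<and> same_germ I (\<gamma> s) (\<Phi> s) (\<Phi> t)"
      using ca t unfolding continues_along_def by blast
    have "openin (top_of_set (cspace I)) N" using N(1) by (simp add: holomorphic_map_def)
    then obtain e where e: "e > 0" "polydisc I (\<gamma> t) e \<subseteq> N"
      using openin_contains_polydisc[of I N "\<gamma> t"] N(2) by (auto simp: I_def)
    have ev: "\<forall>\<^sub>F s in at t within {0..<1}. \<gamma> s \<in> polydisc I (\<gamma> t) d" if "d > 0" for d
      by (rule eventually_path_in_openin[OF cont sub openin_polydisc t])
         (use that t sub in \<open>auto simp: I_def intro!: centre_in_polydisc\<close>)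
    show "\<forall>\<^sub>F s in at t within {0..<1}. nodes_germ r (\<Phi> t) (\<gamma> t) = nodes_germ r (\<Phi> s) (\<gamma> s)"
    proof (cases "nodes_germ r (\<Phi> t) (\<gamma> t)")
      case True
      then obtain d where d: "d > 0" "\<forall>\<nu>\<in>polydisc I (\<gamma> t) d. nodes r \<nu> (\<Phi> t \<nu>)"
        unfolding nodes_germ_def I_def by blast
      from ev[OF d(1)] N(3) show ?thesis
      proof eventually_elim
        case (elim s)
        obtain d' where "d' > 0" "polydisc I (\<gamma> s) d' \<subseteq> polydisc I (\<gamma> t) d"
          using polydisc_nested[of "\<gamma> s" I "\<gamma> t" d] elim(1) by (auto simp: I_def)
        then have "nodes_germ r (\<Phi> t) (\<gamma> s)" using d(2) unfolding nodes_germ_def I_def by blast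
        then have "nodes_germ r (\<Phi> s) (\<gamma> s)"
          using elim(2) same_germ_sym nodes_germ_same_germ unfolding I_def by blast
        with True show ?case by simp
      qed
    next
      case False
      from ev[OF e(1)] N(3) show ?thesis
      proof eventually_elim
        case (elim s)
        have "\<not> nodes_germ r (\<Phi> s) (\<gamma> s)"
        proof
          assume "nodes_germ r (\<Phi> s) (\<gamma> s)"
          then have *: "nodes_germ r (\<Phi> t) (\<gamma> s)"
            using elim(2) nodes_germ_same_germ unfolding I_def by blast
          have "nodes r \<nu> (\<Phi> t \<nu>)" if "\<nu> \<in> polydisc I (\<gamma> t) e" for \<nu>
            using nodes_germ_spreads[of r N "\<Phi> t" "\<gamma> t" e "\<gamma> s" \<nu>] N(1) e(2) elim(1) * that
            unfolding I_def by blast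
          then have "nodes_germ r (\<Phi> t) (\<gamma> t)" unfolding nodes_germ_def I_def using e(1) by blast
          with False show False by contradiction
        qed
        with False show ?case by simp
      qed
    qed
  qed
  have "same_germ I (\<gamma> 0) (\<Phi> 0) f" using ca by (simp add: continues_along_def)
  then have "nodes_germ r (\<Phi> 0) (\<gamma> 0)" using f same_germ_sym nodes_germ_same_germ unfolding I_def by blast
  moreover have "nodes_germ r (\<Phi> 0) (\<gamma> 0) = nodes_germ r (\<Phi> t) (\<gamma> t)"
    by (rule connected_local_const[OF _ _ t loc]) (simp_all add: convex_connected)
  ultimately show ?thesis by simp
qed

lemma same_germ_at: "same_germ I p f g \<Longrightarrow> f p = g p"
  by (auto simp: same_germ_def)

lemma continuation_continuous:
  assumes cont: "continuous_on {0..<1} \<gamma>" and ca: "continues_along I J f \<gamma> \<Phi>"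
  shows "continuous_on {0..<1} (\<lambda>t. \<Phi> t (\<gamma> t))"
  unfolding continuous_on_def
proof
  fix t :: real assume t: "t \<in> {0..<1}"
  obtain N where N: "holomorphic_map I J N (\<Phi> t)" "\<gamma> t \<in> N"
    "\<forall>\<^sub>F s in at t within {0..<1}. \<gamma> s \<in> N \<and> same_germ I (\<gamma> s) (\<Phi> s) (\<Phi> t)"
    using ca t unfolding continues_along_def by blast
  have cN: "continuous_on N (\<Phi> t)" using N(1) by (simp add: holomorphic_map_def)
  have c\<gamma>: "(\<gamma> \<longlongrightarrow> \<gamma> t) (at t within {0..<1})" using cont t by (simp add: continuous_on_def)
  have evN: "\<forall>\<^sub>F s in at t within {0..<1}. \<gamma> s \<in> N" using N(3) by eventually_elim blast
  have "((\<lambda>s. \<Phi> t (\<gamma> s)) \<longlongrightarrow> \<Phi> t (\<gamma> t)) (at t within {0..<1})"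
    by (rule continuous_on_tendsto_compose[OF cN c\<gamma> N(2) evN])
  moreover have "\<forall>\<^sub>F s in at t within {0..<1}. \<Phi> t (\<gamma> s) = \<Phi> s (\<gamma> s)"
    using N(3)
  proof eventually_elim
    case (elim s)
    from same_germ_at[OF conjunct2[OF elim]] show ?case by (rule sym)
  qed
  ultimately show "((\<lambda>s. \<Phi> s (\<gamma> s)) \<longlongrightarrow> \<Phi> t (\<gamma> t)) (at t within {0..<1})"
    by (rule Lim_transform_eventually)
qed

text \<open>The discs around the points of \<open>S\<close> are disjoint and open and cover the values, so membership in one of them
is a locally constant property of the parameter.\<close>

lemma cluster_persists:
  fixes h :: "real \<Rightarrow> complex"
  assumes cont: "continuous_on A h" and A: "connected A"
    and sep: "\<And>\<sigma> \<tau>. \<sigma> \<in> S \<Longrightarrow> \<tau> \<in> S \<Longrightarrow> \<sigma> \<noteq> \<tau> \<Longrightarrow> 2 * \<rho> \<le> dist \<sigma> \<tau>"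
    and near: "\<And>t. t \<in> A \<Longrightarrow> \<exists>\<tau>\<in>S. dist (h t) \<tau> < \<rho>"
    and \<tau>: "\<tau> \<in> S" "dist (h a) \<tau> < \<rho>" and ab: "a \<in> A" "b \<in> A"
  shows "dist (h b) \<tau> < \<rho>"
proof -
  have ev: "\<forall>\<^sub>F s in at t within A. dist (h s) \<sigma> < \<rho>" if "t \<in> A" "dist (h t) \<sigma> < \<rho>" for t \<sigma>
  proof -
    have "(h \<longlongrightarrow> h t) (at t within A)" using cont that(1) by (simp add: continuous_on_def)
    then have "((\<lambda>s. dist (h s) \<sigma>) \<longlongrightarrow> dist (h t) \<sigma>) (at t within A)" by (intro tendsto_intros)
    from order_tendstoD(2)[OF this that(2)] show ?thesis .
  qed
  have "\<forall>t\<in>A. \<forall>\<^sub>F s in at t within A. (dist (h t) \<tau> < \<rho>) = (dist (h s) \<tau> < \<rho>)"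
  proof
    fix t assume t: "t \<in> A"
    obtain \<sigma> where \<sigma>: "\<sigma> \<in> S" "dist (h t) \<sigma> < \<rho>" using near[OF t] by blast
    have excl: "\<not> dist x \<tau> < \<rho>" if "\<sigma> \<noteq> \<tau>" "dist x \<sigma> < \<rho>" for x
      using sep[OF \<sigma>(1) \<tau>(1) that(1)] dist_triangle3[of \<sigma> \<tau> x] that(2) by (simp add: dist_commute)
    from ev[OF t \<sigma>(2)] show "\<forall>\<^sub>F s in at t within A. (dist (h t) \<tau> < \<rho>) = (dist (h s) \<tau> < \<rho>)"
    proof eventually_elim
      case (elim s)
      show ?case
      proof (cases "\<sigma> = \<tau>")
        case True
        then show ?thesis using elim \<sigma>(2) by simp
      next
        case False
        then show ?thesis using excl[OF False elim] excl[OF False \<sigma>(2)] by simp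
      qed
    qed
  qed
  from connected_local_const[OF A ab this] \<tau>(2) show ?thesis by simp
qed

section \<open>Composing analytic continuations\<close>

lemma tendsto_coordinatewise_iff:
  fixes f :: "'a \<Rightarrow> cvec"
  shows "(f \<longlongrightarrow> l) F \<longleftrightarrow> (\<forall>i. ((\<lambda>x. f x i) \<longlongrightarrow> l i) F)"
proof -
  have "(f \<longlongrightarrow> l) F \<longleftrightarrow> limitin (product_topology (\<lambda>i. euclidean) UNIV) f l F"
    by (simp only: euclidean_product_topology limitin_canonical_iff)
  also have "\<dots> \<longleftrightarrow> (\<forall>i. ((\<lambda>x. f x i) \<longlongrightarrow> l i) F)"
    unfolding limitin_componentwise by simp
  finally show ?thesis .
qed

lemma same_germ_refl: "openin (top_of_set (cspace I)) N \<Longrightarrow> p \<in> N \<Longrightarrow> same_germ I p f f"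
  by (auto simp: same_germ_def)

lemma same_germ_trans:
  assumes "same_germ I p f g" "same_germ I p g h"
  shows "same_germ I p f h"
proof -
  obtain V V' where "openin (top_of_set (cspace I)) V" "p \<in> V" "\<forall>q\<in>V. f q = g q"
    "openin (top_of_set (cspace I)) V'" "p \<in> V'" "\<forall>q\<in>V'. g q = h q"
    using assms unfolding same_germ_def by blast
  then show ?thesis unfolding same_germ_def
    by (intro exI[of _ "V \<inter> V'"]) (simp add: openin_Int)
qed

text \<open>The local condition in an analytic continuation along \<open>\<gamma>\<close>, for an arbitrary set of parameters. Unlike
\<open>continues_along\<close>, it is available on the closed unit interval, as the concatenation of continuations requires.\<close>

definition germ_family :: "nat set \<Rightarrow> nat set \<Rightarrow> real set \<Rightarrow> (real \<Rightarrow> cvec) \<Rightarrow> (real \<Rightarrow> cvec \<Rightarrow> cvec) \<Rightarrow> bool" where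
  "germ_family I J A \<gamma> \<Phi> \<longleftrightarrow> (\<forall>t\<in>A. \<exists>N. holomorphic_map I J N (\<Phi> t) \<and> \<gamma> t \<in> N \<and>
     (\<exists>d>0. \<forall>s\<in>A. dist s t < d \<longrightarrow> \<gamma> s \<in> N \<and> same_germ I (\<gamma> s) (\<Phi> s) (\<Phi> t)))"

lemma continues_along_iff:
  "continues_along I J f \<gamma> \<Phi> \<longleftrightarrow> same_germ I (\<gamma> 0) (\<Phi> 0) f \<and> germ_family I J {0..<1} \<gamma> \<Phi>"
proof -
  have *: "(\<forall>\<^sub>F s in at t within {0..<1}. \<gamma> s \<in> N \<and> same_germ I (\<gamma> s) (\<Phi> s) (\<Phi> t)) \<longleftrightarrow>
    (\<exists>d>0. \<forall>s\<in>{0..<1}. dist s t < d \<longrightarrow> \<gamma> s \<in> N \<and> same_germ I (\<gamma> s) (\<Phi> s) (\<Phi> t))"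
    if N: "holomorphic_map I J N (\<Phi> t)" "\<gamma> t \<in> N" for t :: real and N
  proof -
    have "openin (top_of_set (cspace I)) N" using N(1) unfolding holomorphic_map_def by (rule conjunct1)
    then have t: "\<gamma> t \<in> N \<and> same_germ I (\<gamma> t) (\<Phi> t) (\<Phi> t)" using N(2) same_germ_refl by blast
    show ?thesis unfolding eventually_at
    proof (intro ex_cong1 conj_cong ball_cong refl)
      fix d s show "(s \<noteq> t \<and> dist s t < d \<longrightarrow> \<gamma> s \<in> N \<and> same_germ I (\<gamma> s) (\<Phi> s) (\<Phi> t)) =
        (dist s t < d \<longrightarrow> \<gamma> s \<in> N \<and> same_germ I (\<gamma> s) (\<Phi> s) (\<Phi> t))"
        using t by (cases "s = t") simp_all
    qed
  qed
  show ?thesis unfolding continues_along_def germ_family_def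
    by (intro arg_cong2[of _ _ _ _ "(\<and>)"] ball_cong ex_cong1 conj_cong refl) (rule *)
qed

lemma germ_family_reparam:
  assumes g: "germ_family I J A \<gamma> \<Phi>" and h: "\<And>s. s \<in> B \<Longrightarrow> h s \<in> A"
    and lip: "\<And>s t. s \<in> B \<Longrightarrow> t \<in> B \<Longrightarrow> dist (h s) (h t) \<le> K * dist s t" and K: "0 < K"
  shows "germ_family I J B (\<lambda>t. \<gamma> (h t)) (\<lambda>t. \<Phi> (h t))"
  unfolding germ_family_def
proof
  fix t assume t: "t \<in> B"
  obtain N d where N: "holomorphic_map I J N (\<Phi> (h t))" "\<gamma> (h t) \<in> N" "d > 0"
    "\<forall>s\<in>A. dist s (h t) < d \<longrightarrow> \<gamma> s \<in> N \<and> same_germ I (\<gamma> s) (\<Phi> s) (\<Phi> (h t))"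
    using bspec[OF g[unfolded germ_family_def] h[OF t]] by blast
  have "\<gamma> (h s) \<in> N \<and> same_germ I (\<gamma> (h s)) (\<Phi> (h s)) (\<Phi> (h t))" if s: "s \<in> B" "dist s t < d / K" for s
  proof -
    have "dist (h s) (h t) \<le> K * dist s t" by (rule lip[OF s(1) t])
    also have "\<dots> < d" using s(2) K by (simp add: field_simps)
    finally show ?thesis using N(4) h[OF s(1)] by blast
  qed
  then show "\<exists>N. holomorphic_map I J N (\<Phi> (h t)) \<and> \<gamma> (h t) \<in> N \<and>
    (\<exists>d>0. \<forall>s\<in>B. dist s t < d \<longrightarrow> \<gamma> (h s) \<in> N \<and> same_germ I (\<gamma> (h s)) (\<Phi> (h s)) (\<Phi> (h t)))"
    using N(1-3) K by (intro exI[of _ N] conjI exI[of _ "d / K"]) simp_all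
qed

text \<open>In contrast to \<open>continuation_values\<close>, the end point carries a germ, so that a further continuation can be appended.\<close>

definition reaches :: "nat set \<Rightarrow> nat set \<Rightarrow> cvec set \<Rightarrow> cvec \<Rightarrow> (cvec \<Rightarrow> cvec) \<Rightarrow> cvec \<Rightarrow> (cvec \<Rightarrow> cvec) \<Rightarrow> bool" where
  "reaches I J U p f q g \<longleftrightarrow> (\<exists>\<gamma> \<Phi>. path \<gamma> \<and> path_image \<gamma> \<subseteq> U \<and> pathstart \<gamma> = p \<and> pathfinish \<gamma> = q \<and>
     same_germ I p (\<Phi> 0) f \<and> same_germ I q (\<Phi> 1) g \<and> germ_family I J {0..1} \<gamma> \<Phi>)"

lemma reaches_truncate:
  assumes \<gamma>: "path \<gamma>" "path_image \<gamma> \<subseteq> U" and ca: "continues_along I J f \<gamma> \<Phi>" and T: "T \<in> {0..<1}"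
  shows "reaches I J U (\<gamma> 0) f (\<gamma> T) (\<Phi> T)"
  unfolding reaches_def
proof (intro exI[of _ "\<lambda>t. \<gamma> (T * t)"] exI[of _ "\<lambda>t. \<Phi> (T * t)"] conjI)
  have T01: "T * t \<in> {0..1}" if "t \<in> {0..1}" for t
    using T that mult_le_one[of T t] by simp
  have im: "(*) T ` {0..1} \<subseteq> {0..1}" using T01 by (rule image_subsetI)
  have cT: "continuous_on {0..1} ((*) T)" by (intro continuous_intros)
  show "path (\<lambda>t. \<gamma> (T * t))"
    unfolding path_def by (rule continuous_on_compose2[OF \<gamma>(1)[unfolded path_def] cT im])
  show "path_image (\<lambda>t. \<gamma> (T * t)) \<subseteq> U"
    unfolding path_image_def
  proof (rule image_subsetI)
    fix t :: real assume "t \<in> {0..1}"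
    from imageI[OF T01[OF this], of \<gamma>] show "\<gamma> (T * t) \<in> U"
      using \<gamma>(2) unfolding path_image_def by (rule rev_subsetD)
  qed
  show "pathstart (\<lambda>t. \<gamma> (T * t)) = \<gamma> 0" "pathfinish (\<lambda>t. \<gamma> (T * t)) = \<gamma> T"
    by (simp_all add: pathstart_def pathfinish_def)
  show "same_germ I (\<gamma> 0) (\<Phi> (T * 0)) f" using ca by (simp add: continues_along_def)
  have fam: "germ_family I J {0..<1} \<gamma> \<Phi>" using ca by (simp add: continues_along_iff)
  then obtain N where N: "holomorphic_map I J N (\<Phi> T)" "\<gamma> T \<in> N" using T unfolding germ_family_def by blast
  have "openin (top_of_set (cspace I)) N" using N(1) unfolding holomorphic_map_def by (rule conjunct1)
  from same_germ_refl[OF this N(2)] show "same_germ I (\<gamma> T) (\<Phi> (T * 1)) (\<Phi> T)"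
    unfolding mult_1_right .
  show "germ_family I J {0..1} (\<lambda>t. \<gamma> (T * t)) (\<lambda>t. \<Phi> (T * t))"
  proof (rule germ_family_reparam[OF fam, of _ _ 1])
    show "T * s \<in> {0..<1}" if "s \<in> {0..1}" for s
    proof -
      have "T * s \<le> T * 1" using T that by (intro mult_left_mono) auto
      then show ?thesis using T that by auto
    qed
    show "dist (T * s) (T * t) \<le> 1 * dist s t" for s t
    proof -
      have "dist (T * s) (T * t) = T * dist s t"
        using T unfolding dist_real_def right_diff_distrib[symmetric] abs_mult by simp
      also have "\<dots> \<le> 1 * dist s t" using T by (intro mult_right_mono) auto
      finally show ?thesis .
    qed
  qed simp
qed

text \<open>The constant family \<open>f\<close> is a continuation along the segment from \<open>p\<close> to \<open>q\<close>.\<close>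

lemma reaches_constant:
  assumes I: "finite I" and hol: "holomorphic_map I J N f" and P: "polydisc I c e \<subseteq> N" "polydisc I c e \<subseteq> U"
    and p: "p \<in> polydisc I c e" and q: "q \<in> polydisc I c e"
  shows "reaches I J U p f q f"
  unfolding reaches_def
proof (intro exI[of _ "\<lambda>t. segment_point I p q (complex_of_real t)"] exI[of _ "\<lambda>_. f"] conjI)
  have pq: "p \<in> cspace I" "q \<in> cspace I" using p q by (simp_all add: mem_polydisc)
  have seg: "segment_point I p q (complex_of_real t) \<in> polydisc I c e" if t: "t \<in> {0..1}" for t
  proof -
    have 01: "0 \<in> {z. segment_point I p q z \<in> polydisc I c e}" "1 \<in> {z. segment_point I p q z \<in> polydisc I c e}"
      using p q pq by (simp_all add: segment_point_simps)
    have "(1 - t) *\<^sub>R 0 + t *\<^sub>R 1 \<in> {z. segment_point I p q z \<in> polydisc I c e}"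
      by (rule convexD[OF segment_domain(2)[OF I] 01]) (use t in auto)
    then show ?thesis by (simp add: scaleR_conv_of_real)
  qed
  show "path (\<lambda>t. segment_point I p q (complex_of_real t))"
    unfolding path_def
    by (rule continuous_on_compose2[OF continuous_segment_point continuous_on_of_real[OF continuous_on_id] subset_UNIV])
  show "path_image (\<lambda>t. segment_point I p q (complex_of_real t)) \<subseteq> U"
    unfolding path_image_def by (rule image_subsetI) (use seg P(2) in blast)
  show "pathstart (\<lambda>t. segment_point I p q (complex_of_real t)) = p"
    "pathfinish (\<lambda>t. segment_point I p q (complex_of_real t)) = q"
    using pq by (simp_all add: pathstart_def pathfinish_def segment_point_simps)
  have N: "openin (top_of_set (cspace I)) N" using hol by (simp add: holomorphic_map_def)
  show "same_germ I p f f" "same_germ I q f f" using same_germ_refl[OF N] P(1) p q by blast+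
  show "germ_family I J {0..1} (\<lambda>t. segment_point I p q (complex_of_real t)) (\<lambda>_. f)"
    unfolding germ_family_def
  proof
    have segN: "segment_point I p q (complex_of_real t) \<in> N" if "t \<in> {0..1}" for t
      using seg[OF that] P(1) by blast
    fix t :: real assume t: "t \<in> {0..1}"
    show "\<exists>N. holomorphic_map I J N f \<and> segment_point I p q (complex_of_real t) \<in> N \<and>
      (\<exists>d>0. \<forall>s\<in>{0..1}. dist s t < d \<longrightarrow> segment_point I p q (complex_of_real s) \<in> N \<and>
        same_germ I (segment_point I p q (complex_of_real s)) f f)"
      using hol segN[OF t] segN same_germ_refl[OF N segN]
      by (intro exI[of _ N] conjI exI[of _ "1 :: real"] ballI impI) simp_all
  qed
qed

text \<open>Concatenation of continuations. The only delicate parameter is \<open>1 / 2\<close>, where the final germ of the first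
family and the initial germ of the second one agree near \<open>q\<close>.\<close>

lemma reaches_continuation_values:
  assumes U: "U \<subseteq> cspace I" and re: "reaches I J U p f q g" and w: "w \<in> continuation_values I J U q g \<nu>"
  shows "w \<in> continuation_values I J U p f \<nu>"
proof -
  obtain \<gamma>1 \<Phi>1 where g1: "path \<gamma>1" "path_image \<gamma>1 \<subseteq> U" "pathstart \<gamma>1 = p" "pathfinish \<gamma>1 = q"
    "same_germ I p (\<Phi>1 0) f" "same_germ I q (\<Phi>1 1) g" and fam1: "germ_family I J {0..1} \<gamma>1 \<Phi>1"
    using re unfolding reaches_def by blast
  obtain \<gamma>2 \<Phi>2 where wJ: "w \<in> cspace J" and g2: "path \<gamma>2" "path_image \<gamma>2 \<subseteq> U" "pathstart \<gamma>2 = q" "pathfinish \<gamma>2 = \<nu>"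
    and ca: "continues_along I J g \<gamma>2 \<Phi>2" and lim: "((\<lambda>t. \<Phi>2 t (\<gamma>2 t)) \<longlongrightarrow> w) (at_left 1)"
    using w unfolding continuation_values_def by blast
  have q12: "\<gamma>1 1 = q" "\<gamma>2 0 = q" using g1(4) g2(3) by (simp_all add: pathfinish_def pathstart_def)
  have fam2: "germ_family I J {0..<1} \<gamma>2 \<Phi>2" and g20: "same_germ I q (\<Phi>2 0) g"
    using ca q12 by (simp_all add: continues_along_iff)
  define \<gamma> where "\<gamma> = \<gamma>1 +++ \<gamma>2"
  define \<Phi> where "\<Phi> t = (if t \<le> 1 / 2 then \<Phi>1 (2 * t) else \<Phi>2 (2 * t - 1))" for t :: real
  have \<gamma>: "\<gamma> t = (if t \<le> 1 / 2 then \<gamma>1 (2 * t) else \<gamma>2 (2 * t - 1))" for t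
    by (simp add: \<gamma>_def joinpaths_def)
  have fam: "germ_family I J {0..<1} \<gamma> \<Phi>"
    unfolding germ_family_def
  proof
    fix t :: real assume t: "t \<in> {0..<1}"
    consider "t < 1 / 2" | "t = 1 / 2" | "t > 1 / 2" by linarith
    then show "\<exists>N. holomorphic_map I J N (\<Phi> t) \<and> \<gamma> t \<in> N \<and>
      (\<exists>d>0. \<forall>s\<in>{0..<1}. dist s t < d \<longrightarrow> \<gamma> s \<in> N \<and> same_germ I (\<gamma> s) (\<Phi> s) (\<Phi> t))"
    proof cases
      case 1
      then have "2 * t \<in> {0..1}" using t by simp
      from bspec[OF fam1[unfolded germ_family_def] this] obtain N d where N: "holomorphic_map I J N (\<Phi>1 (2 * t))"
        "\<gamma>1 (2 * t) \<in> N" "d > 0" "\<forall>s\<in>{0..1}. dist s (2 * t) < d \<longrightarrow> \<gamma>1 s \<in> N \<and> same_germ I (\<gamma>1 s) (\<Phi>1 s) (\<Phi>1 (2 * t))"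
        by blast
      have "\<gamma> s \<in> N \<and> same_germ I (\<gamma> s) (\<Phi> s) (\<Phi> t)" if s: "s \<in> {0..<1}" "dist s t < min (d / 2) (1 / 2 - t)" for s
      proof -
        have "dist (2 * s) (2 * t) = 2 * dist s t"
          by (simp add: dist_real_def abs_if)
        then have "s < 1 / 2" "dist (2 * s) (2 * t) < d" using s(2) by (auto simp: dist_real_def)
        then show ?thesis using N(4) s(1) 1 by (simp add: \<gamma> \<Phi>_def)
      qed
      then show ?thesis
        using N(1-3) 1 by (intro exI[of _ N] conjI exI[of _ "min (d / 2) (1 / 2 - t)"]) (simp_all add: \<gamma> \<Phi>_def)
    next
      case 3
      then have "2 * t - 1 \<in> {0..<1}" using t by simp
      from bspec[OF fam2[unfolded germ_family_def] this] obtain N d where N: "holomorphic_map I J N (\<Phi>2 (2 * t - 1))"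
        "\<gamma>2 (2 * t - 1) \<in> N" "d > 0"
        "\<forall>s\<in>{0..<1}. dist s (2 * t - 1) < d \<longrightarrow> \<gamma>2 s \<in> N \<and> same_germ I (\<gamma>2 s) (\<Phi>2 s) (\<Phi>2 (2 * t - 1))"
        by blast
      have "\<gamma> s \<in> N \<and> same_germ I (\<gamma> s) (\<Phi> s) (\<Phi> t)" if s: "s \<in> {0..<1}" "dist s t < min (d / 2) (t - 1 / 2)" for s
      proof -
        have "dist (2 * s - 1) (2 * t - 1) = 2 * dist s t"
          by (simp add: dist_real_def abs_if)
        then have "s > 1 / 2" "dist (2 * s - 1) (2 * t - 1) < d" using s(2) by (auto simp: dist_real_def)
        then show ?thesis using N(4) s(1) 3 by (simp add: \<gamma> \<Phi>_def)
      qed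
      then show ?thesis
        using N(1-3) 3 by (intro exI[of _ N] conjI exI[of _ "min (d / 2) (t - 1 / 2)"]) (simp_all add: \<gamma> \<Phi>_def)
    next
      case 2
      have "(1 :: real) \<in> {0..1}" by simp
      from bspec[OF fam1[unfolded germ_family_def] this] obtain N1 d1 where N1: "holomorphic_map I J N1 (\<Phi>1 1)"
        "\<gamma>1 1 \<in> N1" "d1 > 0" "\<forall>s\<in>{0..1}. dist s 1 < d1 \<longrightarrow> \<gamma>1 s \<in> N1 \<and> same_germ I (\<gamma>1 s) (\<Phi>1 s) (\<Phi>1 1)"
        by blast
      have "(0 :: real) \<in> {0..<1}" by simp
      from bspec[OF fam2[unfolded germ_family_def] this] obtain N2 d2 where N2: "d2 > 0"
        "\<forall>s\<in>{0..<1}. dist s 0 < d2 \<longrightarrow> \<gamma>2 s \<in> N2 \<and> same_germ I (\<gamma>2 s) (\<Phi>2 s) (\<Phi>2 0)"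
        by blast
      have "same_germ I q (\<Phi>2 0) (\<Phi>1 1)"
        using same_germ_trans[OF g20 same_germ_sym[OF g1(6)]] .
      then obtain V where V: "openin (top_of_set (cspace I)) V" "q \<in> V" "\<forall>x\<in>V. \<Phi>2 0 x = \<Phi>1 1 x"
        unfolding same_germ_def by blast
      have VN: "openin (top_of_set (cspace I)) (V \<inter> N1)"
        using V(1) N1(1) by (simp add: holomorphic_map_def openin_Int)
      have "\<forall>\<^sub>F s in at 0 within {0..1}. \<gamma>2 s \<in> V \<inter> N1"
      proof (rule eventually_path_in_openin[OF g2(1)[unfolded path_def] _ VN])
        show "\<gamma>2 ` {0..1} \<subseteq> cspace I" using g2(2) U unfolding path_image_def by (rule subset_trans)
        show "\<gamma>2 0 \<in> V \<inter> N1" using V(2) N1(2) by (simp add: q12)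
      qed simp
      then obtain d3 where d3: "d3 > 0" "\<forall>s\<in>{0..1}. s \<noteq> 0 \<and> dist s 0 < d3 \<longrightarrow> \<gamma>2 s \<in> V \<inter> N1"
        unfolding eventually_at by blast
      define d where "d = min (d1 / 2) (min (d2 / 2) (d3 / 2))"
      have t\<Phi>: "\<Phi> t = \<Phi>1 1" "\<gamma> t = \<gamma>1 1" unfolding 2 \<gamma> \<Phi>_def by simp_all
      have "\<gamma> s \<in> N1 \<and> same_germ I (\<gamma> s) (\<Phi> s) (\<Phi>1 1)" if s: "s \<in> {0..<1}" "dist s t < d" for s
      proof (cases "s \<le> 1 / 2")
        case True
        then have "2 * s \<in> {0..1}" "dist (2 * s) 1 < d1" using s 2 by (auto simp: dist_real_def d_def)
        then show ?thesis using N1(4) True by (simp add: \<gamma> \<Phi>_def)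
      next
        case False
        define u where "u = 2 * s - 1"
        have u: "u \<in> {0..<1}" "u \<noteq> 0" "dist u 0 < d2" "dist u 0 < d3"
          using False s 2 by (auto simp: u_def dist_real_def d_def)
        have \<gamma>u: "\<gamma>2 u \<in> V \<inter> N1" using d3(2) u by simp
        have "same_germ I (\<gamma>2 u) (\<Phi>2 u) (\<Phi>2 0)" using N2(2) u by blast
        moreover have "same_germ I (\<gamma>2 u) (\<Phi>2 0) (\<Phi>1 1)"
          unfolding same_germ_def using V(1,3) \<gamma>u by blast
        ultimately have "same_germ I (\<gamma>2 u) (\<Phi>2 u) (\<Phi>1 1)" by (rule same_germ_trans)
        then show ?thesis using False \<gamma>u by (simp add: \<gamma> \<Phi>_def u_def)
      qed
      moreover have "d > 0" using N1(3) N2(1) d3(1) by (simp add: d_def)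
      ultimately show ?thesis
        unfolding t\<Phi> using N1(1,2) by (intro exI[of _ N1] conjI exI[of _ d] ballI impI) simp_all
    qed
  qed
  show ?thesis
    unfolding continuation_values_def mem_Collect_eq
  proof (intro conjI wJ exI[of _ \<gamma>] exI[of _ \<Phi>])
    show "path \<gamma>" "pathstart \<gamma> = p" "pathfinish \<gamma> = \<nu>"
      using g1(1,3,4) g2(1,3,4) by (simp_all add: \<gamma>_def)
    show "path_image \<gamma> \<subseteq> U"
      unfolding \<gamma>_def using g1(2) g2(2) by (rule subset_path_image_join)
    have "\<gamma> 0 = p" using g1(3) by (simp add: \<gamma> pathstart_def)
    then show "continues_along I J f \<gamma> \<Phi>"
      unfolding continues_along_iff using fam g1(5) by (simp add: \<Phi>_def)
    have "filterlim (\<lambda>t. 2 * t - 1 :: real) (at_left 1) (at_left 1)"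
    proof (rule filterlim_at_withinI)
      show "\<forall>\<^sub>F t in at_left 1. 2 * t - 1 \<in> {..<1 :: real} - {1}"
        unfolding eventually_at_left_field by (intro exI[of _ 0]) auto
      have "((\<lambda>t. 2 * t - 1 :: real) \<longlongrightarrow> 2 * 1 - 1) (at_left 1)" by (intro tendsto_intros)
      then show "filterlim (\<lambda>t. 2 * t - 1 :: real) (nhds 1) (at_left 1)" by simp
    qed
    from filterlim_compose[OF lim this]
    have "((\<lambda>t. \<Phi>2 (2 * t - 1) (\<gamma>2 (2 * t - 1))) \<longlongrightarrow> w) (at_left 1)" .
    moreover have "\<forall>\<^sub>F t in at_left 1. \<Phi>2 (2 * t - 1) (\<gamma>2 (2 * t - 1)) = \<Phi> t (\<gamma> t)"
      unfolding eventually_at_left_field by (intro exI[of _ "1 / 2"]) (simp add: \<gamma> \<Phi>_def)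
    ultimately show "((\<lambda>t. \<Phi> t (\<gamma> t)) \<longlongrightarrow> w) (at_left 1)" by (rule Lim_transform_eventually)
  qed
qed

lemma continuation_values_mono: "U \<subseteq> V \<Longrightarrow> continuation_values I J U p f q \<subseteq> continuation_values I J V p f q"
  unfolding continuation_values_def by blast

text \<open>The germs along a continuation satisfy the recurrence, and so does their limit at the end point because the
recurrence is a closed condition.\<close>

lemma continuation_value_path:
  fixes r :: nat
  defines "I \<equiv> {..<2 * r}"
  assumes U: "U \<subseteq> cspace I" and f: "nodes_germ r f p" and w: "w \<in> continuation_values I {1..r} U p f q"
  shows "\<exists>\<gamma> W. continuous_on {0..1} \<gamma> \<and> \<gamma> ` {0..1} \<subseteq> U \<and> \<gamma> 0 = p \<and> \<gamma> 1 = q \<and> W 0 = f p \<and> W 1 = w \<and>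
    (\<forall>t\<in>{0..1}. nodes r (\<gamma> t) (W t)) \<and> (\<forall>j. continuous_on {0..1 :: real} (\<lambda>t. W t j))"
proof -
  obtain \<gamma> \<Phi> where wJ: "w \<in> cspace {1..r}" and \<gamma>: "path \<gamma>" "path_image \<gamma> \<subseteq> U" "pathstart \<gamma> = p" "pathfinish \<gamma> = q"
    and ca: "continues_along I {1..r} f \<gamma> \<Phi>" and lim: "((\<lambda>t. \<Phi> t (\<gamma> t)) \<longlongrightarrow> w) (at_left 1)"
    using w unfolding continuation_values_def by blast
  have c: "continuous_on {0..1} \<gamma>" and im: "\<gamma> ` {0..1} \<subseteq> U" and \<gamma>01: "\<gamma> 0 = p" "\<gamma> 1 = q"
    using \<gamma> by (simp_all add: path_def path_image_def pathstart_def pathfinish_def)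
  have c': "continuous_on {0..<1} \<gamma>" using c by (rule continuous_on_subset) auto
  have im': "\<gamma> ` {0..<1} \<subseteq> cspace I" using im U by force
  define W where "W t = (if t < 1 then \<Phi> t (\<gamma> t) else w)" for t :: real
  have nd: "nodes r (\<gamma> t) (W t)" if t: "t \<in> {0..<1}" for t
  proof -
    have "nodes_germ r (\<Phi> t) (\<gamma> t)"
      using continuation_nodes_germ[of \<gamma> r f \<Phi> t] c' im' ca f t \<gamma>01 by (simp add: I_def)
    moreover have "\<gamma> t \<in> cspace {..<2 * r}" using im' t by (auto simp: I_def)
    ultimately show ?thesis using t nodes_germ_at by (simp add: W_def)
  qed
  have cW: "continuous_on {0..1} W"
    unfolding continuous_on_def
  proof
    fix t :: real assume t: "t \<in> {0..1}"
    show "(W \<longlongrightarrow> W t) (at t within {0..1})"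
    proof (cases "t < 1")
      case True
      have "continuous_on {0..<1} (\<lambda>t. \<Phi> t (\<gamma> t))" by (rule continuation_continuous[OF c' ca])
      then have "continuous_on {0..<1} W" by (rule continuous_on_eq) (simp add: W_def)
      then have "(W \<longlongrightarrow> W t) (at t within {0..<1})" using t True by (simp add: continuous_on_def)
      moreover have "at t within {0..<1} = at t within {0..1}"
        by (rule at_within_nhd[of _ "{..<1}"]) (use True in auto)
      ultimately show ?thesis by simp
    next
      case False
      then have t1: "t = 1" using t by simp
      have "\<forall>\<^sub>F t in at_left 1. \<Phi> t (\<gamma> t) = W t"
        unfolding eventually_at_left_field by (intro exI[of _ 0]) (simp add: W_def)
      with lim have "(W \<longlongrightarrow> w) (at_left 1)" by (rule Lim_transform_eventually)
      moreover have "at 1 within {0..1} = at_left (1 :: real)" by (rule at_within_Icc_at_left) simp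
      ultimately show ?thesis by (simp add: t1 W_def)
    qed
  qed
  have cWj: "continuous_on {0..1} (\<lambda>t. W t j)" for j
    using cW by (rule continuous_on_product_then_coordinatewise)
  have "nodes r (\<gamma> 1) w"
    unfolding nodes_def
  proof (intro conjI wJ allI impI)
    fix i assume i: "i < r"
    define G where "G t = (\<Sum>k\<le>r. coeff (npoly r (W t)) k * \<gamma> t (k + i))" for t
    have cG: "continuous_on {0..1} G"
      unfolding G_def npoly_linprod
      by (intro continuous_on_sum continuous_on_mult continuous_on_coeff_linprod cWj
          continuous_on_product_then_coordinatewise[OF c])
    have "G 1 = 0"
    proof (rule continuous_constant_on_closure[of "{0..<1 :: real}" G 0 1])
      show "continuous_on (closure {0..<1}) G" using cG by simp
      show "G t = 0" if "t \<in> {0..<1}" for t using nd[OF that] i by (simp add: G_def nodes_def)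
    qed simp
    then show "(\<Sum>k\<le>r. coeff (npoly r w) k * \<gamma> 1 (k + i)) = 0" by (simp add: G_def W_def)
  qed
  then have "nodes r (\<gamma> t) (W t)" if "t \<in> {0..1}" for t
    using nd[of t] that by (cases "t = 1") (simp_all add: W_def)
  moreover have "W 0 = f p"
    using ca same_germ_at[of I "\<gamma> 0" "\<Phi> 0" f] \<gamma>01 by (simp add: continues_along_def W_def)
  moreover have "W 1 = w" by (simp add: W_def)
  ultimately show ?thesis using c im \<gamma>01 cWj by blast
qed

section \<open>Existence of values and their dependence on the moments\<close>

text \<open>By continuity \<open>g\<close> stays within the distance from \<open>w\<close> in which \<open>F\<close> is the only branch.\<close>

lemma branches_agree:
  fixes r :: nat
  defines "I \<equiv> {..<2 * r}"
  assumes g: "\<And>i. i \<in> {1..r} \<Longrightarrow> continuous_on N (\<lambda>\<nu>. g \<nu> i)" and N: "openin (top_of_set (cspace I)) N" "p \<in> N"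
    and ng: "nodes_germ r g p" and p: "p \<in> polydisc I c e"
    and close: "\<And>i. i \<in> {1..r} \<Longrightarrow> dist (g p i) (w i) < \<rho>"
    and uniq: "\<And>\<nu> w'. \<nu> \<in> polydisc I c e \<Longrightarrow> nodes r \<nu> w' \<Longrightarrow> (\<forall>i\<in>{1..r}. dist (w' i) (w i) < \<rho>) \<Longrightarrow> w' = F \<nu>"
  shows "same_germ I p g F"
proof -
  have I: "finite I" by (simp add: I_def)
  obtain d1 where d1: "d1 > 0" "polydisc I p d1 \<subseteq> polydisc I c e" using polydisc_nested[OF p I] by blast
  obtain d2 where d2: "d2 > 0" "\<forall>\<nu>\<in>polydisc I p d2. nodes r \<nu> (g \<nu>)"
    using ng unfolding nodes_germ_def I_def by blast
  have "\<exists>d>0. \<forall>\<nu>\<in>polydisc I p d. \<forall>i\<in>{1..r}. dist (g \<nu> i) (w i) < \<rho>"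
  proof (rule polydisc_finite_conj)
    fix i assume i: "i \<in> {1..r}"
    have "0 < \<rho> - dist (g p i) (w i)" using close[OF i] by simp
    from continuous_on_polydisc_nbhd[OF I N(1) g[OF i] N(2) this]
    obtain d where d: "d > 0" "\<forall>q\<in>polydisc I p d. dist (g q i) (g p i) < \<rho> - dist (g p i) (w i)" by blast
    have "dist (g q i) (w i) < \<rho>" if "q \<in> polydisc I p d" for q
      using bspec[OF d(2) that] dist_triangle[of "g q i" "w i" "g p i"] by simp
    with d(1) show "\<exists>d>0. \<forall>\<nu>\<in>polydisc I p d. dist (g \<nu> i) (w i) < \<rho>" by blast
  qed simp
  then obtain d3 where d3: "d3 > 0" "\<forall>\<nu>\<in>polydisc I p d3. \<forall>i\<in>{1..r}. dist (g \<nu> i) (w i) < \<rho>" by blast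
  define d where "d = min d1 (min d2 d3)"
  have d: "d > 0" "d \<le> d1" "d \<le> d2" "d \<le> d3" using d1(1) d2(1) d3(1) by (simp_all add: d_def)
  have "g \<nu> = F \<nu>" if \<nu>: "\<nu> \<in> polydisc I p d" for \<nu>
  proof (rule uniq)
    show "\<nu> \<in> polydisc I c e" using \<nu> polydisc_mono[OF d(2)] d1(2) by blast
    show "nodes r \<nu> (g \<nu>)" using \<nu> polydisc_mono[OF d(3)] d2(2) by blast
    show "\<forall>i\<in>{1..r}. dist (g \<nu> i) (w i) < \<rho>" using \<nu> polydisc_mono[OF d(4)] d3(2) by blast
  qed
  moreover have "p \<in> polydisc I p d"
    by (rule centre_in_polydisc[OF _ d(1)]) (use p in \<open>simp add: mem_polydisc\<close>)
  ultimately show ?thesis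
    unfolding same_germ_def using openin_polydisc[OF I, of p d] by blast
qed

text \<open>Near the end of the path the roots are close to the finitely many roots at the end point, and by connectedness each
node follows one and the same of them. The end point may be a branch point.\<close>

lemma node_limit:
  fixes \<gamma> :: "real \<Rightarrow> cvec" and r :: nat
  assumes r: "1 \<le> r" and c: "continuous_on {0..1} \<gamma>" and im: "\<gamma> ` {0..1} \<subseteq> cspace {..<2 * r}"
    and h: "hdet r (\<gamma> 1) \<noteq> 0" and nd: "\<And>t. t \<in> {0..<1} \<Longrightarrow> nodes r (\<gamma> t) (W t)"
    and cW: "continuous_on {0..<1} (\<lambda>t. W t j)" and j: "j \<in> {1..r}"
  shows "\<exists>z. ((\<lambda>t. W t j) \<longlongrightarrow> z) (at_left 1)"
proof -
  define I where "I = {..<2 * r}"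
  obtain v where v: "nodes r (\<gamma> 1) v" using nodes_exist[OF h] by (rule exE)
  define S where "S = v ` {1..r}"
  obtain \<sigma> where \<sigma>: "\<sigma> > 0" and sep0: "\<forall>a\<in>S. \<forall>b\<in>S. a \<noteq> b \<longrightarrow> 3 * \<sigma> \<le> dist a b"
  proof -
    have "finite S" "inj_on (\<lambda>z. z) S" by (simp_all add: S_def)
    from separation_exists[OF this] show thesis by (elim exE conjE) (rule that)
  qed
  have near: "\<exists>T<1. 0 \<le> T \<and> (\<forall>t\<in>{T..<1}. \<exists>\<tau>\<in>S. dist (W t j) \<tau> < \<epsilon>)" if \<epsilon>: "\<epsilon> > 0" for \<epsilon>
  proof -
    have \<gamma>1: "\<gamma> 1 \<in> cspace {..<2 * r}" using im by auto
    obtain d where d: "d > 0" and d0: "\<forall>\<nu>\<in>polydisc I (\<gamma> 1) d. hdet r \<nu> \<noteq> 0 \<and>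
        (\<forall>z. poly (den r \<nu>) z = 0 \<longrightarrow> (\<exists>j\<in>{1..r}. dist z (v j) < \<epsilon>)) \<and>
        (\<forall>j\<in>{1..r}. \<exists>z. poly (den r \<nu>) z = 0 \<and> dist z (v j) < \<epsilon>)"
      using roots_near[OF r \<gamma>1 h v \<epsilon>] unfolding I_def by (elim exE conjE)
    have "\<forall>\<^sub>F t in at 1 within {0..1}. \<gamma> t \<in> polydisc I (\<gamma> 1) d"
      by (rule eventually_path_in_openin[OF c im[folded I_def] openin_polydisc])
         (use \<gamma>1 d in \<open>simp_all add: I_def centre_in_polydisc\<close>)
    then obtain \<delta> where \<delta>: "\<delta> > 0" "\<forall>t\<in>{0..1}. t \<noteq> 1 \<and> dist t 1 < \<delta> \<longrightarrow> \<gamma> t \<in> polydisc I (\<gamma> 1) d"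
      unfolding eventually_at by blast
    define T where "T = max 0 (1 - \<delta> / 2)"
    have T: "T < 1" "0 \<le> T" using \<delta>(1) by (simp_all add: T_def)
    have "\<exists>\<tau>\<in>S. dist (W t j) \<tau> < \<epsilon>" if t: "t \<in> {T..<1}" for t
    proof -
      have t': "t \<in> {0..<1}" "dist t 1 < \<delta>" using t T \<delta>(1) by (auto simp: T_def dist_real_def)
      then have \<gamma>t: "\<gamma> t \<in> polydisc I (\<gamma> 1) d" using \<delta>(2) by auto
      have ht: "hdet r (\<gamma> t) \<noteq> 0" using bspec[OF d0 \<gamma>t] by blast
      have "poly (den r (\<gamma> t)) (W t j) = 0" unfolding root_den_iff[OF nd[OF t'(1)] ht] using j by blast
      then show ?thesis using bspec[OF d0 \<gamma>t] unfolding S_def by blast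
    qed
    with T show ?thesis by blast
  qed
  obtain T where T: "T < 1" "0 \<le> T" "\<And>t. t \<in> {T..<1} \<Longrightarrow> \<exists>\<tau>\<in>S. dist (W t j) \<tau> < \<sigma>" using near[OF \<sigma>] by blast
  have TT: "T \<in> {T..<1}" using T(1) by simp
  obtain \<tau> where \<tau>: "\<tau> \<in> S" "dist (W T j) \<tau> < \<sigma>" using T(3)[OF TT] by blast
  have sep: "2 * \<sigma> \<le> dist a b" if "a \<in> S" "b \<in> S" "a \<noteq> b" for a b
  proof -
    have "3 * \<sigma> \<le> dist a b" using sep0 that by blast
    then show ?thesis using \<sigma> by linarith
  qed
  have cT: "continuous_on {T..<1} (\<lambda>t. W t j)"
    using cW by (rule continuous_on_subset) (use T(2) in auto)
  have stay: "dist (W t j) \<tau> < \<sigma>" if "t \<in> {T..<1}" for t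
    by (rule cluster_persists[OF cT _ sep T(3) \<tau> TT that]) (simp_all add: convex_connected)
  have "((\<lambda>t. W t j) \<longlongrightarrow> \<tau>) (at_left 1)"
    unfolding tendsto_iff
  proof (intro allI impI)
    fix \<epsilon> :: real assume "\<epsilon> > 0"
    then have m: "min \<epsilon> \<sigma> > 0" using \<sigma> by simp
    obtain T' where T': "T' < 1" "\<And>t. t \<in> {T'..<1} \<Longrightarrow> \<exists>\<tau>\<in>S. dist (W t j) \<tau> < min \<epsilon> \<sigma>"
      using near[OF m] by blast
    have "dist (W t j) \<tau> < \<epsilon>" if t: "max T T' < t" "t < 1" for t
    proof -
      obtain \<tau>' where \<tau>': "\<tau>' \<in> S" "dist (W t j) \<tau>' < min \<epsilon> \<sigma>" using T'(2)[of t] t by auto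
      have "dist (W t j) \<tau> < \<sigma>" using stay[of t] t by simp
      then have "dist \<tau> \<tau>' < 2 * \<sigma>" using \<tau>'(2) dist_triangle3[of \<tau> \<tau>' "W t j"] by simp
      then have "\<tau> = \<tau>'" using sep[OF \<tau>(1) \<tau>'(1)] by linarith
      then show ?thesis using \<tau>'(2) by simp
    qed
    then show "\<forall>\<^sub>F t in at_left 1. dist (W t j) \<tau> < \<epsilon>"
      unfolding eventually_at_left_field using T(1) T'(1) by (intro exI[of _ "max T T'"]) simp
  qed
  then show ?thesis by blast
qed

text \<open>Join \<open>p\<close> to \<open>q\<close> off the discriminant, lift the path to node vectors, and take as germs the local branches
around the lifted vectors; at the end point the nodes have limits.\<close>

lemma continuation_value_exists:
  fixes r :: nat
  defines "I \<equiv> {..<2 * r}"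
  assumes r: "1 \<le> r" and p: "p \<in> polydisc I c e" and q: "q \<in> polydisc I c e"
    and h: "\<And>\<nu>. \<nu> \<in> polydisc I c e \<Longrightarrow> hdet r \<nu> \<noteq> 0" and dp: "disc r p \<noteq> 0"
    and hol: "holomorphic_map I {1..r} N g" "p \<in> N" and ng: "nodes_germ r g p"
  shows "\<exists>w. w \<in> continuation_values I {1..r} (polydisc I c e) p g q"
proof -
  have I: "finite I" by (simp add: I_def)
  have "\<exists>\<gamma>. path \<gamma> \<and> path_image \<gamma> \<subseteq> polydisc I c e \<and> pathstart \<gamma> = p \<and> pathfinish \<gamma> = q \<and>
      (\<forall>t\<in>{0..<1}. disc r (\<gamma> t) \<noteq> 0)"
    unfolding I_def by (rule path_off_discriminant) (use p q h dp in \<open>simp_all add: I_def\<close>)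
  then obtain \<gamma> where \<gamma>: "path \<gamma>" "path_image \<gamma> \<subseteq> polydisc I c e" "pathstart \<gamma> = p" "pathfinish \<gamma> = q"
    and off: "\<forall>t\<in>{0..<1}. disc r (\<gamma> t) \<noteq> 0"
    by (elim exE conjE)
  have cont: "continuous_on {0..1} \<gamma>" and im: "\<gamma> ` {0..1} \<subseteq> polydisc I c e" and \<gamma>01: "\<gamma> 0 = p" "\<gamma> 1 = q"
    using \<gamma> by (simp_all add: path_def path_image_def pathstart_def pathfinish_def)
  have cont': "continuous_on {0..<1} \<gamma>" using cont by (rule continuous_on_subset) auto
  have imI: "\<gamma> ` {0..1} \<subseteq> cspace I" using im polydisc_subset_cspace by (rule subset_trans)
  have \<gamma>I: "\<gamma> t \<in> cspace {..<2 * r}" "\<gamma> t \<in> polydisc I c e" if "t \<in> {0..1}" for t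
    using imI im that by (auto simp: I_def)
  have pI: "p \<in> cspace {..<2 * r}" using p by (simp add: mem_polydisc I_def)
  have ht: "hdet r (\<gamma> t) \<noteq> 0" if "t \<in> {0..<1}" for t using h \<gamma>I(2)[of t] that by auto
  have im': "\<gamma> ` {0..<1} \<subseteq> cspace {..<2 * r}" using \<gamma>I(1) by force
  have g0: "nodes r (\<gamma> 0) (g p)" unfolding \<gamma>01 by (rule nodes_germ_at[OF ng pI])
  have offt: "disc r (\<gamma> t) \<noteq> 0" if "t \<in> {0..<1}" for t using off that by (rule bspec)
  have "\<exists>W. W 0 = g p \<and> (\<forall>t\<in>{0..<1}. nodes r (\<gamma> t) (W t)) \<and> (\<forall>j. continuous_on {0..<1} (\<lambda>t. W t j))"
    by (rule lift_nodes[OF r cont' im' _ _ g0]) (fact ht offt)+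
  then obtain W where W0: "W 0 = g p" and W': "\<forall>t\<in>{0..<1}. nodes r (\<gamma> t) (W t)"
    and cW': "\<forall>j. continuous_on {0..<1} (\<lambda>t. W t j)"
    by (elim exE conjE)
  have W: "nodes r (\<gamma> t) (W t)" if "t \<in> {0..<1}" for t using W' that by (rule bspec)
  have cW: "continuous_on {0..<1} (\<lambda>t. W t j)" for j using cW' by (rule spec)
  \<comment> \<open>The germ at time \<open>t\<close> is the branch through \<open>W t\<close>; uniqueness of branches makes neighbouring germs agree.\<close>
  have "\<forall>t\<in>{0..<1}. \<exists>F. \<exists>e>0. \<exists>\<rho>>0. holomorphic_map I {1..r} (polydisc I (\<gamma> t) e) F \<and> F (\<gamma> t) = W t \<and>
    (\<forall>\<nu>\<in>polydisc I (\<gamma> t) e. nodes r \<nu> (F \<nu>) \<and>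
      (\<forall>w'. nodes r \<nu> w' \<and> (\<forall>i\<in>{1..r}. dist (w' i) (W t i) < \<rho>) \<longrightarrow> w' = F \<nu>))"
  proof
    fix t :: real assume t: "t \<in> {0..<1}"
    then have t': "t \<in> {0..1}" by simp
    have inj: "inj_on (W t) {1..r}" using disc_nonzero_iff[OF W[OF t] ht[OF t]] offt[OF t] by simp
    obtain e \<rho> F where e: "e > 0" and \<rho>: "\<rho> > 0" and holF: "holomorphic_map I {1..r} (polydisc I (\<gamma> t) e) F"
      and Ft: "F (\<gamma> t) = W t"
      and F: "\<forall>\<nu>\<in>polydisc I (\<gamma> t) e. hdet r \<nu> \<noteq> 0 \<and> nodes r \<nu> (F \<nu>) \<and> (\<forall>i\<in>{1..r}. dist (F \<nu> i) (W t i) < \<rho>) \<and>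
        (\<forall>w'. nodes r \<nu> w' \<and> (\<forall>i\<in>{1..r}. dist (w' i) (W t i) < \<rho>) \<longrightarrow> w' = F \<nu>)"
      using local_branch[OF r \<gamma>I(1)[OF t'] ht[OF t] W[OF t] inj] unfolding I_def by (elim exE conjE)
    have F\<nu>: "nodes r \<nu> (F \<nu>) \<and> (\<forall>w'. nodes r \<nu> w' \<and> (\<forall>i\<in>{1..r}. dist (w' i) (W t i) < \<rho>) \<longrightarrow> w' = F \<nu>)"
      if "\<nu> \<in> polydisc I (\<gamma> t) e" for \<nu>
      using bspec[OF F that] by (elim conjE) (rule conjI)
    show "\<exists>F. \<exists>e>0. \<exists>\<rho>>0. holomorphic_map I {1..r} (polydisc I (\<gamma> t) e) F \<and> F (\<gamma> t) = W t \<and>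
      (\<forall>\<nu>\<in>polydisc I (\<gamma> t) e. nodes r \<nu> (F \<nu>) \<and>
        (\<forall>w'. nodes r \<nu> w' \<and> (\<forall>i\<in>{1..r}. dist (w' i) (W t i) < \<rho>) \<longrightarrow> w' = F \<nu>))"
      by (rule exI[of _ F], rule exI[of _ e], rule conjI[OF e], rule exI[of _ \<rho>], rule conjI[OF \<rho>],
          rule conjI[OF holF], rule conjI[OF Ft], rule ballI, rule F\<nu>)
  qed
  from bchoice[OF this] obtain F where F: "\<forall>t\<in>{0..<1}. \<exists>e>0. \<exists>\<rho>>0.
    holomorphic_map I {1..r} (polydisc I (\<gamma> t) e) (F t) \<and> F t (\<gamma> t) = W t \<and>
    (\<forall>\<nu>\<in>polydisc I (\<gamma> t) e. nodes r \<nu> (F t \<nu>) \<and>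
      (\<forall>w'. nodes r \<nu> w' \<and> (\<forall>i\<in>{1..r}. dist (w' i) (W t i) < \<rho>) \<longrightarrow> w' = F t \<nu>))" by (rule exE)
  have FW: "F t (\<gamma> t) = W t" "nodes_germ r (F t) (\<gamma> t)" if t: "t \<in> {0..<1}" for t
  proof -
    obtain e \<rho> where e: "e > 0" and Ft: "F t (\<gamma> t) = W t"
      and F': "\<forall>\<nu>\<in>polydisc I (\<gamma> t) e. nodes r \<nu> (F t \<nu>) \<and>
        (\<forall>w'. nodes r \<nu> w' \<and> (\<forall>i\<in>{1..r}. dist (w' i) (W t i) < \<rho>) \<longrightarrow> w' = F t \<nu>)"
      using bspec[OF F t] by (elim exE conjE)
    show "F t (\<gamma> t) = W t" by fact
    show "nodes_germ r (F t) (\<gamma> t)"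
      unfolding nodes_germ_def I_def[symmetric]
      by (intro exI[of _ e] conjI e ballI) (rule conjunct1[OF bspec[OF F']])
  qed
  have agree: "same_germ I (\<gamma> s) G (F t)"
    if t: "t \<in> {0..<1}" and e: "\<gamma> s \<in> polydisc I (\<gamma> t) e" and G: "holomorphic_map I {1..r} M G" "\<gamma> s \<in> M" "nodes_germ r G (\<gamma> s)"
      and Gs: "G (\<gamma> s) = W s" and close: "\<And>i. i \<in> {1..r} \<Longrightarrow> dist (W s i) (W t i) < \<rho>"
      and un: "\<forall>\<nu>\<in>polydisc I (\<gamma> t) e. nodes r \<nu> (F t \<nu>) \<and>
        (\<forall>w'. nodes r \<nu> w' \<and> (\<forall>i\<in>{1..r}. dist (w' i) (W t i) < \<rho>) \<longrightarrow> w' = F t \<nu>)"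
    for s t e \<rho> M G
    unfolding I_def
  proof (rule branches_agree[of r M G "\<gamma> s" "\<gamma> t" e "W t" \<rho> "F t"])
    have "continuous_on M G" using G(1) by (simp add: holomorphic_map_def)
    then show "continuous_on M (\<lambda>\<nu>. G \<nu> i)" for i by (rule continuous_on_product_then_coordinatewise)
    show "openin (top_of_set (cspace {..<2 * r})) M" using G(1) by (simp add: holomorphic_map_def I_def)
    show "dist (G (\<gamma> s) i) (W t i) < \<rho>" if "i \<in> {1..r}" for i using close[OF that] by (simp only: Gs)
    show "w' = F t \<nu>" if "\<nu> \<in> polydisc {..<2 * r} (\<gamma> t) e" "nodes r \<nu> w'" "\<forall>i\<in>{1..r}. dist (w' i) (W t i) < \<rho>" for \<nu> w'
      using bspec[OF un[unfolded I_def] that(1)] that(2,3) by blast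
  qed (use G e in \<open>simp_all add: I_def\<close>)
  have fam: "germ_family I {1..r} {0..<1} \<gamma> F"
    unfolding germ_family_def
  proof
    fix t :: real assume t: "t \<in> {0..<1}"
    obtain e \<rho> where e: "e > 0" and \<rho>: "\<rho> > 0" and holt: "holomorphic_map I {1..r} (polydisc I (\<gamma> t) e) (F t)"
      and un: "\<forall>\<nu>\<in>polydisc I (\<gamma> t) e. nodes r \<nu> (F t \<nu>) \<and>
        (\<forall>w'. nodes r \<nu> w' \<and> (\<forall>i\<in>{1..r}. dist (w' i) (W t i) < \<rho>) \<longrightarrow> w' = F t \<nu>)"
      using bspec[OF F t] by (elim exE conjE)
    have \<gamma>e: "\<gamma> t \<in> polydisc I (\<gamma> t) e"
      by (rule centre_in_polydisc[OF _ e]) (use \<gamma>I(1)[of t] t in \<open>simp add: I_def\<close>)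
    have "\<forall>\<^sub>F s in at t within {0..<1}. \<gamma> s \<in> polydisc I (\<gamma> t) e"
      by (rule eventually_path_in_openin[OF cont' im'[folded I_def] openin_polydisc[OF I] t \<gamma>e])
    moreover have "\<forall>\<^sub>F s in at t within {0..<1}. \<forall>i\<in>{1..r}. dist (W s i) (W t i) < \<rho>"
    proof (rule eventually_ball_finite[OF finite_atLeastAtMost ballI])
      fix i
      have "((\<lambda>s. W s i) \<longlongrightarrow> W t i) (at t within {0..<1})"
        using cW[of i] t by (simp add: continuous_on_def)
      then show "\<forall>\<^sub>F s in at t within {0..<1}. dist (W s i) (W t i) < \<rho>"
        using \<rho> by (rule tendstoD)
    qed
    ultimately have "\<forall>\<^sub>F s in at t within {0..<1}. \<gamma> s \<in> polydisc I (\<gamma> t) e \<and> (\<forall>i\<in>{1..r}. dist (W s i) (W t i) < \<rho>)"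
      by (rule eventually_conj)
    then obtain d where d: "d > 0" "\<forall>s\<in>{0..<1}. s \<noteq> t \<and> dist s t < d \<longrightarrow>
        \<gamma> s \<in> polydisc I (\<gamma> t) e \<and> (\<forall>i\<in>{1..r}. dist (W s i) (W t i) < \<rho>)"
      unfolding eventually_at by (elim exE conjE)
    have "\<gamma> s \<in> polydisc I (\<gamma> t) e \<and> same_germ I (\<gamma> s) (F s) (F t)" if s: "s \<in> {0..<1}" "dist s t < d" for s
    proof -
      have *: "\<gamma> s \<in> polydisc I (\<gamma> t) e \<and> (\<forall>i\<in>{1..r}. dist (W s i) (W t i) < \<rho>)"
        using bspec[OF d(2) s(1)] s(2) \<gamma>e \<rho> by (cases "s = t") simp_all
      obtain es where es: "es > 0" "holomorphic_map I {1..r} (polydisc I (\<gamma> s) es) (F s)"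
        using bspec[OF F s(1)] by (elim exE conjE)
      have "\<gamma> s \<in> polydisc I (\<gamma> s) es"
        by (rule centre_in_polydisc[OF _ es(1)]) (use \<gamma>I(1)[of s] s in \<open>simp add: I_def\<close>)
      from agree[OF t conjunct1[OF *] es(2) this FW(2)[OF s(1)] FW(1)[OF s(1)] bspec[OF conjunct2[OF *]] un]
      show ?thesis using conjunct1[OF *] by (intro conjI)
    qed
    then show "\<exists>N. holomorphic_map I {1..r} N (F t) \<and> \<gamma> t \<in> N \<and>
      (\<exists>d>0. \<forall>s\<in>{0..<1}. dist s t < d \<longrightarrow> \<gamma> s \<in> N \<and> same_germ I (\<gamma> s) (F s) (F t))"
      using holt \<gamma>e d(1) by (intro exI[of _ "polydisc I (\<gamma> t) e"] conjI exI[of _ d] ballI impI) simp_all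
  qed
  have start: "same_germ I (\<gamma> 0) (F 0) g"
  proof -
    have t0: "(0 :: real) \<in> {0..<1}" by simp
    obtain e \<rho> where e: "e > 0" and \<rho>: "\<rho> > 0"
      and un: "\<forall>\<nu>\<in>polydisc I (\<gamma> 0) e. nodes r \<nu> (F 0 \<nu>) \<and>
        (\<forall>w'. nodes r \<nu> w' \<and> (\<forall>i\<in>{1..r}. dist (w' i) (W 0 i) < \<rho>) \<longrightarrow> w' = F 0 \<nu>)"
      using bspec[OF F t0] by (elim exE conjE)
    have \<gamma>e: "\<gamma> 0 \<in> polydisc I (\<gamma> 0) e"
      by (rule centre_in_polydisc[OF _ e]) (use pI in \<open>simp add: I_def \<gamma>01\<close>)
    have "same_germ I (\<gamma> 0) g (F 0)"
      by (rule agree[OF t0 \<gamma>e hol(1) _ _ _ _ un]) (use hol(2) ng W0 \<rho> in \<open>simp_all add: \<gamma>01\<close>)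
    then show ?thesis by (rule same_germ_sym)
  qed
  have h1: "hdet r (\<gamma> 1) \<noteq> 0" unfolding \<gamma>01 by (rule h[OF q])
  have "\<forall>j\<in>{1..r}. \<exists>z. ((\<lambda>t. W t j) \<longlongrightarrow> z) (at_left 1)"
    using node_limit[OF r cont imI[unfolded I_def] h1 W cW] by (rule ballI)
  from bchoice[OF this] obtain z where z: "\<forall>j\<in>{1..r}. ((\<lambda>t. W t j) \<longlongrightarrow> z j) (at_left 1)" by (rule exE)
  define w where "w = restrict z {1..r}"
  have lim: "(W \<longlongrightarrow> w) (at_left 1)"
    unfolding tendsto_coordinatewise_iff
  proof
    fix j
    show "((\<lambda>t. W t j) \<longlongrightarrow> w j) (at_left 1)"
    proof (cases "j \<in> {1..r}")
      case True
      then show ?thesis using z by (simp add: w_def)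
    next
      case False
      have "W t j = w j" if "t \<in> {0..<1}" for t
      proof -
        have "W t \<in> extensional {1..r}" using W[OF that] by (simp add: nodes_def cspace_def PiE_def)
        from extensional_arb[OF this False] have "W t j = undefined" .
        moreover have "w j = undefined" unfolding w_def restrict_def using False by (simp only: if_False)
        ultimately show ?thesis by simp
      qed
      then have "\<forall>\<^sub>F t in at_left 1. w j = W t j"
        unfolding eventually_at_left_field by (intro exI[of _ 0]) simp
      with tendsto_const show ?thesis by (rule Lim_transform_eventually)
    qed
  qed
  have "\<forall>\<^sub>F t in at_left 1. W t = F t (\<gamma> t)"
    unfolding eventually_at_left_field by (intro exI[of _ 0]) (simp add: FW(1))
  with lim have "((\<lambda>t. F t (\<gamma> t)) \<longlongrightarrow> w) (at_left 1)" by (rule Lim_transform_eventually)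
  moreover have "w \<in> cspace {1..r}" by (simp add: w_def cspace_def)
  moreover have "continues_along I {1..r} g \<gamma> F" unfolding continues_along_iff using start fam by (rule conjI)
  ultimately show ?thesis
    unfolding continuation_values_def mem_Collect_eq
    using \<gamma> by (intro exI[of _ w] exI[of _ \<gamma>] exI[of _ F] conjI)
qed

section \<open>Values at neighbouring moment vectors\<close>

text \<open>A value at \<open>\<nu>\<close> is the limit of a continuation. Stop this continuation shortly before its end, at a point of a
small polydisc around \<open>\<mu>\<close>, and continue inside this polydisc to \<open>\<nu>'\<close>. During the second part each node stays in its
cluster, so the new value is close to the old one.\<close>

lemma values_transport:
  fixes r :: nat
  defines "I \<equiv> {..<2 * r}"
  assumes r: "1 \<le> r" and h: "\<And>\<nu>. \<nu> \<in> polydisc I c e \<Longrightarrow> hdet r \<nu> \<noteq> 0"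
    and \<mu>1: "\<mu>1 \<in> polydisc I c e" "disc r \<mu>1 \<noteq> 0" and ng: "nodes_germ r x \<mu>1"
    and \<mu>: "\<mu> \<in> polydisc I c e" and \<rho>: "0 < \<rho>"
  shows "\<exists>d>0. \<forall>\<nu>\<in>polydisc I \<mu> d. \<forall>\<nu>'\<in>polydisc I \<mu> d. \<nu>' \<in> polydisc I c e \<and>
    (\<forall>w\<in>continuation_values I {1..r} (polydisc I c e) \<mu>1 x \<nu>.
      \<exists>w'\<in>continuation_values I {1..r} (polydisc I c e) \<mu>1 x \<nu>'. \<forall>i\<in>{1..r}. dist (w i) (w' i) < \<rho>)"
proof -
  define U where "U = polydisc I c e"
  have I: "finite I" by (simp add: I_def)
  have UI: "U \<subseteq> cspace I" unfolding U_def by (rule polydisc_subset_cspace)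
  have \<mu>I: "\<mu> \<in> cspace {..<2 * r}" using \<mu> by (simp add: mem_polydisc I_def)
  obtain v where v: "nodes r \<mu> v" using nodes_exist[OF h[OF \<mu>]] by (rule exE)
  define S where "S = v ` {1..r}"
  obtain \<sigma> where \<sigma>: "\<sigma> > 0" and sep: "\<forall>a\<in>S. \<forall>b\<in>S. a \<noteq> b \<longrightarrow> 3 * \<sigma> \<le> dist a b"
  proof -
    have "finite S" "inj_on (\<lambda>z. z) S" by (simp_all add: S_def)
    from separation_exists[OF this] show thesis by (elim exE conjE) (rule that)
  qed
  \<comment> \<open>The three parts of size \<open>\<rho>'\<close>: from \<open>w\<close> to the interrupted continuation, from there to the centre of
    the cluster, and from the centre to the new value.\<close>
  define \<rho>' where "\<rho>' = min \<sigma> (\<rho> / 3)"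
  have \<rho>': "\<rho>' > 0" "\<rho>' \<le> \<sigma>" "3 * \<rho>' \<le> \<rho>" using \<sigma> \<rho> by (simp_all add: \<rho>'_def)
  have sep': "2 * \<rho>' \<le> dist a b" if "a \<in> S" "b \<in> S" "a \<noteq> b" for a b
  proof -
    have "3 * \<sigma> \<le> dist a b" using sep that by blast
    then show ?thesis using \<sigma> \<rho>'(2) by linarith
  qed
  obtain d1 where d1: "d1 > 0" and roots: "\<forall>\<nu>\<in>polydisc I \<mu> d1. hdet r \<nu> \<noteq> 0 \<and>
      (\<forall>z. poly (den r \<nu>) z = 0 \<longrightarrow> (\<exists>j\<in>{1..r}. dist z (v j) < \<rho>')) \<and>
      (\<forall>j\<in>{1..r}. \<exists>z. poly (den r \<nu>) z = 0 \<and> dist z (v j) < \<rho>')"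
    using roots_near[OF r \<mu>I h[OF \<mu>] v \<rho>'(1)] unfolding I_def by (elim exE conjE)
  obtain d2 where d2: "d2 > 0" "polydisc I \<mu> d2 \<subseteq> U"
    using polydisc_nested[OF \<mu> I] unfolding U_def by (elim exE conjE)
  define d where "d = min d1 d2"
  have d: "d > 0" using d1 d2(1) by (simp add: d_def)
  define V where "V = polydisc I \<mu> d"
  have V1: "V \<subseteq> polydisc I \<mu> d1" unfolding V_def by (rule polydisc_mono) (simp add: d_def)
  have "V \<subseteq> polydisc I \<mu> d2" unfolding V_def by (rule polydisc_mono) (simp add: d_def)
  then have VU: "V \<subseteq> U" using d2(2) by (rule subset_trans)
  have VI: "V \<subseteq> cspace I" using VU UI by (rule subset_trans)
  have rootV: "\<exists>\<tau>\<in>S. dist (w i) \<tau> < \<rho>'" if "\<nu> \<in> V" "nodes r \<nu> w" "i \<in> {1..r}" for \<nu> w i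
  proof -
    have *: "\<nu> \<in> polydisc I \<mu> d1" using that(1) V1 by blast
    have "hdet r \<nu> \<noteq> 0" using bspec[OF roots *] by blast
    then have "poly (den r \<nu>) (w i) = 0" using root_den_iff[OF that(2)] that(3) by blast
    then show ?thesis using bspec[OF roots *] unfolding S_def by blast
  qed
  have hV: "hdet r \<nu> \<noteq> 0" if "\<nu> \<in> polydisc I \<mu> d" for \<nu>
    using h that VU unfolding V_def U_def by blast
  have main: "\<exists>w'\<in>continuation_values I {1..r} U \<mu>1 x \<nu>'. \<forall>i\<in>{1..r}. dist (w i) (w' i) < \<rho>"
    if \<nu>: "\<nu> \<in> V" "\<nu>' \<in> V" and w: "w \<in> continuation_values I {1..r} U \<mu>1 x \<nu>" for \<nu> \<nu>' w
  proof -
    obtain \<gamma> \<Phi> where \<gamma>: "path \<gamma>" "path_image \<gamma> \<subseteq> U" "pathstart \<gamma> = \<mu>1" "pathfinish \<gamma> = \<nu>"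
      and ca: "continues_along I {1..r} x \<gamma> \<Phi>" and lim: "((\<lambda>t. \<Phi> t (\<gamma> t)) \<longlongrightarrow> w) (at_left 1)"
      using w unfolding continuation_values_def mem_Collect_eq by (elim exE conjE)
    have cont: "continuous_on {0..1} \<gamma>" and im: "\<gamma> ` {0..1} \<subseteq> U" and \<gamma>01: "\<gamma> 0 = \<mu>1" "\<gamma> 1 = \<nu>"
      using \<gamma> by (simp_all add: path_def path_image_def pathstart_def pathfinish_def)
    have cont': "continuous_on {0..<1} \<gamma>" using cont by (rule continuous_on_subset) auto
    have imI: "\<gamma> ` {0..1} \<subseteq> cspace I" using im UI by (rule subset_trans)
    have imI': "\<gamma> ` {0..<1} \<subseteq> cspace I"
      by (rule subset_trans[OF image_mono imI]) auto
    have "\<forall>\<^sub>F t in at_left 1. \<gamma> t \<in> V"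
    proof -
      have "\<forall>\<^sub>F t in at 1 within {0..1}. \<gamma> t \<in> V"
        unfolding V_def
        by (rule eventually_path_in_openin[OF cont imI openin_polydisc[OF I]])
           (use \<nu>(1) in \<open>simp_all add: \<gamma>01 V_def\<close>)
      then show ?thesis by (simp add: at_within_Icc_at_left)
    qed
    moreover have "\<forall>\<^sub>F t in at_left 1. \<forall>i\<in>{1..r}. dist (\<Phi> t (\<gamma> t) i) (w i) < \<rho>'"
    proof (rule eventually_ball_finite[OF finite_atLeastAtMost ballI])
      fix i
      have "((\<lambda>t. \<Phi> t (\<gamma> t) i) \<longlongrightarrow> w i) (at_left 1)"
        using lim unfolding tendsto_coordinatewise_iff by (rule spec)
      then show "\<forall>\<^sub>F t in at_left 1. dist (\<Phi> t (\<gamma> t) i) (w i) < \<rho>'" using \<rho>'(1) by (rule tendstoD)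
    qed
    moreover have "\<forall>\<^sub>F t in at_left (1 :: real). t \<in> {0..<1}"
      unfolding eventually_at_left_field by (intro exI[of _ 0]) simp
    ultimately have "\<forall>\<^sub>F t in at_left 1. \<gamma> t \<in> V \<and> (\<forall>i\<in>{1..r}. dist (\<Phi> t (\<gamma> t) i) (w i) < \<rho>') \<and> t \<in> {0..<1}"
      by (intro eventually_conj)
    from eventually_happens'[OF trivial_limit_at_left_real this] obtain T where
      T: "\<gamma> T \<in> V" "\<forall>i\<in>{1..r}. dist (\<Phi> T (\<gamma> T) i) (w i) < \<rho>'" "T \<in> {0..<1}" by (elim exE conjE)
    define p where "p = \<gamma> T"
    define g where "g = \<Phi> T"
    have pV: "p \<in> V" using T(1) by (simp only: p_def)
    have ngp: "nodes_germ r g p"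
      unfolding p_def g_def
      by (rule continuation_nodes_germ[OF cont' imI'[unfolded I_def] ca[unfolded I_def] _ T(3)])
         (simp only: \<gamma>01 ng)
    obtain N where N: "holomorphic_map I {1..r} N g" "p \<in> N"
      using ca T(3) unfolding continues_along_def p_def g_def by blast
    have re1: "reaches I {1..r} U \<mu>1 x p g"
      using reaches_truncate[OF \<gamma>(1,2) ca T(3)] unfolding \<gamma>01 p_def g_def .
    obtain e1 where e1: "e1 > 0" "polydisc I p e1 \<subseteq> N"
      using openin_contains_polydisc[OF I _ N(2)] N(1) unfolding holomorphic_map_def by blast
    obtain e2 where e2: "e2 > 0" "polydisc I p e2 \<subseteq> V"
      using polydisc_nested[OF pV[unfolded V_def] I] unfolding V_def by (elim exE conjE)
    obtain e3 where e3: "e3 > 0" "\<forall>\<nu>\<in>polydisc I p e3. nodes r \<nu> (g \<nu>)"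
      using ngp unfolding nodes_germ_def I_def by (elim exE conjE)
    define e' where "e' = min e1 (min e2 e3)"
    have e': "e' > 0" "e' \<le> e1" "e' \<le> e2" "e' \<le> e3" using e1(1) e2(1) e3(1) by (simp_all add: e'_def)
    define B where "B = polydisc I p e'"
    have BN: "B \<subseteq> N" and BV: "B \<subseteq> V" and Bn: "\<forall>\<nu>\<in>B. nodes r \<nu> (g \<nu>)"
      unfolding B_def using polydisc_mono[OF e'(2)] polydisc_mono[OF e'(3)] polydisc_mono[OF e'(4)] e1(2) e2(2) e3(2)
      by blast+
    have pB: "p \<in> B" unfolding B_def by (rule centre_in_polydisc[OF _ e'(1)]) (use pV VI in blast)
    \<comment> \<open>The end of a path off the discriminant provides points in \<open>B\<close> at which it does not vanish.\<close>
    have "\<exists>p'\<in>B. disc r p' \<noteq> 0"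
    proof -
      have pU: "p \<in> polydisc I c e" using pV VU unfolding U_def by blast
      have "\<exists>\<gamma>. path \<gamma> \<and> path_image \<gamma> \<subseteq> polydisc I c e \<and> pathstart \<gamma> = \<mu>1 \<and> pathfinish \<gamma> = p \<and>
          (\<forall>t\<in>{0..<1}. disc r (\<gamma> t) \<noteq> 0)"
        unfolding I_def by (rule path_off_discriminant) (use \<mu>1 pU h in \<open>simp_all add: I_def\<close>)
      then obtain \<eta> where \<eta>: "path \<eta>" "path_image \<eta> \<subseteq> polydisc I c e" "pathfinish \<eta> = p"
        "\<forall>t\<in>{0..<1}. disc r (\<eta> t) \<noteq> 0" by (elim exE conjE)
      have \<eta>I: "\<eta> ` {0..1} \<subseteq> cspace I"
        using \<eta>(2) polydisc_subset_cspace unfolding path_image_def by (rule subset_trans)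
      have "\<forall>\<^sub>F t in at 1 within {0..1}. \<eta> t \<in> B"
        unfolding B_def
        by (rule eventually_path_in_openin[OF \<eta>(1)[unfolded path_def] \<eta>I openin_polydisc[OF I]])
           (use pB \<eta>(3) in \<open>simp_all add: B_def pathfinish_def\<close>)
      then have "\<forall>\<^sub>F t in at_left 1. \<eta> t \<in> B" by (simp add: at_within_Icc_at_left)
      moreover have "\<forall>\<^sub>F t in at_left (1 :: real). t \<in> {0..<1}"
        unfolding eventually_at_left_field by (intro exI[of _ 0]) simp
      ultimately have "\<forall>\<^sub>F t in at_left 1. \<eta> t \<in> B \<and> t \<in> {0..<1}" by (rule eventually_conj)
      from eventually_happens'[OF trivial_limit_at_left_real this] obtain t where "\<eta> t \<in> B" "t \<in> {0..<1}"
        by (elim exE conjE)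
      then show ?thesis using \<eta>(4) by blast
    qed
    then obtain p' where p': "p' \<in> B" "disc r p' \<noteq> 0" by (elim bexE)
    have ngp': "nodes_germ r g p'"
    proof -
      obtain e4 where "e4 > 0" "polydisc I p' e4 \<subseteq> B"
        using polydisc_nested[OF p'(1)[unfolded B_def] I] unfolding B_def by (elim exE conjE)
      then show ?thesis unfolding nodes_germ_def I_def[symmetric] using Bn by blast
    qed
    have p'V: "p' \<in> polydisc I \<mu> d" using p'(1) BV unfolding V_def by blast
    have p'N: "p' \<in> N" using p'(1) BN by blast
    have "\<exists>w'. w' \<in> continuation_values I {1..r} V p' g \<nu>'"
      unfolding V_def I_def
      by (rule continuation_value_exists[OF r _ _ _ p'(2) _ p'N ngp'])
         (use p'V \<nu>(2) hV N(1) in \<open>simp_all add: V_def I_def\<close>)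
    then obtain w' where w'1: "w' \<in> continuation_values I {1..r} V p' g \<nu>'" by (rule exE)
    have re2: "reaches I {1..r} V p g p' g"
      by (rule reaches_constant[OF I N(1) BN[unfolded B_def] BV[unfolded B_def] pB[unfolded B_def] p'(1)[unfolded B_def]])
    have w'2: "w' \<in> continuation_values I {1..r} V p g \<nu>'"
      by (rule reaches_continuation_values[OF VI re2 w'1])
    then have "w' \<in> continuation_values I {1..r} U p g \<nu>'" using continuation_values_mono[OF VU] by blast
    from reaches_continuation_values[OF UI re1 this]
    have w'U: "w' \<in> continuation_values I {1..r} U \<mu>1 x \<nu>'" .
    have "\<exists>\<eta> Y. continuous_on {0..1} \<eta> \<and> \<eta> ` {0..1} \<subseteq> V \<and> \<eta> 0 = p \<and> \<eta> 1 = \<nu>' \<and> Y 0 = g p \<and> Y 1 = w' \<and>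
        (\<forall>t\<in>{0..1}. nodes r (\<eta> t) (Y t)) \<and> (\<forall>j. continuous_on {0..1 :: real} (\<lambda>t. Y t j))"
      by (rule continuation_value_path[OF VI[unfolded I_def] ngp w'2[unfolded I_def]])
    then obtain \<eta> Y where \<eta>: "\<eta> ` {0..1} \<subseteq> V" and Y: "Y 0 = g p" "Y 1 = w'"
      and nY: "\<forall>t\<in>{0..1}. nodes r (\<eta> t) (Y t)" and cY: "\<forall>j. continuous_on {0..1 :: real} (\<lambda>t. Y t j)"
      by (elim exE conjE)
    have "dist (w i) (w' i) < \<rho>" if i: "i \<in> {1..r}" for i
    proof -
      have nearY: "\<exists>\<tau>\<in>S. dist (Y t i) \<tau> < \<rho>'" if t: "t \<in> {0..1}" for t
        by (rule rootV[OF _ bspec[OF nY t] i]) (use \<eta> t in blast)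
      have 01: "(0 :: real) \<in> {0..1}" "(1 :: real) \<in> {0..1}" by simp_all
      obtain \<tau> where \<tau>: "\<tau> \<in> S" "dist (Y 0 i) \<tau> < \<rho>'" using nearY[OF 01(1)] by (elim bexE)
      have conn: "connected {0..1 :: real}" by simp
      have "dist (Y 1 i) \<tau> < \<rho>'"
        by (rule cluster_persists[OF spec[OF cY] conn sep' nearY \<tau> 01])
      then have "dist (g p i) (w' i) < 2 * \<rho>'"
        using \<tau>(2) dist_triangle2[of "g p i" "w' i" \<tau>] unfolding Y by linarith
      moreover have "dist (g p i) (w i) < \<rho>'" using bspec[OF T(2) i] unfolding g_def p_def .
      ultimately show ?thesis using dist_triangle3[of "w i" "w' i" "g p i"] \<rho>'(3) by linarith
    qed
    then show ?thesis using w'U by blast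
  qed
  have "\<nu>' \<in> U \<and> (\<forall>w\<in>continuation_values I {1..r} U \<mu>1 x \<nu>.
      \<exists>w'\<in>continuation_values I {1..r} U \<mu>1 x \<nu>'. \<forall>i\<in>{1..r}. dist (w i) (w' i) < \<rho>)"
    if "\<nu> \<in> V" "\<nu>' \<in> V" for \<nu> \<nu>'
    using main[OF that] that(2) VU by blast
  then show ?thesis unfolding U_def V_def using d by blast
qed

section \<open>The coordinates as multivalued functions\<close>

lemma hdet_restrict: "hdet r (restrict \<mu> {..<2 * r}) = hdet r \<mu>"
proof -
  have "hankel r r (restrict \<mu> {..<2 * r}) = hankel r r \<mu>"
    unfolding hankel_def by (intro eq_matI) auto
  then show ?thesis by (simp add: hdet_def)
qed

lemma finite_nodes:
  assumes "hdet r \<mu> \<noteq> 0"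
  shows "finite {w. nodes r \<mu> w}"
proof (rule finite_subset)
  have "finite {z. poly (den r \<mu>) z = 0}" by (rule poly_roots_finite[OF den_nonzero])
  then show "finite ({1..r} \<rightarrow>\<^sub>E {z. poly (den r \<mu>) z = 0})" by (intro finite_PiE) simp_all
  show "{w. nodes r \<mu> w} \<subseteq> {1..r} \<rightarrow>\<^sub>E {z. poly (den r \<mu>) z = 0}"
  proof
    fix w assume "w \<in> {w. nodes r \<mu> w}"
    then have w: "nodes r \<mu> w" by simp
    have "poly (den r \<mu>) (w i) = 0" if "i \<in> {1..r}" for i
      unfolding root_den_iff[OF w assms] using that by blast
    moreover have "w \<in> extensional {1..r}" using w by (simp add: nodes_def cspace_def PiE_def)
    ultimately show "w \<in> {1..r} \<rightarrow>\<^sub>E {z. poly (den r \<mu>) z = 0}" by (simp add: PiE_iff)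
  qed
qed

text \<open>Clusters of distinct nodes are disjoint, so nodes that coincide after the perturbation coincided before it.\<close>

lemma subordinated_near:
  assumes sub: "subordinated r w0 \<C>"
    and sep: "\<And>k l. k \<in> {1..r} \<Longrightarrow> l \<in> {1..r} \<Longrightarrow> w0 k \<noteq> w0 l \<Longrightarrow> 2 * \<sigma> \<le> dist (w0 k) (w0 l)"
    and near: "\<And>k. k \<in> {1..r} \<Longrightarrow> dist (w k) (w0 k) < \<sigma>"
  shows "subordinated r w \<C>"
  unfolding subordinated_def
proof (intro ballI impI)
  fix k l assume k: "k \<in> {1..r}" and l: "l \<in> {1..r}" and kl: "k \<noteq> l \<and> w k = w l"
  have "dist (w0 k) (w0 l) < 2 * \<sigma>"
    using near[OF k] near[OF l] kl dist_triangle3[of "w0 k" "w0 l" "w k"] by simp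
  then have "w0 k = w0 l" using sep[OF k l] by linarith
  then show "\<exists>X\<in>\<C>. k \<in> X \<and> l \<in> X" using sub k l kl unfolding subordinated_def by blast
qed

lemma solution_continuous:
  assumes C: "partition_on {1..r} \<C>"
    and sol: "\<And>\<mu> w. \<mu> \<in> U \<Longrightarrow> w \<in> W \<mu> \<Longrightarrow> subordinated r w \<C> \<and> solves_linear_system r \<C> \<mu> w (\<beta> \<mu> w)"
    and p: "p \<in> conf_index \<C>"
  shows "continuous_on (SIGMA \<mu>:U. W \<mu>) (\<lambda>(\<mu>, w). \<beta> \<mu> w p)"
proof -
  have "continuous_on (SIGMA \<mu>:U. W \<mu>) (\<lambda>s. \<beta> (fst s) (snd s) p)"
  proof (rule linear_system_solution_continuous[OF C, of _ snd "\<lambda>s. \<beta> (fst s) (snd s)" fst])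
    show "continuous_on (SIGMA \<mu>:U. W \<mu>) (\<lambda>s. fst s i)" "continuous_on (SIGMA \<mu>:U. W \<mu>) (\<lambda>s. snd s i)" for i
      by (rule continuous_on_product_then_coordinatewise, intro continuous_intros)+
    fix s assume s: "s \<in> (SIGMA \<mu>:U. W \<mu>)"
    obtain \<mu> w where \<mu>w: "s = (\<mu>, w)" "\<mu> \<in> U" "w \<in> W \<mu>" using s by (elim SigmaE) simp
    show "subordinated r (snd s) \<C>" using sol[OF \<mu>w(2,3)] by (simp add: \<mu>w(1))
    show "dd_sum \<C> (snd s) (\<beta> (fst s) (snd s)) (monom 1 k) = fst s k" if "k < r" for k
      using conjunct2[OF sol[OF \<mu>w(2,3)]] that
      unfolding solves_linear_system_iff[OF C] \<mu>w(1) by simp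
  qed (rule p)
  then show ?thesis by (simp only: case_prod_unfold)
qed

text \<open>The relation between moments and coordinate has positive degree in the coordinate: otherwise its leading coefficient would
vanish at all moment vectors of an open polydisc.\<close>

lemma solution_algebraic:
  fixes r :: nat
  assumes C: "partition_on {1..r} \<C>" and U: "U = polydisc {..<2 * r} c e" and e: "0 < e"
    and ne: "\<And>\<mu>. \<mu> \<in> U \<Longrightarrow> W \<mu> \<noteq> {}"
    and sol: "\<And>\<mu> w. \<mu> \<in> U \<Longrightarrow> w \<in> W \<mu> \<Longrightarrow> solves_linear_system r \<C> \<mu> w (\<beta> \<mu> w)"
    and p: "p \<in> conf_index \<C>"
  shows "algebraic_multifun {..<2 * r} U (\<lambda>\<mu>. (\<lambda>w. \<beta> \<mu> w p) ` W \<mu>)"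
proof -
  obtain n q where q: "\<forall>k. polynomial_fun {..<2 * r} (q k)"
    and nz: "\<forall>A. (\<forall>i<2 * r. infinite (A i)) \<longrightarrow> (\<exists>\<mu>\<in>PiE {..<2 * r} A. q n \<mu> \<noteq> 0)"
    and rel: "\<forall>\<mu> w b. (\<forall>k<2 * r. dd_sum \<C> w b (monom 1 k) = \<mu> k) \<longrightarrow> (\<Sum>k\<le>n. q k \<mu> * b p ^ k) = 0"
    using coordinate_algebraic_relation[OF C p] by (elim exE conjE)
  have eq: "(\<Sum>k\<le>n. q k \<mu> * \<beta> \<mu> w p ^ k) = 0" if "\<mu> \<in> U" "w \<in> W \<mu>" for \<mu> w
  proof -
    have "\<forall>k<2 * r. dd_sum \<C> w (\<beta> \<mu> w) (monom 1 k) = \<mu> k"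
      using sol[OF that] unfolding solves_linear_system_iff[OF C] by (rule conjunct2)
    then show ?thesis by (rule mp[OF spec[OF spec[OF spec[OF rel]]]])
  qed
  have "\<exists>\<mu>\<in>PiE {..<2 * r} (\<lambda>i. ball (c i) e). q n \<mu> \<noteq> 0"
  proof -
    have "infinite (ball (c i) e)" for i
      using finite_imp_not_open[of "ball (c i) e"] e by (auto simp: ball_eq_empty)
    then have "\<forall>i<2 * r. infinite (ball (c i) e)" by (intro allI impI)
    then show ?thesis by (rule mp[OF spec[OF nz]])
  qed
  then obtain \<mu> where \<mu>: "\<mu> \<in> U" "q n \<mu> \<noteq> 0" unfolding U polydisc_def by (elim bexE)
  have "1 \<le> n"
  proof (rule ccontr)
    assume "\<not> 1 \<le> n"
    then have n: "n = 0" by simp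
    obtain w where "w \<in> W \<mu>" using ne[OF \<mu>(1)] by blast
    from eq[OF \<mu>(1) this] \<mu>(2) show False by (simp add: n)
  qed
  moreover have \<mu>I: "\<mu> \<in> cspace {..<2 * r}" using \<mu>(1) polydisc_subset_cspace unfolding U by blast
  ultimately show ?thesis
    unfolding algebraic_multifun_def
  proof (intro exI[of _ n] exI[of _ q] conjI ballI allI impI)
    show "\<exists>\<mu>\<in>cspace {..<2 * r}. q n \<mu> \<noteq> 0" using \<mu>(2) \<mu>I by (rule bexI)
  next
    fix \<nu> y assume \<nu>: "\<nu> \<in> U" and "y \<in> (\<lambda>w. \<beta> \<nu> w p) ` W \<nu>"
    then obtain w where "w \<in> W \<nu>" "y = \<beta> \<nu> w p" by (elim imageE)
    with eq[OF \<nu>] show "(\<Sum>k\<le>n. q k \<nu> * y ^ k) = 0" by simp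
  qed (use q in simp_all)
qed

text \<open>Joint continuity of \<open>\<beta>\<close> at the finitely many points \<open>(\<mu>, w)\<close> over \<open>\<mu>\<close> gives common radii; transport of values
supplies for each node vector at one of two neighbouring points a close one at the other.\<close>

lemma solution_continuous_multifun:
  fixes r :: nat
  assumes U: "U = polydisc {..<2 * r} c e"
    and W: "\<And>\<mu>. \<mu> \<in> U \<Longrightarrow> W \<mu> \<noteq> {}" "\<And>\<mu>. \<mu> \<in> U \<Longrightarrow> finite (W \<mu>)" "\<And>\<mu>. \<mu> \<in> U \<Longrightarrow> W \<mu> \<subseteq> cspace {1..r}"
    and transport: "\<And>\<mu> \<rho>. \<mu> \<in> U \<Longrightarrow> 0 < \<rho> \<Longrightarrow> \<exists>d>0. \<forall>\<nu>\<in>polydisc {..<2 * r} \<mu> d. \<forall>\<nu>'\<in>polydisc {..<2 * r} \<mu> d.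
      \<nu>' \<in> U \<and> (\<forall>w\<in>W \<nu>. \<exists>w'\<in>W \<nu>'. \<forall>i\<in>{1..r}. dist (w i) (w' i) < \<rho>)"
    and cont: "continuous_on (SIGMA \<mu>:U. W \<mu>) (\<lambda>(\<mu>, w). \<beta> \<mu> w p)"
  shows "continuous_multifun U (\<lambda>\<mu>. (\<lambda>w. \<beta> \<mu> w p) ` W \<mu>)"
  unfolding continuous_multifun_def
proof (intro ballI conjI allI impI)
  fix \<mu> assume \<mu>: "\<mu> \<in> U"
  show "(\<lambda>w. \<beta> \<mu> w p) ` W \<mu> \<noteq> {}" "finite ((\<lambda>w. \<beta> \<mu> w p) ` W \<mu>)" using W[OF \<mu>] by simp_all
  fix \<epsilon> :: real assume \<epsilon>: "\<epsilon> > 0"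
  have \<mu>I: "\<mu> \<in> cspace {..<2 * r}" using \<mu> polydisc_subset_cspace unfolding U by blast
  have "\<exists>t. 0 < fst t \<and> 0 < snd t \<and> (\<forall>\<nu>\<in>polydisc {..<2 * r} \<mu> (fst t). \<forall>w'\<in>W \<nu>. \<nu> \<in> U \<longrightarrow>
      (\<forall>i\<in>{1..r}. dist (w i) (w' i) < snd t) \<longrightarrow> dist (\<beta> \<nu> w' p) (\<beta> \<mu> w p) < \<epsilon>)" if w: "w \<in> W \<mu>" for w
  proof -
    have \<mu>w: "(\<mu>, w) \<in> (SIGMA \<mu>:U. W \<mu>)" using \<mu> w by simp
    have "\<beta> \<mu> w p \<in> ball (\<beta> \<mu> w p) \<epsilon>" using \<epsilon> by simp
    then have "(\<lambda>(\<mu>, w). \<beta> \<mu> w p) (\<mu>, w) \<in> ball (\<beta> \<mu> w p) \<epsilon>" by (simp only: prod.case)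
    from mp[OF mp[OF spec[OF bspec[OF cont[unfolded continuous_on_topological] \<mu>w]] open_ball] this]
    obtain A where A: "open A" "(\<mu>, w) \<in> A"
      "\<forall>y\<in>(SIGMA \<mu>:U. W \<mu>). y \<in> A \<longrightarrow> (\<lambda>(\<mu>, w). \<beta> \<mu> w p) y \<in> ball (\<beta> \<mu> w p) \<epsilon>"
      by (elim exE conjE)
    obtain A1 A2 where A12: "open A1" "open A2" "\<mu> \<in> A1" "w \<in> A2" "A1 \<times> A2 \<subseteq> A"
      using A(2) by (rule open_prod_elim[OF A(1)]) (elim SigmaE2)
    have op: "openin (top_of_set (cspace {..<2 * r})) (cspace {..<2 * r} \<inter> A1)"
      "openin (top_of_set (cspace {1..r})) (cspace {1..r} \<inter> A2)"
      by (rule openin_open_Int[OF A12(1)], rule openin_open_Int[OF A12(2)])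
    have \<mu>A: "\<mu> \<in> cspace {..<2 * r} \<inter> A1" using \<mu>I A12(3) by blast
    have wA: "w \<in> cspace {1..r} \<inter> A2" using w W(3)[OF \<mu>] A12(4) by blast
    obtain d where d: "d > 0" "polydisc {..<2 * r} \<mu> d \<subseteq> cspace {..<2 * r} \<inter> A1"
      using openin_contains_polydisc[OF finite_lessThan op(1) \<mu>A] by (elim exE conjE)
    obtain \<rho> where \<rho>: "\<rho> > 0" "polydisc {1..r} w \<rho> \<subseteq> cspace {1..r} \<inter> A2"
      using openin_contains_polydisc[OF finite_atLeastAtMost op(2) wA] by (elim exE conjE)
    have "dist (\<beta> \<nu> w' p) (\<beta> \<mu> w p) < \<epsilon>"
      if \<nu>: "\<nu> \<in> polydisc {..<2 * r} \<mu> d" "\<nu> \<in> U" and w': "w' \<in> W \<nu>" "\<forall>i\<in>{1..r}. dist (w i) (w' i) < \<rho>" for \<nu> w'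
    proof -
      have "w' \<in> polydisc {1..r} w \<rho>" unfolding mem_polydisc using w' W(3)[OF \<nu>(2)] by blast
      then have "(\<nu>, w') \<in> A" using d(2) \<rho>(2) \<nu>(1) A12(5) by blast
      moreover have "(\<nu>, w') \<in> (SIGMA \<mu>:U. W \<mu>)" using \<nu>(2) w'(1) by simp
      ultimately have "\<beta> \<nu> w' p \<in> ball (\<beta> \<mu> w p) \<epsilon>" using A(3) by fastforce
      then show ?thesis by (simp add: dist_commute)
    qed
    with d(1) \<rho>(1) show ?thesis by (intro exI[of _ "(d, \<rho>)"] conjI ballI impI) simp_all
  qed
  then have "\<forall>w\<in>W \<mu>. \<exists>t. 0 < fst t \<and> 0 < snd t \<and> (\<forall>\<nu>\<in>polydisc {..<2 * r} \<mu> (fst t). \<forall>w'\<in>W \<nu>. \<nu> \<in> U \<longrightarrow>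
      (\<forall>i\<in>{1..r}. dist (w i) (w' i) < snd t) \<longrightarrow> dist (\<beta> \<nu> w' p) (\<beta> \<mu> w p) < \<epsilon>)"
    by (rule ballI)
  from bchoice[OF this] obtain T where T: "\<forall>w\<in>W \<mu>. 0 < fst (T w) \<and> 0 < snd (T w) \<and>
      (\<forall>\<nu>\<in>polydisc {..<2 * r} \<mu> (fst (T w)). \<forall>w'\<in>W \<nu>. \<nu> \<in> U \<longrightarrow>
      (\<forall>i\<in>{1..r}. dist (w i) (w' i) < snd (T w)) \<longrightarrow> dist (\<beta> \<nu> w' p) (\<beta> \<mu> w p) < \<epsilon>)" by (rule exE)
  define d where "d = Min ((\<lambda>w. fst (T w)) ` W \<mu>)"
  define \<rho> where "\<rho> = Min ((\<lambda>w. snd (T w)) ` W \<mu>)"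
  have d: "d > 0" "\<And>w. w \<in> W \<mu> \<Longrightarrow> d \<le> fst (T w)"
    and \<rho>: "\<rho> > 0" "\<And>w. w \<in> W \<mu> \<Longrightarrow> \<rho> \<le> snd (T w)"
    using W(1,2)[OF \<mu>] T by (simp_all add: d_def \<rho>_def)
  have close: "dist (\<beta> \<nu> w' p) (\<beta> \<mu> w p) < \<epsilon>"
    if "\<nu> \<in> polydisc {..<2 * r} \<mu> d" "\<nu> \<in> U" "w \<in> W \<mu>" "w' \<in> W \<nu>" and lt: "\<forall>i\<in>{1..r}. dist (w i) (w' i) < \<rho>" for \<nu> w w'
  proof -
    have "\<nu> \<in> polydisc {..<2 * r} \<mu> (fst (T w))" using polydisc_mono[OF d(2)[OF that(3)]] that(1) by blast
    moreover have "\<forall>i\<in>{1..r}. dist (w i) (w' i) < snd (T w)" using lt \<rho>(2)[OF that(3)] by fastforce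
    ultimately show ?thesis using bspec[OF T that(3)] that(2,4) by (elim conjE) (drule (1) bspec, drule (1) bspec, drule (1) mp, drule (1) mp)
  qed
  obtain d' where d': "d' > 0" and tr: "\<forall>\<nu>\<in>polydisc {..<2 * r} \<mu> d'. \<forall>\<nu>'\<in>polydisc {..<2 * r} \<mu> d'.
      \<nu>' \<in> U \<and> (\<forall>w\<in>W \<nu>. \<exists>w'\<in>W \<nu>'. \<forall>i\<in>{1..r}. dist (w i) (w' i) < \<rho>)"
    using transport[OF \<mu> \<rho>(1)] by (elim exE conjE)
  define N where "N = polydisc {..<2 * r} \<mu> (min d d')"
  have N: "N \<subseteq> polydisc {..<2 * r} \<mu> d" "N \<subseteq> polydisc {..<2 * r} \<mu> d'"
    unfolding N_def by (rule polydisc_mono, simp)+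
  have \<mu>d': "\<mu> \<in> polydisc {..<2 * r} \<mu> d'" by (rule centre_in_polydisc[OF \<mu>I d'])
  have NU: "N \<subseteq> U" using tr \<mu>d' N(2) by blast
  have "openin (top_of_set U) N"
  proof (rule openin_subset_trans[OF _ NU])
    show "openin (top_of_set (cspace {..<2 * r})) N" unfolding N_def by (rule openin_polydisc) simp
    show "U \<subseteq> cspace {..<2 * r}" unfolding U by (rule polydisc_subset_cspace)
  qed
  moreover have "\<mu> \<in> N" unfolding N_def by (rule centre_in_polydisc[OF \<mu>I]) (use d(1) d' in simp)
  ultimately have "\<forall>\<^sub>F \<nu> in at \<mu> within U. \<nu> \<in> N" by (rule eventually_openin_within)
  then show "\<forall>\<^sub>F \<nu> in at \<mu> within U.
      (\<forall>y\<in>(\<lambda>w. \<beta> \<mu> w p) ` W \<mu>. \<exists>z\<in>(\<lambda>w. \<beta> \<nu> w p) ` W \<nu>. dist y z < \<epsilon>) \<and>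
      (\<forall>z\<in>(\<lambda>w. \<beta> \<nu> w p) ` W \<nu>. \<exists>y\<in>(\<lambda>w. \<beta> \<mu> w p) ` W \<mu>. dist y z < \<epsilon>)"
  proof eventually_elim
    case (elim \<nu>)
    have \<nu>: "\<nu> \<in> polydisc {..<2 * r} \<mu> d" "\<nu> \<in> polydisc {..<2 * r} \<mu> d'" "\<nu> \<in> U" using elim N NU by blast+
    have 1: "\<exists>w'\<in>W \<nu>. \<forall>i\<in>{1..r}. dist (w i) (w' i) < \<rho>" if "w \<in> W \<mu>" for w
      using bspec[OF bspec[OF tr \<mu>d'] \<nu>(2)] that by blast
    have 2: "\<exists>w\<in>W \<mu>. \<forall>i\<in>{1..r}. dist (w' i) (w i) < \<rho>" if "w' \<in> W \<nu>" for w'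
      using bspec[OF bspec[OF tr \<nu>(2)] \<mu>d'] that by blast
    show ?case
    proof (intro conjI ballI)
      fix y assume "y \<in> (\<lambda>w. \<beta> \<mu> w p) ` W \<mu>"
      then obtain w where w: "w \<in> W \<mu>" "y = \<beta> \<mu> w p" by (elim imageE)
      obtain w' where w': "w' \<in> W \<nu>" "\<forall>i\<in>{1..r}. dist (w i) (w' i) < \<rho>" using 1[OF w(1)] by (elim bexE)
      have "dist y (\<beta> \<nu> w' p) < \<epsilon>"
        unfolding w(2) using close[OF \<nu>(1,3) w(1) w'] by (simp add: dist_commute)
      then show "\<exists>z\<in>(\<lambda>w. \<beta> \<nu> w p) ` W \<nu>. dist y z < \<epsilon>" using w'(1) by blast
    next
      fix z assume "z \<in> (\<lambda>w. \<beta> \<nu> w p) ` W \<nu>"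
      then obtain w' where w': "w' \<in> W \<nu>" "z = \<beta> \<nu> w' p" by (elim imageE)
      obtain w where w: "w \<in> W \<mu>" "\<forall>i\<in>{1..r}. dist (w' i) (w i) < \<rho>" using 2[OF w'(1)] by (elim bexE)
      have "\<forall>i\<in>{1..r}. dist (w i) (w' i) < \<rho>" using w(2) by (simp add: dist_commute)
      from close[OF \<nu>(1,3) w(1) w'(1) this] have "dist (\<beta> \<mu> w p) z < \<epsilon>"
        unfolding w'(2) by (simp add: dist_commute)
      then show "\<exists>y\<in>(\<lambda>w. \<beta> \<mu> w p) ` W \<mu>. dist y z < \<epsilon>" using w(1) by blast
    qed
  qed
qed

theorem theorem6p13:
  fixes r d :: nat and \<mu>0 w0 :: cvec and g0 :: functional and \<C> :: "nat set set"
  assumes "1 \<le> r" and "r \<le> d"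
    and "\<mu>0 \<in> Sigma_r_star d r"
    and "prony_solution r \<mu>0 w0 g0"
    and "partition_on {1..r} \<C>"
    and "subordinated r w0 \<C>"
  shows "\<exists>\<epsilon>0>0. \<forall>\<epsilon>. 0 < \<epsilon> \<and> \<epsilon> \<le> \<epsilon>0 \<longrightarrow>
    (let U = polydisc {..<2 * r} \<mu>0 \<epsilon> in
     \<forall>\<mu>1\<in>U. \<forall>x. node_germ r w0 \<mu>1 x \<longrightarrow>
       (let W = node_values r U \<mu>1 x in
        \<exists>\<beta> :: cvec \<Rightarrow> cvec \<Rightarrow> nat set \<times> nat \<Rightarrow> complex.
          (\<forall>\<mu>\<in>U. \<forall>w\<in>W \<mu>.
             bij_betw (B_combination \<C> w) (conf_index \<C> \<rightarrow>\<^sub>E UNIV) (V_space r w) \<and>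
             (\<forall>b. solves_linear_system r \<C> \<mu> w b \<longleftrightarrow> b = \<beta> \<mu> w)) \<and>
          (\<forall>p\<in>conf_index \<C>.
             algebraic_multifun {..<2 * r} U (\<lambda>\<mu>. (\<lambda>w. \<beta> \<mu> w p) ` W \<mu>) \<and>
             continuous_multifun U (\<lambda>\<mu>. (\<lambda>w. \<beta> \<mu> w p) ` W \<mu>) \<and>
             continuous_on (SIGMA \<mu>:U. W \<mu>) (\<lambda>(\<mu>, w). \<beta> \<mu> w p))))"
proof -
  note r = assms(1) and C = assms(5)
  define I where "I = {..<2 * r}"
  obtain \<mu>s where \<mu>s: "\<mu>s \<in> Sigma_r d r" "\<mu>0 = restrict \<mu>s {..<2 * r}"
    using assms(3) unfolding Sigma_r_star_def by (elim imageE)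
  have h0: "hdet r \<mu>0 \<noteq> 0"
    using \<mu>s(1) unfolding \<mu>s(2) hdet_restrict by (simp add: Sigma_r_def hdet_def)
  have \<mu>0: "\<mu>0 \<in> cspace {..<2 * r}" unfolding \<mu>s(2) by (simp add: cspace_def)
  have n0: "nodes r \<mu>0 w0" using assms(4) by (rule prony_solution_nodes)
  define S where "S = w0 ` {1..r}"
  \<comment> \<open>The factor \<open>6\<close> makes the clusters of radius \<open>\<sigma>\<close> compatible with the enumeration of the roots, for which
    only a distance of at most a third of the gaps is known.\<close>
  obtain \<sigma> where \<sigma>: "\<sigma> > 0" and sep: "\<forall>a\<in>S. \<forall>b\<in>S. a \<noteq> b \<longrightarrow> 6 * \<sigma> \<le> dist a b"
  proof -
    have "finite S" "inj_on (\<lambda>z. z) S" by (simp_all add: S_def)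
    from separation_exists[OF this] obtain \<tau> where \<tau>: "\<tau> > 0" "\<forall>a\<in>S. \<forall>b\<in>S. a \<noteq> b \<longrightarrow> 3 * \<tau> \<le> dist a b"
      by (elim exE conjE)
    have "6 * (\<tau> / 2) = 3 * \<tau>" by simp
    with \<tau> show thesis by (intro that[of "\<tau> / 2"]) simp_all
  qed
  have sep2: "2 * \<sigma> \<le> dist a b" if "a \<in> S" "b \<in> S" "a \<noteq> b" for a b
  proof -
    have "6 * \<sigma> \<le> dist a b" using sep that by blast
    then show ?thesis using \<sigma> by linarith
  qed
  obtain \<epsilon>0 where \<epsilon>0: "\<epsilon>0 > 0" and roots: "\<forall>\<nu>\<in>polydisc I \<mu>0 \<epsilon>0. hdet r \<nu> \<noteq> 0 \<and>
      (\<forall>z. poly (den r \<nu>) z = 0 \<longrightarrow> (\<exists>j\<in>{1..r}. dist z (w0 j) < \<sigma>)) \<and>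
      (\<forall>j\<in>{1..r}. \<exists>z. poly (den r \<nu>) z = 0 \<and> dist z (w0 j) < \<sigma>)"
    using roots_near[OF r \<mu>0 h0 n0 \<sigma>] unfolding I_def by (elim exE conjE)
  show ?thesis
    unfolding Let_def
  proof (rule exI[of _ \<epsilon>0], rule conjI[OF \<epsilon>0], intro allI impI ballI)
    fix \<epsilon> \<mu>1 x assume \<epsilon>: "0 < \<epsilon> \<and> \<epsilon> \<le> \<epsilon>0" and \<mu>1: "\<mu>1 \<in> polydisc {..<2 * r} \<mu>0 \<epsilon>"
      and germ: "node_germ r w0 \<mu>1 x"
    define U where "U = polydisc I \<mu>0 \<epsilon>"
    define W where "W = node_values r U \<mu>1 x"
    have UI: "U \<subseteq> cspace I" unfolding U_def by (rule polydisc_subset_cspace)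
    have U0: "U \<subseteq> polydisc I \<mu>0 \<epsilon>0" unfolding U_def using \<epsilon> by (intro polydisc_mono) simp
    have hU: "hdet r \<nu> \<noteq> 0" if "\<nu> \<in> U" for \<nu> using roots U0 that by blast
    have rootU: "\<exists>\<tau>\<in>S. dist (w i) \<tau> < \<sigma>" if "\<nu> \<in> U" "nodes r \<nu> w" "i \<in> {1..r}" for \<nu> w i
    proof -
      have *: "\<nu> \<in> polydisc I \<mu>0 \<epsilon>0" using that(1) U0 by blast
      have "poly (den r \<nu>) (w i) = 0" using root_den_iff[OF that(2) hU[OF that(1)]] that(3) by blast
      then show ?thesis using bspec[OF roots *] unfolding S_def by blast
    qed
    have \<mu>1U: "\<mu>1 \<in> U" using \<mu>1 unfolding U_def I_def .
    obtain N where N: "holomorphic_map {..<2 * r} {1..r} N x" "\<mu>1 \<in> N"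
      "\<forall>\<mu>\<in>N. \<exists>P. is_pade r \<mu> P (\<Prod>j\<in>{1..r}. [:- x \<mu> j, 1:])"
      and inj: "inj_on (x \<mu>1) {1..r}"
      and cl: "\<forall>i\<in>{1..r}. \<forall>a\<in>{1..r}. \<forall>b\<in>{1..r}. w0 a \<noteq> w0 b \<longrightarrow> cmod (x \<mu>1 i - w0 i) \<le> cmod (w0 a - w0 b) / 3"
      using germ unfolding node_germ_def by (elim exE conjE)
    have nN: "nodes r \<mu> (x \<mu>)" if \<mu>N: "\<mu> \<in> N" for \<mu>
      unfolding nodes_def
    proof (intro conjI allI impI)
      show "x \<mu> \<in> cspace {1..r}" using N(1) \<mu>N unfolding holomorphic_map_def image_subset_iff by (elim conjE) (drule (1) bspec)
      fix i assume i: "i < r"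
      obtain P where "is_pade r \<mu> P (npoly r (x \<mu>))" using bspec[OF N(3) \<mu>N] unfolding npoly_def by (rule exE)
      from pade_recurrence[OF this r i] show "(\<Sum>k\<le>r. coeff (npoly r (x \<mu>)) k * \<mu> (k + i)) = 0" .
    qed
    have ng: "nodes_germ r x \<mu>1"
    proof -
      have "openin (top_of_set (cspace {..<2 * r})) N" using N(1) unfolding holomorphic_map_def by (rule conjunct1)
      from openin_contains_polydisc[OF finite_lessThan this N(2)] show ?thesis
        unfolding nodes_germ_def using nN by blast
    qed
    have n1: "nodes r \<mu>1 (x \<mu>1)" by (rule nN[OF N(2)])
    have d1: "disc r \<mu>1 \<noteq> 0" using disc_nonzero_iff[OF n1 hU[OF \<mu>1U]] inj by simp
    have close1: "dist (x \<mu>1 i) (w0 i) < \<sigma>" if i: "i \<in> {1..r}" for i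
    proof -
      obtain \<tau> where "\<tau> \<in> S" "dist (x \<mu>1 i) \<tau> < \<sigma>" using rootU[OF \<mu>1U n1 i] by (elim bexE)
      then obtain a where a: "a \<in> {1..r}" "dist (x \<mu>1 i) (w0 a) < \<sigma>" unfolding S_def by (elim imageE) simp
      \<comment> \<open>The root lies within a third of the gap from \<open>w0 i\<close> and within a sixth from \<open>w0 a\<close>, so both are the same.\<close>
      have "w0 a = w0 i"
      proof (rule ccontr)
        assume ne: "w0 a \<noteq> w0 i"
        have "dist (x \<mu>1 i) (w0 i) \<le> dist (w0 a) (w0 i) / 3"
          using cl i a(1) ne unfolding dist_norm by blast
        moreover have "6 * \<sigma> \<le> dist (w0 a) (w0 i)" using sep a(1) i ne unfolding S_def by blast
        ultimately show False using a(2) \<sigma> dist_triangle3[of "w0 a" "w0 i" "x \<mu>1 i"] by linarith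
      qed
      then show ?thesis using a(2) by simp
    qed
    have W: "nodes r \<mu> w \<and> subordinated r w \<C>" if \<mu>: "\<mu> \<in> U" and w: "w \<in> W \<mu>" for \<mu> w
    proof -
      have "w \<in> continuation_values {..<2 * r} {1..r} U \<mu>1 x \<mu>" using w unfolding W_def .
      from continuation_value_path[OF UI[unfolded I_def] ng this]
      obtain \<gamma> Y where \<gamma>: "\<gamma> ` {0..1} \<subseteq> U" "\<gamma> 1 = \<mu>" and Y: "Y 0 = x \<mu>1" "Y 1 = w"
        and nY: "\<forall>t\<in>{0..1}. nodes r (\<gamma> t) (Y t)" and cY: "\<forall>j. continuous_on {0..1 :: real} (\<lambda>t. Y t j)"
        by (elim exE conjE)
      have 01: "(0 :: real) \<in> {0..1}" "(1 :: real) \<in> {0..1}" by simp_all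
      have conn: "connected {0..1 :: real}" by simp
      have "dist (w i) (w0 i) < \<sigma>" if i: "i \<in> {1..r}" for i
      proof -
        have near: "\<exists>\<tau>\<in>S. dist (Y t i) \<tau> < \<sigma>" if t: "t \<in> {0..1}" for t
          by (rule rootU[OF _ bspec[OF nY t] i]) (use \<gamma>(1) t in blast)
        have S: "w0 i \<in> S" using i by (simp add: S_def)
        have 0: "dist (Y 0 i) (w0 i) < \<sigma>" unfolding Y by (rule close1[OF i])
        have "dist (Y 1 i) (w0 i) < \<sigma>"
          by (rule cluster_persists[where h = "\<lambda>t. Y t i", OF spec[OF cY] conn sep2 near S 0 01])
        then show ?thesis unfolding Y .
      qed
      then have "subordinated r w \<C>"
        using sep2 by (intro subordinated_near[OF assms(6), of \<sigma>]) (simp_all add: S_def)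
      moreover have "nodes r \<mu> w" using bspec[OF nY 01(2)] unfolding \<gamma>(2) Y(2) .
      ultimately show ?thesis by (intro conjI)
    qed
    \<comment> \<open>The solution is unique if \<open>w \<in> W \<mu>\<close>; at other pairs the value is arbitrary.\<close>
    define \<beta> where "\<beta> \<mu> w = (THE b. solves_linear_system r \<C> \<mu> w b)" for \<mu> w
    have ex1: "\<exists>!b. solves_linear_system r \<C> \<mu> w b" if "\<mu> \<in> U" "w \<in> W \<mu>" for \<mu> w
      using W[OF that] by (intro linear_system_unique_solution[OF C]) simp_all
    have sol: "solves_linear_system r \<C> \<mu> w (\<beta> \<mu> w)" if "\<mu> \<in> U" "w \<in> W \<mu>" for \<mu> w
      unfolding \<beta>_def by (rule theI'[OF ex1[OF that]])
    have ne: "W \<mu> \<noteq> {}" if \<mu>: "\<mu> \<in> U" for \<mu>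
    proof -
      have "\<exists>w. w \<in> continuation_values {..<2 * r} {1..r} (polydisc {..<2 * r} \<mu>0 \<epsilon>) \<mu>1 x \<mu>"
        by (rule continuation_value_exists[OF r _ _ _ d1 N(1,2) ng])
           (use \<mu> \<mu>1U hU in \<open>simp_all add: U_def I_def\<close>)
      then show ?thesis unfolding W_def U_def I_def by blast
    qed
    have fin: "finite (W \<mu>)" if \<mu>: "\<mu> \<in> U" for \<mu>
      by (rule finite_subset[OF _ finite_nodes[OF hU[OF \<mu>]]]) (use W[OF \<mu>] in blast)
    have Wc: "W \<mu> \<subseteq> cspace {1..r}" for \<mu> unfolding W_def continuation_values_def by blast
    have transport: "\<exists>d>0. \<forall>\<nu>\<in>polydisc {..<2 * r} \<mu> d. \<forall>\<nu>'\<in>polydisc {..<2 * r} \<mu> d.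
        \<nu>' \<in> U \<and> (\<forall>w\<in>W \<nu>. \<exists>w'\<in>W \<nu>'. \<forall>i\<in>{1..r}. dist (w i) (w' i) < \<rho>)"
      if \<mu>: "\<mu> \<in> U" and \<rho>: "0 < \<rho>" for \<mu> \<rho>
      unfolding W_def U_def I_def
      by (rule values_transport[OF r _ _ d1 ng _ \<rho>]) (use \<mu> \<mu>1U hU in \<open>simp_all add: U_def I_def\<close>)
    have cont: "continuous_on (SIGMA \<mu>:U. W \<mu>) (\<lambda>(\<mu>, w). \<beta> \<mu> w p)" if p: "p \<in> conf_index \<C>" for p
      by (rule solution_continuous[OF C _ p]) (use W sol in blast)
    have U': "U = polydisc {..<2 * r} \<mu>0 \<epsilon>" unfolding U_def I_def ..
    have result: "(\<forall>\<mu>\<in>U. \<forall>w\<in>W \<mu>.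
             bij_betw (B_combination \<C> w) (conf_index \<C> \<rightarrow>\<^sub>E UNIV) (V_space r w) \<and>
             (\<forall>b. solves_linear_system r \<C> \<mu> w b \<longleftrightarrow> b = \<beta> \<mu> w)) \<and>
          (\<forall>p\<in>conf_index \<C>.
             algebraic_multifun {..<2 * r} U (\<lambda>\<mu>. (\<lambda>w. \<beta> \<mu> w p) ` W \<mu>) \<and>
             continuous_multifun U (\<lambda>\<mu>. (\<lambda>w. \<beta> \<mu> w p) ` W \<mu>) \<and>
             continuous_on (SIGMA \<mu>:U. W \<mu>) (\<lambda>(\<mu>, w). \<beta> \<mu> w p))"
    proof (rule conjI; intro ballI conjI allI)
      fix \<mu> w assume \<mu>w: "\<mu> \<in> U" "w \<in> W \<mu>"
      show "bij_betw (B_combination \<C> w) (conf_index \<C> \<rightarrow>\<^sub>E UNIV) (V_space r w)"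
        by (rule B_combination_bij[OF C conjunct2[OF W[OF \<mu>w]] r])
      show "solves_linear_system r \<C> \<mu> w b \<longleftrightarrow> b = \<beta> \<mu> w" for b
        using ex1[OF \<mu>w] sol[OF \<mu>w] by blast
    next
      fix p assume p: "p \<in> conf_index \<C>"
      show "algebraic_multifun {..<2 * r} U (\<lambda>\<mu>. (\<lambda>w. \<beta> \<mu> w p) ` W \<mu>)"
        by (rule solution_algebraic[OF C U' conjunct1[OF \<epsilon>] ne sol p])
      show "continuous_multifun U (\<lambda>\<mu>. (\<lambda>w. \<beta> \<mu> w p) ` W \<mu>)"
        by (rule solution_continuous_multifun[where U = U and W = W and \<beta> = \<beta> and p = p, OF U'],
            erule ne, erule fin, rule Wc, erule (1) transport, rule cont[OF p])
      show "continuous_on (SIGMA \<mu>:U. W \<mu>) (\<lambda>(\<mu>, w). \<beta> \<mu> w p)" by (rule cont[OF p])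
    qed
    show "\<exists>\<beta> :: cvec \<Rightarrow> cvec \<Rightarrow> nat set \<times> nat \<Rightarrow> complex.
          (\<forall>\<mu>\<in>polydisc {..<2 * r} \<mu>0 \<epsilon>. \<forall>w\<in>node_values r (polydisc {..<2 * r} \<mu>0 \<epsilon>) \<mu>1 x \<mu>.
             bij_betw (B_combination \<C> w) (conf_index \<C> \<rightarrow>\<^sub>E UNIV) (V_space r w) \<and>
             (\<forall>b. solves_linear_system r \<C> \<mu> w b \<longleftrightarrow> b = \<beta> \<mu> w)) \<and>
          (\<forall>p\<in>conf_index \<C>.
             algebraic_multifun {..<2 * r} (polydisc {..<2 * r} \<mu>0 \<epsilon>)
               (\<lambda>\<mu>. (\<lambda>w. \<beta> \<mu> w p) ` node_values r (polydisc {..<2 * r} \<mu>0 \<epsilon>) \<mu>1 x \<mu>) \<and>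
             continuous_multifun (polydisc {..<2 * r} \<mu>0 \<epsilon>)
               (\<lambda>\<mu>. (\<lambda>w. \<beta> \<mu> w p) ` node_values r (polydisc {..<2 * r} \<mu>0 \<epsilon>) \<mu>1 x \<mu>) \<and>
             continuous_on (SIGMA \<mu>:polydisc {..<2 * r} \<mu>0 \<epsilon>. node_values r (polydisc {..<2 * r} \<mu>0 \<epsilon>) \<mu>1 x \<mu>)
               (\<lambda>(\<mu>, w). \<beta> \<mu> w p))"
      by (rule exI[of _ \<beta>]) (rule result[unfolded W_def U'])
  qed
qed

end
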